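(* Let $0\le n\le N$ with $N$ even and let $r$ be a Young diagram in an $(N-n)\times n$ rectangle all of whose outer corners $(x,y)$ satisfy $x+y-1=d$ for the same $d$ (equivalently, the Schubert variety $X^r\subseteq Gr(n,N)$ is Gorenstein), and let $\sigma_r=f_{G/P}^*\,\mathcal O(N/2-d-1)$ on the conormal Schubert variety $CX^r$. If the map $\mu:CX^r\to\mu(CX^r)$ has general fibers that are not points, then $H^0(CX^r;\sigma_r)=0$.
   Context: Young diagrams $r$ in the $(N-n)\times n$ rectangle correspond to subsets $r\in\binom{[N]}{n}$, $[N]=\{1,\dots,N\}$, by numbering the boundary steps from bottom left to top right and recording the steps to the right. Outer corners are the removable boxes of the diagram, $(x,y)$ being the (row/column, starting from $1$) position of such a box, so $x+y-1$ is its diagonal. The Schubert variety is $X^r=\{V\in Gr(n,N): p_s(V)=0\text{ unless } s\subseteq r\}$, where $p_s$ are Plücker coordinates and $s\subseteq r$ is inclusion of Young diagrams (equivalently $r_i\le s_i$ for all $i$, elements ordered increasingly); $X^r_\circ=X^r\cap\{p_r\neq 0\}$ is the Schubert cell. $T^*Gr(n,N)=\{(V,u)\in Gr(n,N)\times\mathrm{Mat}(N): \mathrm{Im}\,u\subseteq V\subseteq\mathrm{Ker}\,u\}$; $CX^r\subseteq T^*Gr(n,N)$ is the closure of the conormal bundle of $X^r_\circ$; $f_{G/P}:CX^r\to X^r\subseteq Gr(n,N)$ is the projection $(V,u)\mapsto V$; $\mu:CX^r\to\mathrm{Mat}(N)$ is the projection $(V,u)\mapsto u^T$ (the transpose of $u$);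 $\mathcal O(1)$ is the Plücker line bundle. *)

theory Defs
  imports
    "HOL-Analysis.Abstract_Topology"
    "Jordan_Normal_Form.DL_Rank"
    "Jordan_Normal_Form.DL_Submatrix"
    "Jordan_Normal_Form.Matrix_Kernel"
begin

section \<open>Young diagrams\<close>

text \<open>
  Diagrams are sets of boxes (row, column) in English notation: both indices start at 1 and the
  box (1, 1) is the top left one. The rectangle has N - n rows and n columns.
\<close>

definition young_diagram :: "nat \<Rightarrow> nat \<Rightarrow> (nat \<times> nat) set \<Rightarrow> bool" where
  "young_diagram n N D \<longleftrightarrow>
     D \<subseteq> {1..N - n} \<times> {1..n} \<and>
     (\<forall>x y x' y'. (x, y) \<in> D \<and> 1 \<le> x' \<and> x' \<le> x \<and> 1 \<le> y' \<and> y' \<le> y \<longrightarrow> (x', y') \<in> D)"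

definition outer_corners :: "nat \<Rightarrow> nat \<Rightarrow> (nat \<times> nat) set \<Rightarrow> (nat \<times> nat) set" where
  "outer_corners n N D = {b \<in> D. young_diagram n N (D - {b})}"

text \<open>
  The boundary path of D runs from the bottom left to the top right of the rectangle; its N steps
  are numbered from 1. Its y-th step to the right runs below column y and is preceded by y - 1
  steps to the right and by one step up for each box of the rectangle missing from column y.
\<close>

definition right_steps :: "nat \<Rightarrow> nat \<Rightarrow> (nat \<times> nat) set \<Rightarrow> nat set" where
  "right_steps n N D = (\<lambda>y. (N - n - card {x. (x, y) \<in> D}) + y) ` {1..n}"


section \<open>Grassmannian, frames and Pluecker coordinates\<close>

definition Gr :: "nat \<Rightarrow> nat \<Rightarrow> complex vec set set" where
  "Gr n N = {V. subspace class_ring V (module_vec TYPE(complex) N) \<and>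
     vectorspace.dim class_ring ((module_vec TYPE(complex) N)\<lparr>carrier := V\<rparr>) = n}"

text \<open>
  For V in Gr n N, the matrices with n columns and column space V are the ordered bases of V.
  The frame bundle of the Grassmannian is a principal GL(n)-bundle, locally trivial in the Zariski
  topology; below, subvarieties of and functions on the Grassmannian are described by their
  pullbacks to it.
\<close>

definition frames :: "nat \<Rightarrow> nat \<Rightarrow> complex vec set \<Rightarrow> complex mat set" where
  "frames n N V = {A \<in> carrier_mat N n. vec_space.col_space N A = V}"

text \<open>The index set of a diagram is 1-based, the rows of a matrix are 0-based.\<close>

definition plucker :: "nat \<Rightarrow> nat \<Rightarrow> (nat \<times> nat) set \<Rightarrow> complex mat \<Rightarrow> complex" where
  "plucker n N s A = det (submatrix A {i. Suc i \<in> right_steps n N s} UNIV)"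

definition schubert_variety :: "nat \<Rightarrow> nat \<Rightarrow> (nat \<times> nat) set \<Rightarrow> complex vec set set" where
  "schubert_variety n N r = {V \<in> Gr n N.
     \<forall>s. young_diagram n N s \<and> \<not> s \<subseteq> r \<longrightarrow> (\<forall>A \<in> frames n N V. plucker n N s A = 0)}"

definition schubert_cell :: "nat \<Rightarrow> nat \<Rightarrow> (nat \<times> nat) set \<Rightarrow> complex vec set set" where
  "schubert_cell n N r =
     {V \<in> schubert_variety n N r. \<forall>A \<in> frames n N V. plucker n N r A \<noteq> 0}"


section \<open>Polynomial functions and Zariski topologies\<close>

inductive_set polynomial_functions :: "('a \<Rightarrow> complex) set \<Rightarrow> ('a \<Rightarrow> complex) set"
  for X :: "('a \<Rightarrow> complex) set" where
  const: "(\<lambda>_. c) \<in> polynomial_functions X"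
| coord: "f \<in> X \<Longrightarrow> f \<in> polynomial_functions X"
| add: "f \<in> polynomial_functions X \<Longrightarrow> g \<in> polynomial_functions X \<Longrightarrow>
    (\<lambda>p. f p + g p) \<in> polynomial_functions X"
| mult: "f \<in> polynomial_functions X \<Longrightarrow> g \<in> polynomial_functions X \<Longrightarrow>
    (\<lambda>p. f p * g p) \<in> polynomial_functions X"

definition zariski :: "('a \<Rightarrow> complex) set \<Rightarrow> 'a set \<Rightarrow> 'a topology" where
  "zariski X S =
     subtopology (topology_generated_by {{p. f p \<noteq> 0} | f. f \<in> polynomial_functions X}) S"

definition mat_coords :: "nat \<Rightarrow> nat \<Rightarrow> (complex mat \<Rightarrow> complex) set" where
  "mat_coords k l = {\<lambda>A. A $$ (i, j) | i j. i < k \<and> j < l}"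

definition pair_coords :: "nat \<Rightarrow> nat \<Rightarrow> (complex mat \<times> complex mat \<Rightarrow> complex) set" where
  "pair_coords n N =
     {\<lambda>p. f (fst p) | f. f \<in> mat_coords N n} \<union> {\<lambda>p. f (snd p) | f. f \<in> mat_coords N N}"

definition frame_preimage ::
    "nat \<Rightarrow> nat \<Rightarrow> (complex vec set \<times> complex mat) set \<Rightarrow> (complex mat \<times> complex mat) set" where
  "frame_preimage n N W = {(A, u). \<exists>V. (V, u) \<in> W \<and> A \<in> frames n N V}"

text \<open>
  The Zariski topology on the product of Gr n N with the N by N matrices, as the quotient of the
  Zariski topology on pairs (frame, matrix); the generating family is already a topology,
  see openin_Gr_mat_iff.
\<close>

definition Gr_mat_topology :: "nat \<Rightarrow> nat \<Rightarrow> (complex vec set \<times> complex mat) topology" where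
  "Gr_mat_topology n N = topology_generated_by
     {W. W \<subseteq> Gr n N \<times> carrier_mat N N \<and>
         openin (zariski (pair_coords n N) (frame_preimage n N (Gr n N \<times> carrier_mat N N)))
           (frame_preimage n N W)}"

lemma openin_Gr_mat_iff:
  "openin (Gr_mat_topology n N) W \<longleftrightarrow>
     W \<subseteq> Gr n N \<times> carrier_mat N N \<and>
     openin (zariski (pair_coords n N) (frame_preimage n N (Gr n N \<times> carrier_mat N N)))
       (frame_preimage n N W)"
    (is "_ \<longleftrightarrow> ?P W")
proof
  have int: "frame_preimage n N (a \<inter> b) = frame_preimage n N a \<inter> frame_preimage n N b" for a b
    unfolding frame_preimage_def frames_def by auto
  have un: "frame_preimage n N (\<Union> K) = \<Union> (frame_preimage n N ` K)" for K
    unfolding frame_preimage_def frames_def by auto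
  assume "openin (Gr_mat_topology n N) W"
  then have "generate_topology_on {W. ?P W} W"
    by (simp add: Gr_mat_topology_def openin_topology_generated_by_iff)
  then show "?P W"
  proof (induction rule: generate_topology_on.induct)
    case Empty
    have "frame_preimage n N {} = {}" by (simp add: frame_preimage_def)
    then show ?case by simp
  next
    case (Int a b)
    then show ?case unfolding int by auto
  next
    case (UN K)
    then show ?case unfolding un by (auto intro!: openin_Union)
  next
    case (Basis s)
    then show ?case by simp
  qed
next
  assume "?P W"
  then show "openin (Gr_mat_topology n N) W"
    unfolding Gr_mat_topology_def by (intro topology_generated_by_Basis) simp
qed


section \<open>Conormal Schubert varieties\<close>

definition cotangent_Gr :: "nat \<Rightarrow> nat \<Rightarrow> (complex vec set \<times> complex mat) set" where
  "cotangent_Gr n N = {(V, u) \<in> Gr n N \<times> carrier_mat N N.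
     (\<lambda>v. u *\<^sub>v v) ` carrier_vec N \<subseteq> V \<and> V \<subseteq> mat_kernel u}"

text \<open>
  Zariski tangent space at A of a set S of N by n matrices. The differential at A of a
  polynomial function F is evaluated as the derivative of F along a line through A.
\<close>

definition zariski_tangent ::
    "nat \<Rightarrow> nat \<Rightarrow> complex mat set \<Rightarrow> complex mat \<Rightarrow> complex mat set" where
  "zariski_tangent n N S A = {D \<in> carrier_mat N n.
     \<forall>F \<in> polynomial_functions (mat_coords N n). (\<forall>B \<in> S. F B = 0) \<longrightarrow>
       ((\<lambda>t. F (A + t \<cdot>\<^sub>m D)) has_field_derivative 0) (at 0)}"

text \<open>
  A tangent vector of the Grassmannian at V is a linear map from V to the quotient of
  N-dimensional space by V; it is represented here by any N by N matrix X inducing it. On frames,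
  the corresponding infinitesimal motion of A is X * A.
\<close>

definition Gr_tangent ::
    "nat \<Rightarrow> nat \<Rightarrow> complex vec set set \<Rightarrow> complex vec set \<Rightarrow> complex mat set" where
  "Gr_tangent n N Y V = {X \<in> carrier_mat N N.
     \<forall>A \<in> frames n N V. X * A \<in> zariski_tangent n N (\<Union> (frames n N ` Y)) A}"

text \<open>
  A cotangent vector u pairs with the tangent vector represented by X to the trace of u * X; this
  does not depend on the representative, as u vanishes on V and has its image in V.
\<close>

definition conormal_bundle ::
    "nat \<Rightarrow> nat \<Rightarrow> complex vec set set \<Rightarrow> (complex vec set \<times> complex mat) set" where
  "conormal_bundle n N Y = {(V, u) \<in> cotangent_Gr n N. V \<in> Y \<and>
     (\<forall>X \<in> Gr_tangent n N Y V. (\<Sum>i<N. (u * X) $$ (i, i)) = 0)}"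

definition conormal_schubert ::
    "nat \<Rightarrow> nat \<Rightarrow> (nat \<times> nat) set \<Rightarrow> (complex vec set \<times> complex mat) set" where
  "conormal_schubert n N r =
     subtopology (Gr_mat_topology n N) (cotangent_Gr n N)
       closure_of conormal_bundle n N (schubert_cell n N r)"

definition f_GP :: "complex vec set \<times> complex mat \<Rightarrow> complex vec set" where
  "f_GP z = fst z"

definition mu :: "complex vec set \<times> complex mat \<Rightarrow> complex mat" where
  "mu z = transpose_mat (snd z)"

definition holds_generally :: "'a topology \<Rightarrow> ('a \<Rightarrow> bool) \<Rightarrow> bool" where
  "holds_generally T P \<longleftrightarrow>
     (\<exists>U. openin T U \<and> T closure_of U = topspace T \<and> (\<forall>w \<in> U. P w))"


section \<open>Powers of the Pluecker line bundle\<close>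

text \<open>
  The fibre of O(1) at V is the dual of the top exterior power of V, so an element of the fibre of
  O(k) is a function on the ordered bases of V that is multiplied by the k-th power of the
  determinant under a change of basis. For k = 1 these include the Pluecker coordinates. Functions
  are extended by 0, which makes the set of sections below a genuine vector space of functions.
\<close>

definition O_fibre ::
    "nat \<Rightarrow> nat \<Rightarrow> int \<Rightarrow> complex vec set \<Rightarrow> (complex mat \<Rightarrow> complex) set" where
  "O_fibre n N k V = {\<phi>.
     (\<forall>A \<in> frames n N V. \<forall>g \<in> carrier_mat n n. invertible_mat g \<longrightarrow>
        \<phi> (A * g) = det g powi k * \<phi> A) \<and>
     (\<forall>A. A \<notin> frames n N V \<longrightarrow> \<phi> A = 0)}"

text \<open>
  Global sections over Z of the pullback of O(k) along f_GP: each point z is sent to an element of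
  the fibre at f_GP z, and, evaluated on frames, the section is locally a quotient of polynomial
  functions.
\<close>

definition pullback_O_sections :: "nat \<Rightarrow> nat \<Rightarrow> int \<Rightarrow> (complex vec set \<times> complex mat) set \<Rightarrow>
    (complex vec set \<times> complex mat \<Rightarrow> complex mat \<Rightarrow> complex) set" where
  "pullback_O_sections n N k Z = {\<sigma>.
     (\<forall>z \<in> Z. \<sigma> z \<in> O_fibre n N k (f_GP z)) \<and>
     (\<forall>z. z \<notin> Z \<longrightarrow> \<sigma> z = (\<lambda>_. 0)) \<and>
     (\<forall>z\<^sub>0 \<in> Z. \<forall>A\<^sub>0 \<in> frames n N (f_GP z\<^sub>0).
        \<exists>P \<in> polynomial_functions (pair_coords n N). \<exists>Q \<in> polynomial_functions (pair_coords n N).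
          Q (A\<^sub>0, snd z\<^sub>0) \<noteq> 0 \<and>
          (\<forall>z \<in> Z. \<forall>A \<in> frames n N (f_GP z). Q (A, snd z) \<noteq> 0 \<longrightarrow>
             \<sigma> z A = P (A, snd z) / Q (A, snd z)))}"

end

theory Submission
  imports "HOL-Complex_Analysis.Cauchy_Integral_Formula" Defs
begin

text \<open>
  In bases given by the standard flag, the conormal fibres over the Schubert cell consist of strictly
  lower triangular matrices u with image in V and kernel containing V, and both the cell and its
  conormal bundle are stable under invertible lower triangular matrices.

  If d < max n (N - n), every right step (or every upward step) of the boundary path can be matched
  with an earlier upward (later right) step. The resulting partial permutation matrix is a conormal
  vector of rank min n (N - n), and V is the image or the kernel of any u of this rank in its fibre;
  hence the general fibres of mu are points.

  Otherwise d is at least n and N - n, so the line bundle is a negative power of O(1). An outer corner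
  splits the path into two parts such that there are more right than upward steps in the first part
  and more upward than right steps in the second. A dimension count then yields, for each conormal
  vector (V, u), a vector w in the kernel of u and a functional xi that vanishes on the image of u,
  but not on V, such that the unipotent matrices 1 + t w xi are lower triangular. They move V in a
  pencil inside the fibre of mu over u, and along this projective line a section of a negative power
  of O(1) vanishes by Liouville's theorem.
\<close>

text \<open>The bound \<open>max n (N - n)\<close> is exactly where the two cases meet. Cutting the
  path behind the right step below a corner \<open>(x, y)\<close> leaves \<open>y\<close> right and
  \<open>N - n - x\<close> upward steps before the cut, and \<open>n - y\<close> right and
  \<open>x\<close> upward steps after it. As \<open>x + y = d + 1\<close>, the two strict
  inequalities that produce a pencil mean \<open>N - n \<le> d\<close> and \<open>n \<le> d\<close>.
  An empty diagram has no corner and leaves \<open>d\<close> free; all its upward steps come first,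
  so it belongs to the matching case.

  Tangent spaces are cut out by all polynomials vanishing on the frames of the cell, an ideal that
  is never computed. Conditions on conormal vectors come from explicit curves of lower triangular
  matrices through a point. Conormality is proved only at the coordinate subspace, where explicit
  minors bound the tangent space, and for translates by matrices that fix \<open>u\<close>. The
  limit point of a pencil lies outside the cell, so it is reached through the closure; vanishing is
  proved over the cell and extended by density.\<close>

no_notation Finite_Cartesian_Product.vec.vec_nth (infixl "$" 90)
hide_const (open) Finite_Cartesian_Product.mat Finite_Cartesian_Product.row
  Finite_Cartesian_Product.vec Determinants.det Cartesian_Space.rank

section \<open>Linear algebra\<close>

text \<open>Gaussian elimination, one unknown per equation. The index sets are arbitrary finite
  sets, so that blocks of \<open>u\<close> given by sets of path steps can be used without
  renumbering.\<close>

lemma homogeneous_system_nontrivial: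
  fixes M :: "'a \<Rightarrow> 'b \<Rightarrow> 'c::field"
  assumes "finite I" "finite J" "card I < card J"
  shows "\<exists>x. (\<exists>j\<in>J. x j \<noteq> 0) \<and> (\<forall>i\<in>I. (\<Sum>j\<in>J. M i j * x j) = 0)"
  using assms
proof (induction I arbitrary: J M rule: finite_induct)
  case empty
  then have "J \<noteq> {}" by auto
  then show ?case by (intro exI[of _ "\<lambda>_. 1"]) auto
next
  case (insert i I)
  show ?case
  proof (cases "\<forall>j\<in>J. M i j = 0")
    case True
    have "card I < card J" using insert by simp
    from insert.IH[OF insert.prems(1) this, of M] True show ?thesis by auto
  next
    case False
    then obtain j0 where j0: "j0 \<in> J" "M i j0 \<noteq> 0" by auto
    have "card I < card (J - {j0})" using insert j0 by simp
    from insert.IH[OF _ this, of "\<lambda>k j. M k j - M k j0 * M i j / M i j0"] insert.prems(1)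
    obtain x where x: "\<exists>j\<in>J-{j0}. x j \<noteq> 0"
      "\<And>k. k \<in> I \<Longrightarrow> (\<Sum>j\<in>J-{j0}. (M k j - M k j0 * M i j / M i j0) * x j) = 0"
      by auto
    define s where "s = (\<Sum>j\<in>J-{j0}. M i j * x j)"
    define y where "y = x(j0 := - s / M i j0)"
    have sumy: "(\<Sum>j\<in>J. M k j * y j) = - M k j0 * s / M i j0 + (\<Sum>j\<in>J-{j0}. M k j * x j)" for k
    proof -
      have "(\<Sum>j\<in>J. M k j * y j) = M k j0 * y j0 + (\<Sum>j\<in>J-{j0}. M k j * y j)"
        using j0 insert.prems(1) by (simp add: sum.remove)
      also have "(\<Sum>j\<in>J-{j0}. M k j * y j) = (\<Sum>j\<in>J-{j0}. M k j * x j)"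
        by (intro sum.cong) (auto simp: y_def)
      finally show ?thesis by (simp add: y_def)
    qed
    have "(\<Sum>j\<in>J. M k j * y j) = 0" if "k \<in> I" for k
    proof -
      have "0 = (\<Sum>j\<in>J-{j0}. M k j * x j) - M k j0 / M i j0 * s"
        using x(2)[OF that] by (simp add: s_def sum_distrib_left left_diff_distrib sum_subtractf mult.assoc)
      then show ?thesis by (simp add: sumy)
    qed
    moreover have "(\<Sum>j\<in>J. M i j * y j) = 0"
      using j0 by (simp add: sumy s_def)
    moreover have "\<exists>j\<in>J. y j \<noteq> 0" using x(1) by (auto simp: y_def)
    ultimately show ?thesis by blast
  qed
qed

text \<open>The cofactors along row \<open>y\<close> do not see that row, so they are those of the
  identity, and Laplace expansion picks out \<open>\<rho> y\<close>. This turns minors of a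
  normalised frame into single entries, and also computes the determinant of the change of basis
  along a pencil.\<close>

lemma det_identity_replace_row:
  fixes \<rho> :: "nat \<Rightarrow> 'a::{comm_ring_1,idom}"
  assumes "y < n"
  shows "det (Matrix.mat n n (\<lambda>(a, b). if a = y then \<rho> b else if a = b then 1 else 0)) = \<rho> y"
proof -
  let ?M = "Matrix.mat n n (\<lambda>(a, b). if a = y then \<rho> b else if a = b then 1 else 0)"
  have del: "mat_delete ?M y b = mat_delete (1\<^sub>m n) y b" if "b < n" for b
    unfolding mat_delete_def using that by (intro eq_matI) auto
  have adj: "adj_mat (1\<^sub>m n :: 'a mat) = 1\<^sub>m n"
  proof -
    have "(1 :: 'a) \<cdot>\<^sub>m 1\<^sub>m n = 1\<^sub>m n" by (intro eq_matI) auto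
    then show ?thesis
      using adj_mat(2)[of "1\<^sub>m n :: 'a mat" n] adj_mat(1)[of "1\<^sub>m n :: 'a mat" n] by simp
  qed
  have cof: "cofactor (1\<^sub>m n :: 'a mat) y b = (if b = y then 1 else 0)" if "b < n" for b
  proof -
    have "adj_mat (1\<^sub>m n :: 'a mat) $$ (b, y) = cofactor (1\<^sub>m n) y b"
      unfolding adj_mat_def using that assms by simp
    then show ?thesis unfolding adj using that assms by simp
  qed
  have "det ?M = (\<Sum>b<n. ?M $$ (y, b) * cofactor ?M y b)"
    by (rule laplace_expansion_row) (use assms in auto)
  also have "\<dots> = (\<Sum>b<n. \<rho> b * (if b = y then 1 else 0))"
    by (intro sum.cong refl) (use assms cof del in \<open>auto simp: cofactor_def\<close>)
  also have "\<dots> = (\<Sum>b<n. if b = y then \<rho> b else 0)" by (intro sum.cong) auto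
  also have "\<dots> = \<rho> y" using assms by simp
  finally show ?thesis .
qed

lemma mat_mult_unit_vec:
  fixes A :: "'a::comm_ring_1 mat"
  assumes "A \<in> carrier_mat N n" "i < n"
  shows "A *\<^sub>v unit_vec n i = col A i"
  using assms by (intro eq_vecI) auto

text \<open>The form with an explicit kernel vector allows two determinants with the same rows in
  different order to be compared without tracking signs.\<close>

lemma det_eq_0_iff_kernel:
  fixes M :: "'a::field mat"
  assumes "M \<in> carrier_mat n n"
  shows "det M = 0 \<longleftrightarrow> (\<exists>x. (\<exists>j<n. x j \<noteq> 0) \<and> (\<forall>i<n. (\<Sum>j<n. M $$ (i, j) * x j) = 0))"
proof
  assume "det M = 0"
  then obtain v where v: "v \<in> carrier_vec n" "v \<noteq> 0\<^sub>v n" "M *\<^sub>v v = 0\<^sub>v n"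
    using det_0_iff_vec_prod_zero_field[OF assms] by auto
  have "(\<Sum>j<n. M $$ (i, j) * v $ j) = 0" if "i < n" for i
  proof -
    have "(M *\<^sub>v v) $ i = (\<Sum>j<n. M $$ (i, j) * v $ j)"
      using assms v(1) that by (auto simp: scalar_prod_def lessThan_atLeast0 intro!: sum.cong)
    then show ?thesis using v that by simp
  qed
  moreover have "\<exists>j<n. v $ j \<noteq> 0"
    using v by (metis carrier_vecD eq_vecI index_zero_vec)
  ultimately show "\<exists>x. (\<exists>j<n. x j \<noteq> 0) \<and> (\<forall>i<n. (\<Sum>j<n. M $$ (i, j) * x j) = 0)"
    by (intro exI[of _ "\<lambda>j. v $ j"]) auto
next
  assume "\<exists>x. (\<exists>j<n. x j \<noteq> 0) \<and> (\<forall>i<n. (\<Sum>j<n. M $$ (i, j) * x j) = 0)"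
  then obtain x j where x: "j < n" "x j \<noteq> 0" "\<And>i. i < n \<Longrightarrow> (\<Sum>j<n. M $$ (i, j) * x j) = 0"
    by auto
  have "M *\<^sub>v Matrix.vec n x = 0\<^sub>v n"
    using assms x(3) by (intro eq_vecI) (auto simp: scalar_prod_def lessThan_atLeast0)
  moreover have "Matrix.vec n x \<noteq> 0\<^sub>v n" using x(1,2) by (metis index_vec index_zero_vec(1))
  ultimately show "det M = 0"
    using det_0_iff_vec_prod_zero_field[OF assms] by (metis vec_carrier)
qed

lemma det_nonzero_inverse:
  fixes M :: "'a::field mat"
  assumes "M \<in> carrier_mat n n" "det M \<noteq> 0"
  obtains M' where "M' \<in> carrier_mat n n" "M * M' = 1\<^sub>m n" "M' * M = 1\<^sub>m n"
proof -
  from det_non_zero_imp_unit[OF assms, of "undefined :: nat"]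
  show thesis
    by (auto simp: Units_def ring_mat_def intro: that)
qed

lemma invertible_mat_iff_det_nonzero:
  fixes M :: "'a::field mat"
  assumes "M \<in> carrier_mat n n"
  shows "invertible_mat M \<longleftrightarrow> det M \<noteq> 0"
proof
  assume "invertible_mat M"
  then obtain B where B: "M * B = 1\<^sub>m n" "B * M = 1\<^sub>m (dim_row B)"
    unfolding invertible_mat_def inverts_mat_def using assms by auto
  have "dim_col B = n" using arg_cong[OF B(1), of dim_col] by simp
  moreover have "dim_row B = n" using arg_cong[OF B(2), of dim_col] assms by simp
  ultimately have "B \<in> carrier_mat n n" by auto
  then have "det M * det B = 1" using det_mult[OF assms] B(1) by (metis det_one)
  then show "det M \<noteq> 0" by auto
next
  assume "det M \<noteq> 0"
  then obtain B where "B \<in> carrier_mat n n" "M * B = 1\<^sub>m n" "B * M = 1\<^sub>m n"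
    using det_nonzero_inverse assms by blast
  then show "invertible_mat M"
    unfolding invertible_mat_def inverts_mat_def using assms by (auto intro!: exI[of _ B])
qed


section \<open>Frames\<close>

text \<open>Members of \<open>frames n N V\<close> are only required to span \<open>V\<close>; their
  \<open>n\<close> columns are independent exactly when \<open>V\<close> has dimension
  \<open>n\<close>, which is what this predicate records.\<close>

definition inj_columns :: "complex mat \<Rightarrow> bool" where
  "inj_columns A \<longleftrightarrow>
     (\<forall>x \<in> carrier_vec (dim_col A). A *\<^sub>v x = 0\<^sub>v (dim_row A) \<longrightarrow> x = 0\<^sub>v (dim_col A))"

lemma frames_iff:
  "A \<in> frames n N V \<longleftrightarrow> A \<in> carrier_mat N n \<and> V = (\<lambda>x. A *\<^sub>v x) ` carrier_vec n"
proof -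
  have "vec_space.col_space N A = (\<lambda>x. A *\<^sub>v x) ` carrier_vec n" if "A \<in> carrier_mat N n"
    using that by (subst vec_space.col_space_eq[OF that]) (auto simp: mult_mat_vec_carrier)
  then show ?thesis by (auto simp: frames_def)
qed

text \<open>The rank is \<open>n\<close>, the number of columns. Linear independence speaks about
  the set of columns, so a repetition among them has to be excluded separately; it would make this
  set too small for the rank.\<close>

lemma frames_inj_columns:
  assumes "V \<in> Gr n N" "A \<in> frames n N V"
  shows "inj_columns A"
proof -
  interpret vec_space "TYPE(complex)" N .
  have A: "A \<in> carrier_mat N n" and V: "V = span (set (cols A))"
    using assms(2) by (auto simp: frames_def col_space_def)
  have rk: "rank A = n" using assms(1) V by (simp add: Gr_def rank_def)
  have dist: "distinct (cols A)"
  proof -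
    obtain S where S: "maximal S (\<lambda>T. T \<subseteq> set (cols A) \<and> lin_indpt T)"
      using maximal_exists_superset[of "set (cols A)" "\<lambda>T. T \<subseteq> set (cols A) \<and> lin_indpt T" "{}"]
      by (auto simp: lin_dep_def)
    then have "card S = n" using rank_card_indpt[OF A S] rk by simp
    moreover have "card S \<le> card (set (cols A))"
      using S by (intro card_mono) (auto simp: maximal_def)
    ultimately have "length (cols A) \<le> card (set (cols A))" using A by simp
    then show ?thesis using card_length[of "cols A"] card_distinct[of "cols A"] by linarith
  qed
  show ?thesis
    unfolding inj_columns_def
    using lin_depI[OF A] full_rank_lin_indpt[OF A rk dist] dist A by auto
qed

lemma inj_columns_in_Gr:
  assumes "A \<in> carrier_mat N n" "inj_columns A"
  shows "vec_space.col_space N A \<in> Gr n N"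
proof -
  interpret vec_space "TYPE(complex)" N .
  have A: "set (cols A) \<subseteq> carrier_vec N" using assms(1) cols_dim by blast
  have dist: "distinct (cols A)"
  proof (rule ccontr)
    assume "\<not> distinct (cols A)"
    then obtain i j where ij: "i < n" "j < n" "i \<noteq> j" "col A i = col A j"
      using assms(1) by (auto simp: distinct_conv_nth)
    define x where "x = unit_vec n i - (unit_vec n j :: complex vec)"
    have "A *\<^sub>v x = A *\<^sub>v unit_vec n i - A *\<^sub>v unit_vec n j"
      unfolding x_def using assms(1) by (intro mult_minus_distrib_mat_vec) auto
    also have "\<dots> = 0\<^sub>v N" using assms(1) ij by (auto simp: mat_mult_unit_vec)
    finally have "A *\<^sub>v x = 0\<^sub>v N" .
    then have "x = 0\<^sub>v n" using assms by (auto simp: inj_columns_def x_def)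
    then have "x $ i = 0" using ij by simp
    then show False using ij by (simp add: x_def)
  qed
  have li: "lin_indpt (set (cols A))"
  proof
    assume "lin_dep (set (cols A))"
    then obtain v where "v \<in> carrier_vec n" "v \<noteq> 0\<^sub>v n" "A *\<^sub>v v = 0\<^sub>v N"
      using lin_depE[OF assms(1) _ dist] by blast
    then show False using assms by (auto simp: inj_columns_def)
  qed
  have "rank A = n" by (rule lin_indpt_full_rank[OF assms(1) dist li])
  moreover have "subspace class_ring (span (set (cols A))) V"
    by (rule span_is_subspace) (use A in simp)
  ultimately show ?thesis unfolding Gr_def col_space_def rank_def by simp
qed

text \<open>A maximal independent subset of \<open>V\<close> is a basis; it exists because
  independence in \<open>V\<close> and in the ambient space agree, which bounds the size by
  \<open>N\<close>.\<close>

lemma Gr_frame_exists: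
  assumes "V \<in> Gr n N"
  shows "\<exists>A. A \<in> frames n N V"
proof -
  interpret vec_space "TYPE(complex)" N .
  let ?W = "module_vec TYPE(complex) N"
  have sub: "subspace class_ring V ?W" and dim: "vectorspace.dim class_ring (?W\<lparr>carrier := V\<rparr>) = n"
    using assms by (auto simp: Gr_def)
  have subm: "submodule class_ring V ?W" using sub by (simp add: subspace_def)
  have Vc: "V \<subseteq> carrier_vec N" using subm by (simp add: submodule_def module_vec_simps)
  interpret W: vectorspace class_ring "?W\<lparr>carrier := V\<rparr>"
    by (rule subspace_is_vs[OF sub])
  have li: "module.lin_dep class_ring (?W\<lparr>carrier := V\<rparr>) S \<longleftrightarrow> lin_dep S" if "S \<subseteq> V" for S
    using span_li_not_depend(2)[OF that subm] .
  have "\<exists>A. finite A \<and> maximal A (\<lambda>S. S \<subseteq> V \<and> \<not> module.lin_dep class_ring (?W\<lparr>carrier := V\<rparr>) S)"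
  proof (rule maximal_exists[where B = "{}"])
    fix S assume S: "S \<subseteq> V \<and> \<not> module.lin_dep class_ring (?W\<lparr>carrier := V\<rparr>) S"
    then have "lin_indpt S" using li by blast
    then show "finite S \<and> card S \<le> N"
      using li_le_dim[of S] S Vc by (auto simp: dim_is_n)
  next
    show "{} \<subseteq> V \<and> \<not> module.lin_dep class_ring (?W\<lparr>carrier := V\<rparr>) {}"
      by (simp add: W.lin_dep_def)
  qed
  then obtain S where S: "finite S"
    "maximal S (\<lambda>S. S \<subseteq> V \<and> \<not> module.lin_dep class_ring (?W\<lparr>carrier := V\<rparr>) S)" by blast
  have basis: "W.basis S" using W.max_li_is_basis S by simp
  then have "card S = n" using W.dim_basis[OF S(1)] dim by simp
  then obtain vs where vs: "set vs = S" "length vs = n" "distinct vs"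
    using S(1) finite_distinct_list distinct_card by metis
  have SV: "S \<subseteq> V" using basis by (simp add: W.basis_def)
  have "span S = V"
    using basis span_li_not_depend(1)[OF SV subm] by (simp add: W.basis_def)
  moreover have "cols (mat_of_cols N vs) = vs" using SV Vc vs by (intro cols_mat_of_cols) auto
  ultimately have "col_space (mat_of_cols N vs) = V" by (simp add: col_space_def vs)
  moreover have "mat_of_cols N vs \<in> carrier_mat N n" using vs by auto
  ultimately show ?thesis unfolding frames_def by auto
qed

lemma Gr_iff_frame: "V \<in> Gr n N \<longleftrightarrow> (\<exists>A \<in> frames n N V. inj_columns A)"
  using Gr_frame_exists frames_inj_columns inj_columns_in_Gr by (fastforce simp: frames_def)

lemma Gr_subset_carrier: "V \<in> Gr n N \<Longrightarrow> V \<subseteq> carrier_vec N"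
  using Gr_frame_exists by (force simp: frames_iff)

lemma factor_through_frame:
  assumes "A \<in> frames n N V" "U \<in> carrier_mat N m" "(\<lambda>v. U *\<^sub>v v) ` carrier_vec m \<subseteq> V"
  obtains B where "B \<in> carrier_mat n m" "U = A * B"
proof -
  have A: "A \<in> carrier_mat N n" "V = (\<lambda>x. A *\<^sub>v x) ` carrier_vec n"
    using assms(1) by (auto simp: frames_iff)
  have "\<exists>x \<in> carrier_vec n. A *\<^sub>v x = col U j" if "j < m" for j
  proof -
    have "col U j = U *\<^sub>v unit_vec m j" using assms(2) that by (simp add: mat_mult_unit_vec)
    then have "col U j \<in> V" using assms(3) by auto
    then show ?thesis using A(2) by force
  qed
  then obtain x where x: "\<And>j. j < m \<Longrightarrow> x j \<in> carrier_vec n \<and> A *\<^sub>v x j = col U j"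
    by metis
  let ?B = "mat_of_cols n (map x [0..<m])"
  have B: "?B \<in> carrier_mat n m" using mat_of_cols_carrier(1)[of n "map x [0..<m]"] by simp
  have colB: "col ?B j = x j" if "j < m" for j using that x by simp
  have "U = A * ?B"
  proof (intro mat_col_eqI)
    fix j assume "j < dim_col (A * ?B)"
    then have j: "j < m" using B by simp
    show "col U j = col (A * ?B) j" using col_mult2[OF A(1) B j] x[OF j] colB[OF j] by simp
  qed (use assms(2) A B in auto)
  then show thesis using B that by blast
qed

lemma frames_mult:
  assumes "A \<in> frames n N V" "g \<in> carrier_mat n n" "invertible_mat g"
  shows "A * g \<in> frames n N V"
proof -
  have A: "A \<in> carrier_mat N n" "V = (\<lambda>x. A *\<^sub>v x) ` carrier_vec n"
    using assms(1) by (auto simp: frames_iff)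
  obtain h where h: "h \<in> carrier_mat n n" "g * h = 1\<^sub>m n"
    using assms(2,3) det_nonzero_inverse invertible_mat_iff_det_nonzero by metis
  have "A *\<^sub>v x = (A * g) *\<^sub>v (h *\<^sub>v x)" if "x \<in> carrier_vec n" for x
  proof -
    have "(A * g) *\<^sub>v (h *\<^sub>v x) = A *\<^sub>v (g *\<^sub>v (h *\<^sub>v x))"
      using A assms(2) h that by (intro assoc_mult_mat_vec) auto
    also have "g *\<^sub>v (h *\<^sub>v x) = (g * h) *\<^sub>v x"
      using assms(2) h that by (intro assoc_mult_mat_vec[symmetric]) auto
    finally show ?thesis using h that by simp
  qed
  moreover have "h *\<^sub>v x \<in> carrier_vec n" if "x \<in> carrier_vec n" for x using h that by auto
  moreover have "(A * g) *\<^sub>v x = A *\<^sub>v (g *\<^sub>v x)" "g *\<^sub>v x \<in> carrier_vec n" if "x \<in> carrier_vec n" for x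
    using A assms(2) that by (auto intro: assoc_mult_mat_vec)
  ultimately have "V = (\<lambda>x. (A * g) *\<^sub>v x) ` carrier_vec n"
    unfolding A(2) by (auto simp: image_def; metis)
  then show ?thesis using A assms(2) by (simp add: frames_iff)
qed

lemma frames_change_of_basis:
  assumes "V \<in> Gr n N" "A \<in> frames n N V" "A' \<in> frames n N V"
  obtains g where "g \<in> carrier_mat n n" "invertible_mat g" "A' = A * g"
proof -
  have A': "A' \<in> carrier_mat N n" "V = (\<lambda>x. A' *\<^sub>v x) ` carrier_vec n"
    using assms(3) by (auto simp: frames_iff)
  have A: "A \<in> carrier_mat N n" using assms(2) by (auto simp: frames_iff)
  obtain g where g: "g \<in> carrier_mat n n" "A' = A * g"
    using factor_through_frame[OF assms(2) A'(1)] A'(2) by blast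
  have "det g \<noteq> 0"
  proof
    assume "det g = 0"
    then obtain v where v: "v \<in> carrier_vec n" "v \<noteq> 0\<^sub>v n" "g *\<^sub>v v = 0\<^sub>v n"
      using det_0_iff_vec_prod_zero_field[OF g(1)] by auto
    have "A' *\<^sub>v v = A *\<^sub>v (g *\<^sub>v v)" unfolding g(2) using A g v by (intro assoc_mult_mat_vec) auto
    also have "\<dots> = 0\<^sub>v N" using A v by (intro eq_vecI) auto
    finally show False
      using frames_inj_columns[OF assms(1,3)] A' v by (auto simp: inj_columns_def)
  qed
  then show thesis using g that invertible_mat_iff_det_nonzero by blast
qed


section \<open>Polynomial functions\<close>

lemma polynomial_functions_sum:
  assumes "finite I" "\<And>i. i \<in> I \<Longrightarrow> f i \<in> polynomial_functions X"
  shows "(\<lambda>p. \<Sum>i\<in>I. f i p) \<in> polynomial_functions X"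
  using assms by (induction I rule: finite_induct) (auto intro: polynomial_functions.intros)

lemma polynomial_functions_prod:
  assumes "finite I" "\<And>i. i \<in> I \<Longrightarrow> f i \<in> polynomial_functions X"
  shows "(\<lambda>p. \<Prod>i\<in>I. f i p) \<in> polynomial_functions X"
  using assms by (induction I rule: finite_induct) (auto intro: polynomial_functions.intros)

lemma polynomial_functions_det:
  assumes "\<And>i j. i < k \<Longrightarrow> j < k \<Longrightarrow> f i j \<in> polynomial_functions X"
  shows "(\<lambda>p. det (Matrix.mat k k (\<lambda>(i, j). f i j p))) \<in> polynomial_functions X"
proof -
  have "(\<lambda>p. det (Matrix.mat k k (\<lambda>(i, j). f i j p))) =
    (\<lambda>p. \<Sum>\<pi> | \<pi> permutes {0..<k}. of_int (sign \<pi>) * (\<Prod>i = 0..<k. f i (\<pi> i) p))"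
  proof
    fix p
    have "det (Matrix.mat k k (\<lambda>(i, j). f i j p)) = (\<Sum>\<pi> | \<pi> permutes {0..<k}. of_int (sign \<pi>) *
        (\<Prod>i = 0..<k. Matrix.mat k k (\<lambda>(i, j). f i j p) $$ (i, \<pi> i)))"
      by (rule det_def') simp
    also have "\<dots> = (\<Sum>\<pi> | \<pi> permutes {0..<k}. of_int (sign \<pi>) * (\<Prod>i = 0..<k. f i (\<pi> i) p))"
    proof (intro sum.cong refl arg_cong2[where f = "(*)"] prod.cong)
      fix \<pi> i assume "\<pi> \<in> {\<pi>. \<pi> permutes {0..<k}}" "i \<in> {0..<k}"
      then have "\<pi> i < k" using permutes_in_image[of \<pi> "{0..<k}" i] by auto
      then show "Matrix.mat k k (\<lambda>(i, j). f i j p) $$ (i, \<pi> i) = f i (\<pi> i) p"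
        using \<open>i \<in> {0..<k}\<close> by simp
    qed
    finally show "det (Matrix.mat k k (\<lambda>(i, j). f i j p)) = \<dots>" .
  qed
  also have "\<dots> \<in> polynomial_functions X"
  proof (intro polynomial_functions_sum polynomial_functions.mult polynomial_functions.const
      polynomial_functions_prod)
    fix \<pi> i assume "\<pi> \<in> {\<pi>. \<pi> permutes {0..<k}}" "i \<in> {0..<k}"
    then show "f i (\<pi> i) \<in> polynomial_functions X"
      using permutes_in_image[of \<pi> "{0..<k}" i] assms by auto
  qed (auto simp: finite_permutations)
  finally show ?thesis .
qed

lemma polynomial_functions_compose:
  assumes "F \<in> polynomial_functions X" "\<And>f. f \<in> X \<Longrightarrow> (\<lambda>q. f (\<phi> q)) \<in> polynomial_functions Y"
  shows "(\<lambda>q. F (\<phi> q)) \<in> polynomial_functions Y"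
  using assms(1)
  by (induction rule: polynomial_functions.induct) (auto intro: polynomial_functions.intros assms(2))

lemma polynomial_functions_holomorphic:
  assumes "F \<in> polynomial_functions X" "\<And>f. f \<in> X \<Longrightarrow> (\<lambda>t. f (\<gamma> t)) holomorphic_on S"
  shows "(\<lambda>t. F (\<gamma> t)) holomorphic_on S"
  using assms(1)
  by (induction rule: polynomial_functions.induct) (auto intro: holomorphic_intros assms(2))

lemma mat_coord_polynomial:
  "i < k \<Longrightarrow> j < l \<Longrightarrow> (\<lambda>A. A $$ (i, j)) \<in> polynomial_functions (mat_coords k l)"
  by (rule polynomial_functions.coord) (auto simp: mat_coords_def)

section \<open>Zariski-open sets and holomorphic curves\<close>

lemma openin_zariski_nonvanishing:
  assumes "f \<in> polynomial_functions X"
  shows "openin (zariski X S) {p \<in> S. f p \<noteq> 0}"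
proof -
  have "openin (topology_generated_by {{p. f p \<noteq> 0} | f. f \<in> polynomial_functions X}) {p. f p \<noteq> 0}"
    using assms by (intro topology_generated_by_Basis) auto
  then show ?thesis unfolding zariski_def openin_subtopology by (intro exI[of _ "{p. f p \<noteq> 0}"]) auto
qed

lemma topspace_zariski [simp]: "topspace (zariski X S) = S"
proof -
  have "(\<lambda>_. 1) \<in> polynomial_functions X" by (rule polynomial_functions.const)
  then have "UNIV \<in> {{p. f p \<noteq> 0} | f. f \<in> polynomial_functions X}" by force
  then show ?thesis unfolding zariski_def topspace_subtopology by (auto simp: topology_generated_by_topspace)
qed

text \<open>Polynomials are continuous along a holomorphic curve, so Zariski-open conditions become
  Euclidean-open in the parameter. In this way a limit of points on a pencil is recognised as a
  point of a Zariski closure.\<close>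

lemma open_preimage_zariski:
  assumes "openin (zariski X S) W" "\<And>f. f \<in> X \<Longrightarrow> (\<lambda>t. f (\<gamma> t)) holomorphic_on UNIV"
    "\<And>t. \<gamma> t \<in> S"
  shows "open {t :: complex. \<gamma> t \<in> W}"
proof -
  obtain T where T: "W = T \<inter> S"
    "generate_topology_on {{p. f p \<noteq> 0} | f. f \<in> polynomial_functions X} T"
    using assms(1) by (auto simp: zariski_def openin_subtopology openin_topology_generated_by_iff)
  from T(2) have "open {t. \<gamma> t \<in> T}"
  proof (induction rule: generate_topology_on.induct)
    case Empty
    then show ?case by simp
  next
    case (Int a b)
    then show ?case by (auto simp: Collect_conj_eq intro: open_Int)
  next
    case (UN K)
    have "{t. \<gamma> t \<in> \<Union>K} = (\<Union>k\<in>K. {t. \<gamma> t \<in> k})" by auto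
    then show ?case using UN by auto
  next
    case (Basis s)
    then obtain f where f: "f \<in> polynomial_functions X" "s = {p. f p \<noteq> 0}" by auto
    have "continuous_on UNIV (\<lambda>t. f (\<gamma> t))"
      by (intro holomorphic_on_imp_continuous_on polynomial_functions_holomorphic[OF f(1)] assms(2))
    then show ?case using f(2) by (auto intro!: open_Collect_neq continuous_on_const)
  qed
  then show ?thesis using T(1) assms(3) by simp
qed


section \<open>Diagrams and their right steps\<close>

text \<open>The 0-based matrix row of a right step, with columns of the diagram counted from 0 too.
  Beyond the \<open>n\<close>-th column a diagram is empty and the value is
  \<open>N - n + y\<close>, so the function is strictly increasing on all natural numbers.\<close>

definition right_row :: "nat \<Rightarrow> nat \<Rightarrow> (nat \<times> nat) set \<Rightarrow> nat \<Rightarrow> nat" where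
  "right_row n N r y = N - n - card {x. (x, Suc y) \<in> r} + y"

lemma young_diagram_closed:
  assumes "young_diagram n N r" "(x, y) \<in> r" "1 \<le> x'" "x' \<le> x" "1 \<le> y'" "y' \<le> y"
  shows "(x', y') \<in> r"
proof -
  have "\<forall>x y x' y'. (x, y) \<in> r \<and> 1 \<le> x' \<and> x' \<le> x \<and> 1 \<le> y' \<and> y' \<le> y \<longrightarrow> (x', y') \<in> r"
    using assms(1) unfolding young_diagram_def by (rule conjunct2)
  from this[rule_format, of x y x' y'] assms(2-) show ?thesis by simp
qed

text \<open>Closure under moving up makes every column an initial segment, so a diagram is
  determined by its column heights.\<close>

lemma young_column:
  assumes "young_diagram n N r"
  shows "{x. (x, y) \<in> r} = {1..card {x. (x, y) \<in> r}}"
proof -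
  let ?S = "{x. (x, y) \<in> r}"
  have sub: "?S \<subseteq> {1..N - n}" using assms by (auto simp: young_diagram_def)
  have fin: "finite ?S" by (rule finite_subset[OF sub]) simp
  show ?thesis
  proof (cases "?S = {}")
    case True
    then show ?thesis by simp
  next
    case False
    define M where "M = Max ?S"
    have "M \<in> ?S" unfolding M_def using fin False by (rule Max_in)
    then have M: "(M, y) \<in> r" "1 \<le> y" using assms by (auto simp: young_diagram_def)
    have "?S = {1..M}"
    proof (intro equalityI subsetI)
      fix x assume "x \<in> ?S"
      moreover from this have "x \<le> M" unfolding M_def using fin by (intro Max_ge)
      ultimately show "x \<in> {1..M}" using sub by auto
    next
      fix x assume "x \<in> {1..M}"
      then show "x \<in> ?S" using young_diagram_closed[OF assms M(1), of x y] M(2) by simp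
    qed
    then show ?thesis by simp
  qed
qed

lemma young_in_iff:
  assumes "young_diagram n N r"
  shows "(x, y) \<in> r \<longleftrightarrow> 1 \<le> x \<and> x \<le> card {x. (x, y) \<in> r}"
  using arg_cong[OF young_column[OF assms, of y], of "\<lambda>S. x \<in> S"] by simp

lemma young_column_le: "young_diagram n N r \<Longrightarrow> card {x. (x, y) \<in> r} \<le> N - n"
  by (rule order.trans[OF card_mono[of "{1..N - n}"]]) (auto simp: young_diagram_def)

lemma finite_young: "young_diagram n N r \<Longrightarrow> finite r"
  unfolding young_diagram_def by (elim conjE) (rule finite_subset, auto)

lemma young_column_mono:
  assumes "young_diagram n N r" "1 \<le> y" "y \<le> y'"
  shows "card {x. (x, y') \<in> r} \<le> card {x. (x, y) \<in> r}"
proof (rule card_mono)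
  show "finite {x. (x, y) \<in> r}" by (subst young_column[OF assms(1)]) simp
  show "{x. (x, y') \<in> r} \<subseteq> {x. (x, y) \<in> r}"
  proof
    fix x assume "x \<in> {x. (x, y') \<in> r}"
    moreover from this have "1 \<le> x" using assms(1) by (auto simp: young_diagram_def)
    ultimately show "x \<in> {x. (x, y) \<in> r}"
      using young_diagram_closed[OF assms(1), of x y' x y] assms(2,3) by simp
  qed
qed

lemma strict_mono_right_row:
  assumes "young_diagram n N r"
  shows "strict_mono (right_row n N r)"
proof (rule strict_monoI)
  fix y y' :: nat assume "y < y'"
  then show "right_row n N r y < right_row n N r y'"
    using young_column_mono[OF assms, of "Suc y" "Suc y'"] unfolding right_row_def by simp
qed

lemma right_row_less: "n \<le> N \<Longrightarrow> y < n \<Longrightarrow> right_row n N r y < N"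
  unfolding right_row_def by linarith

lemma right_steps_rows: "{i. Suc i \<in> right_steps n N r} = right_row n N r ` {..<n}"
proof (intro equalityI subsetI)
  fix i assume "i \<in> {i. Suc i \<in> right_steps n N r}"
  then obtain y where y: "1 \<le> y" "y \<le> n" "Suc i = N - n - card {x. (x, y) \<in> r} + y"
    by (auto simp: right_steps_def)
  then have "i = right_row n N r (y - 1)" by (simp add: right_row_def)
  then show "i \<in> right_row n N r ` {..<n}" using y by auto
next
  fix i assume "i \<in> right_row n N r ` {..<n}"
  then obtain y where "y < n" "i = right_row n N r y" by auto
  then show "i \<in> {i. Suc i \<in> right_steps n N r}"
    by (auto simp: right_steps_def right_row_def intro!: image_eqI[of _ _ "Suc y"])
qed

lemma pick_strict_mono_image:
  assumes "strict_mono (f :: nat \<Rightarrow> nat)" "y < n"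
  shows "pick (f ` {..<n}) y = f y"
proof -
  have "{a \<in> f ` {..<n}. a < f y} = f ` {..<y}"
    using assms by (auto simp: strict_mono_less)
  then have "card {a \<in> f ` {..<n}. a < f y} = y"
    using assms by (simp add: card_image strict_mono_imp_inj_on inj_on_subset)
  then show ?thesis using pick_card_in_set[of "f y" "f ` {..<n}"] assms(2) by auto
qed

text \<open>\<open>submatrix\<close> lists the chosen rows through \<open>pick\<close>, that is,
  increasingly; strict monotonicity makes \<open>right_row\<close> the same enumeration.\<close>

lemma plucker_eq_det:
  assumes "n \<le> N" "young_diagram n N s" "A \<in> carrier_mat N n"
  shows "plucker n N s A = det (Matrix.mat n n (\<lambda>(a, b). A $$ (right_row n N s a, b)))"
proof -
  have mono: "strict_mono (right_row n N s)" by (rule strict_mono_right_row[OF assms(2)])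
  have "{i. i < N \<and> i \<in> right_row n N s ` {..<n}} = right_row n N s ` {..<n}"
    using right_row_less[OF assms(1)] by auto
  then have "card {i. i < N \<and> i \<in> right_row n N s ` {..<n}} = n"
    by (simp add: card_image strict_mono_imp_inj_on[OF mono] inj_on_subset)
  then have "submatrix A (right_row n N s ` {..<n}) UNIV =
      Matrix.mat n n (\<lambda>(a, b). A $$ (right_row n N s a, b))"
    using assms(3) by (intro eq_matI) (auto simp: submatrix_def pick_strict_mono_image[OF mono] pick_UNIV)
  then show ?thesis unfolding plucker_def right_steps_rows by simp
qed

text \<open>A strictly increasing sequence gains at least one per step, so
  \<open>y \<le> t y \<le> N - n + y\<close>. These bounds make \<open>N - n + y - t y\<close> an
  admissible column height, and the gaps make the heights decrease weakly.\<close>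

lemma young_diagram_of_rows:
  assumes "n \<le> N" "\<And>y y'. y < y' \<Longrightarrow> y' < n \<Longrightarrow> t y < t y'" "\<And>y. y < n \<Longrightarrow> t y < N"
  shows "\<exists>s. young_diagram n N s \<and> (\<forall>y<n. right_row n N s y = t y)"
proof -
  have gap: "t y + (y' - y) \<le> t y'" if "y \<le> y'" "y' < n" for y y'
    using that
  proof (induction y' rule: dec_induct)
    case base
    then show ?case by simp
  next
    case (step m)
    then show ?case using assms(2)[of m "Suc m"] by linarith
  qed
  have low: "y \<le> t y" if "y < n" for y using gap[of 0 y] that by simp
  have high: "t y \<le> N - n + y" if "y < n" for y
  proof -
    have "t y + (n - 1 - y) \<le> t (n - 1)" using that by (intro gap) auto
    moreover have "t (n - 1) < N" using that by (intro assms(3)) auto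
    ultimately show ?thesis using that assms(1) by arith
  qed
  define s where "s = {(x, y). 1 \<le> y \<and> y \<le> n \<and> 1 \<le> x \<and> x \<le> N - n + (y - 1) - t (y - 1)}"
  have "young_diagram n N s"
    unfolding young_diagram_def
  proof (intro conjI allI impI)
    show "s \<subseteq> {1..N - n} \<times> {1..n}"
    proof
      fix b assume b: "b \<in> s"
      obtain x y where xy: "b = (x, y)" by force
      have "y - 1 \<le> t (y - 1)" using b xy low[of "y - 1"] by (auto simp: s_def)
      then show "b \<in> {1..N - n} \<times> {1..n}" using b xy by (auto simp: s_def)
    qed
    fix x y x' y' assume h: "(x, y) \<in> s \<and> 1 \<le> x' \<and> x' \<le> x \<and> 1 \<le> y' \<and> y' \<le> y"
    then have "t (y' - 1) + (y - 1 - (y' - 1)) \<le> t (y - 1)" by (intro gap) (auto simp: s_def)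
    then show "(x', y') \<in> s" using h unfolding s_def by auto
  qed
  moreover have "right_row n N s y = t y" if "y < n" for y
  proof -
    have "{x. (x, Suc y) \<in> s} = {1..N - n + y - t y}" using that by (auto simp: s_def)
    then show ?thesis using low[OF that] high[OF that] by (simp add: right_row_def)
  qed
  ultimately show ?thesis by blast
qed

text \<open>Inclusion compares column heights, and the height enters \<open>right_row\<close> with a
  minus sign, which reverses the order.\<close>

lemma young_subset_iff:
  assumes "young_diagram n N r" "young_diagram n N s"
  shows "s \<subseteq> r \<longleftrightarrow> (\<forall>y<n. right_row n N r y \<le> right_row n N s y)"
proof
  assume sub: "s \<subseteq> r"
  show "\<forall>y<n. right_row n N r y \<le> right_row n N s y"
  proof (intro allI impI)
    fix y assume "y < n"
    have "card {x. (x, Suc y) \<in> s} \<le> card {x. (x, Suc y) \<in> r}"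
    proof (rule card_mono)
      show "finite {x. (x, Suc y) \<in> r}" by (subst young_column[OF assms(1)]) simp
    qed (use sub in auto)
    then show "right_row n N r y \<le> right_row n N s y" by (simp add: right_row_def)
  qed
next
  assume le: "\<forall>y<n. right_row n N r y \<le> right_row n N s y"
  show "s \<subseteq> r"
  proof
    fix b assume b: "b \<in> s"
    obtain x y where xy: "b = (x, y)" by force
    have y: "1 \<le> y" "y \<le> n" using b xy assms(2) by (auto simp: young_diagram_def)
    have "card {x. (x, y) \<in> s} \<le> card {x. (x, y) \<in> r}"
    proof -
      have "right_row n N r (y - 1) \<le> right_row n N s (y - 1)" using le y by simp
      moreover have "Suc (y - 1) = y" using y by simp
      ultimately show ?thesis
        using young_column_le[OF assms(1), of y] young_column_le[OF assms(2), of y]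
        unfolding right_row_def by simp
    qed
    then show "b \<in> r" using b young_in_iff[OF assms(1), of x y] young_in_iff[OF assms(2), of x y]
      unfolding xy by linarith
  qed
qed

text \<open>Moving one right step to an earlier free position lowers the sum of all rows, whereas
  \<open>s \<subseteq> r\<close> would bound every sorted row, hence the sum, from below. Comparing
  sums avoids locating \<open>j\<close> in the sorted order.\<close>

lemma young_diagram_replace_row:
  assumes "n \<le> N" "young_diagram n N r" "y < n" "j \<notin> right_row n N r ` {..<n}" "j < right_row n N r y"
  obtains s where "young_diagram n N s" "\<not> s \<subseteq> r"
    "right_row n N s ` {..<n} = insert j (right_row n N r ` ({..<n} - {y}))"
proof -
  let ?rr = "right_row n N r"
  have inj: "inj ?rr" by (rule strict_mono_imp_inj_on[OF strict_mono_right_row[OF assms(2)]])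
  define T where "T = insert j (?rr ` ({..<n} - {y}))"
  have finT: "finite T" by (simp add: T_def)
  have jn: "j \<notin> ?rr ` ({..<n} - {y})" using assms(4) by auto
  have cardT: "card T = n"
    using jn assms(3) inj by (simp add: T_def card_image inj_on_subset)
  have TN: "T \<subseteq> {..<N}"
    using right_row_less[OF assms(1)] assms(3,5) unfolding T_def by (auto intro: less_trans)
  have "pick T a < pick T b" if "a < b" "b < n" for a b
    using pick_mono_le[of b T a] that cardT by simp
  moreover have "pick T a < N" if "a < n" for a
    using pick_in_set_le[of a T] that cardT TN by auto
  ultimately obtain s where s: "young_diagram n N s" "\<And>a. a < n \<Longrightarrow> right_row n N s a = pick T a"
    using young_diagram_of_rows[OF assms(1), of "pick T"] by blast
  have inj_s: "inj (right_row n N s)" by (rule strict_mono_imp_inj_on[OF strict_mono_right_row[OF s(1)]])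
  have rows: "right_row n N s ` {..<n} = T"
  proof (rule card_subset_eq[OF finT])
    show "right_row n N s ` {..<n} \<subseteq> T"
      using s(2) pick_in_set_le[of _ T] cardT by auto
    show "card (right_row n N s ` {..<n}) = card T"
      using inj_s cardT by (simp add: card_image inj_on_subset)
  qed
  have "\<not> s \<subseteq> r"
  proof
    assume "s \<subseteq> r"
    then have "\<And>a. a < n \<Longrightarrow> ?rr a \<le> right_row n N s a" using young_subset_iff assms(2) s(1) by blast
    then have "(\<Sum>a<n. ?rr a) \<le> (\<Sum>a<n. right_row n N s a)" by (intro sum_mono) auto
    also have "\<dots> = \<Sum>T"
      unfolding rows[symmetric] using inj_s by (simp add: sum.reindex inj_on_subset)
    also have "\<dots> = j + (\<Sum>a\<in>{..<n} - {y}. ?rr a)"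
      unfolding T_def using jn inj by (simp add: sum.reindex inj_on_subset)
    also have "\<dots> < ?rr y + (\<Sum>a\<in>{..<n} - {y}. ?rr a)" using assms(5) by simp
    also have "\<dots> = (\<Sum>a<n. ?rr a)" using assms(3) by (simp add: sum.remove)
    finally show False by simp
  qed
  then show thesis by (rule that[OF s(1) _ rows[unfolded T_def]])
qed

section \<open>Outer corners, the cut of the path and the matching of steps\<close>

lemma outer_corner_above:
  assumes "young_diagram n N r" "(x, y) \<in> r"
  obtains x' y' where "(x', y') \<in> outer_corners n N r" "x \<le> x'" "y \<le> y'"
proof -
  define B where "B = {b \<in> r. x \<le> fst b \<and> y \<le> snd b}"
  have "finite B" using finite_young[OF assms(1)] by (simp add: B_def)
  have "(x, y) \<in> B" using assms(2) by (simp add: B_def)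
  then have "B \<noteq> {}" by blast
  \<comment> \<open>A box of \<open>B\<close> with the largest coordinate sum is removable: a box of
    \<open>r\<close> that needs it lies weakly below and to the right of it, hence in
    \<open>B\<close>, with a larger sum.\<close>
  define b where "b = arg_min_on (\<lambda>b. - int (fst b + snd b)) B"
  have bB: "b \<in> B" unfolding b_def by (rule arg_min_if_finite(1)[OF \<open>finite B\<close> \<open>B \<noteq> {}\<close>])
  have b_max: "fst c + snd c \<le> fst b + snd b" if "c \<in> B" for c
    using arg_min_least[OF \<open>finite B\<close> \<open>B \<noteq> {}\<close> that, of "\<lambda>b. - int (fst b + snd b)"] by (simp add: b_def)
  have "young_diagram n N (r - {b})"
    unfolding young_diagram_def
  proof (intro conjI allI impI)
    show "r - {b} \<subseteq> {1..N - n} \<times> {1..n}" using assms(1) by (auto simp: young_diagram_def)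
    fix u v u' v' assume h: "(u, v) \<in> r - {b} \<and> 1 \<le> u' \<and> u' \<le> u \<and> 1 \<le> v' \<and> v' \<le> v"
    then have "(u', v') \<in> r" using young_diagram_closed[OF assms(1), of u v u' v'] by simp
    moreover have "(u', v') \<noteq> b"
    proof
      assume eq: "(u', v') = b"
      have "(u, v) \<in> r" using h by simp
      moreover have "(u', v') \<in> B" using bB eq by simp
      ultimately have "(u, v) \<in> B" using h by (simp add: B_def)
      then have "u + v \<le> u' + v'" using b_max[of "(u, v)"] unfolding eq[symmetric] by simp
      moreover have "u' \<le> u" "v' \<le> v" using h by auto
      ultimately have "u = u'" "v = v'" by linarith+
      then show False using h eq by simp
    qed
    ultimately show "(u', v') \<in> r - {b}" by simp
  qed
  then have "b \<in> outer_corners n N r" using bB by (simp add: outer_corners_def B_def)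
  then show thesis using that[of "fst b" "snd b"] bB by (simp add: B_def)
qed

lemma corner_split:
  assumes "n \<le> N" "young_diagram n N r" "r \<noteq> {}" "n \<le> d" "N - n \<le> d"
    and corners: "\<forall>(x, y) \<in> outer_corners n N r. x + y - 1 = d"
  obtains q p where "q \<le> n" "p \<le> N" "\<And>m. m < q \<Longrightarrow> right_row n N r m < p" "\<And>m. q \<le> m \<Longrightarrow> p \<le> right_row n N r m"
    "card ({..<p} - right_row n N r ` {..<n}) < q"
    "n - q < card ({p..<N} - right_row n N r ` {..<n})"
proof -
  let ?rr = "right_row n N r"
  have mono: "strict_mono ?rr" by (rule strict_mono_right_row[OF assms(2)])
  have inj: "inj ?rr" by (rule strict_mono_imp_inj_on[OF mono])
  obtain x y where xy: "(x, y) \<in> outer_corners n N r"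
    using assms(3) outer_corner_above[OF assms(2)] by (metis all_not_in_conv surj_pair)
  have d: "x + y - 1 = d" using corners xy by auto
  have xyr: "(x, y) \<in> r" "young_diagram n N (r - {(x, y)})" using xy by (auto simp: outer_corners_def)
  have bounds: "1 \<le> x" "x \<le> N - n" "1 \<le> y" "y \<le> n" using xyr(1) assms(2) by (auto simp: young_diagram_def)
  \<comment> \<open>A box just below the corner would survive its removal and force the corner back
    into the diagram. Hence column \<open>y\<close> has height exactly \<open>x\<close>.\<close>
  have "(Suc x, y) \<notin> r"
  proof
    assume "(Suc x, y) \<in> r"
    then have "(Suc x, y) \<in> r - {(x, y)}" by simp
    moreover have "1 \<le> x" "x \<le> Suc x" "1 \<le> y" "y \<le> y" using bounds by auto
    ultimately have "(x, y) \<in> r - {(x, y)}"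
      using young_diagram_closed[OF xyr(2)] by blast
    then show False by simp
  qed
  then have col: "card {x. (x, y) \<in> r} = x"
    using xyr(1) young_in_iff[OF assms(2), of x y] young_in_iff[OF assms(2), of "Suc x" y] by linarith
  \<comment> \<open>The number of path steps up to and including the right step below column
    \<open>y\<close>: \<open>N - n - x\<close> upward and \<open>y\<close> to the right. As a
    0-based row, that step itself is \<open>p - 1\<close>.\<close>
  define p where "p = N - n - x + y"
  have last: "?rr (y - 1) = p - 1" using bounds col by (simp add: right_row_def p_def)
  have lo: "?rr m < p" if "m < y" for m
  proof -
    have "?rr m \<le> ?rr (y - 1)" using that mono by (simp add: strict_mono_less_eq)
    then show ?thesis using last bounds by (simp add: p_def)
  qed
  have hi: "p \<le> ?rr m" if "y \<le> m" for m
  proof -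
    have "?rr (y - 1) < ?rr m" using that mono bounds by (simp add: strict_mono_less)
    then show ?thesis using last by simp
  qed
  have pN: "p \<le> N" using bounds assms(1) by (simp add: p_def)
  have "{..<p} \<inter> ?rr ` {..<n} = ?rr ` {..<y}"
  proof (intro equalityI subsetI)
    fix i assume "i \<in> {..<p} \<inter> ?rr ` {..<n}"
    then obtain m where "i = ?rr m" "?rr m < p" by auto
    then show "i \<in> ?rr ` {..<y}" using hi[of m] by (cases "m < y") auto
  qed (use lo bounds(4) in auto)
  then have c1: "card ({..<p} - ?rr ` {..<n}) = p - y"
    using card_Diff_subset_Int[of "{..<p}" "?rr ` {..<n}"] card_image[OF inj_on_subset[OF inj subset_UNIV], of "{..<y}"]
    by simp
  have "{p..<N} \<inter> ?rr ` {..<n} = ?rr ` {y..<n}"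
  proof (intro equalityI subsetI)
    fix i assume "i \<in> {p..<N} \<inter> ?rr ` {..<n}"
    then obtain m where "i = ?rr m" "p \<le> ?rr m" "m < n" by auto
    then show "i \<in> ?rr ` {y..<n}" using lo[of m] by (cases "m < y") auto
  qed (use hi right_row_less[OF assms(1)] in auto)
  then have c2: "card ({p..<N} - ?rr ` {..<n}) = N - p - (n - y)"
    using card_Diff_subset_Int[of "{p..<N}" "?rr ` {..<n}"] card_image[OF inj_on_subset[OF inj subset_UNIV], of "{y..<n}"]
    by simp
  show thesis
  proof (rule that[of y p])
    show "card ({..<p} - ?rr ` {..<n}) < y" "n - y < card ({p..<N} - ?rr ` {..<n})"
      unfolding c1 c2 using bounds assms(4,5) d by (auto simp: p_def)
  qed (use bounds pN lo hi in auto)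
qed

text \<open>The subtraction is truncated: if right steps are in the majority, the first
  \<open>2 * n - N\<close> of them stay unmatched, otherwise all are matched. If column
  \<open>m + 1\<close> has height \<open>c > 0\<close>, a corner below and to the right of its last
  box gives \<open>c + m \<le> d\<close>, and this leaves enough upward steps before the right step
  \<open>m\<close>.\<close>

lemma non_row_pick_less:
  assumes "n \<le> N" "young_diagram n N r" "r = {} \<or> d + 1 \<le> max n (N - n)"
    and corners: "\<forall>(x, y) \<in> outer_corners n N r. x + y - 1 = d"
    and m: "2 * n - N \<le> m" "m < n"
  shows "pick ({..<N} - right_row n N r ` {..<n}) (m - (2 * n - N)) < right_row n N r m"
proof -
  let ?rr = "right_row n N r" and ?k = "m - (2 * n - N)"
  let ?C = "{..<N} - ?rr ` {..<n}"
  have mono: "strict_mono ?rr" by (rule strict_mono_right_row[OF assms(2)])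
  have inj: "inj ?rr" by (rule strict_mono_imp_inj_on[OF mono])
  \<comment> \<open>Exactly \<open>?rr m - m\<close> upward steps precede the right step
    \<open>m\<close>; the claim is that the upward step with 0-based number \<open>?k\<close> is
    among them.\<close>
  have "?k + m < ?rr m"
  proof (cases "card {x. (x, Suc m) \<in> r} = 0")
    case True
    then show ?thesis using m by (auto simp: right_row_def)
  next
    case False
    let ?c = "card {x. (x, Suc m) \<in> r}"
    have "(?c, Suc m) \<in> r" using young_in_iff[OF assms(2), of ?c "Suc m"] False by simp
    then obtain x y where xy: "(x, y) \<in> outer_corners n N r" "?c \<le> x" "Suc m \<le> y"
      using outer_corner_above[OF assms(2)] by blast
    have "x + y - 1 = d" using corners xy(1) by auto
    then have "?c + Suc m \<le> d + 1" using xy by linarith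
    moreover have "r \<noteq> {}" using False by auto
    ultimately show ?thesis using assms(3) m by (auto simp: right_row_def)
  qed
  then have "?k < ?rr m - m" by simp
  also have "\<dots> = card ({..<?rr m} - ?rr ` {..<m})"
    using mono inj by (subst card_Diff_subset) (auto simp: card_image inj_on_subset strict_mono_less)
  also have "\<dots> \<le> card {a \<in> ?C. a < ?rr m}"
  proof (rule card_mono)
    show "{..<?rr m} - ?rr ` {..<m} \<subseteq> {a \<in> ?C. a < ?rr m}"
    proof
      fix a assume a: "a \<in> {..<?rr m} - ?rr ` {..<m}"
      have "a \<notin> ?rr ` {..<n}"
      proof
        assume "a \<in> ?rr ` {..<n}"
        then obtain i where "a = ?rr i" by auto
        then show False using a mono by (auto simp: strict_mono_less)
      qed
      then show "a \<in> {a \<in> ?C. a < ?rr m}" using a right_row_less[OF assms(1) m(2), of r] by simp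
    qed
  qed simp
  finally have k: "?k < card {a \<in> ?C. a < ?rr m}" .
  show ?thesis
  proof (rule ccontr)
    assume "\<not> pick ?C ?k < ?rr m"
    then have "{a \<in> ?C. a < ?rr m} \<subseteq> {a \<in> ?C. a < pick ?C ?k}" by auto
    then have "card {a \<in> ?C. a < ?rr m} \<le> card {a \<in> ?C. a < pick ?C ?k}" by (intro card_mono) auto
    also have "\<dots> = ?k"
    proof (rule card_pick_le)
      have "card {a \<in> ?C. a < ?rr m} \<le> card ?C" by (intro card_mono) auto
      then show "?k < card ?C" using k by simp
    qed
    finally show False using k by simp
  qed
qed


section \<open>Schubert cells\<close>

lemma index_mult_mat_sum:
  assumes "A \<in> carrier_mat k l" "B \<in> carrier_mat l m" "i < k" "j < m"
  shows "(A * B) $$ (i, j) = (\<Sum>c<l. A $$ (i, c) * B $$ (c, j))"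
  using assms by (auto simp: scalar_prod_def lessThan_atLeast0 intro!: sum.cong)

lemma row_selection_mult:
  assumes "A \<in> carrier_mat N n" "g \<in> carrier_mat n m" "\<And>a. a < k \<Longrightarrow> f a < N"
  shows "Matrix.mat k m (\<lambda>(a, b). (A * g) $$ (f a, b)) = Matrix.mat k n (\<lambda>(a, b). A $$ (f a, b)) * g"
  using assms by (intro eq_matI) (auto simp: scalar_prod_def intro!: sum.cong)

lemma plucker_mult:
  assumes "n \<le> N" "young_diagram n N s" "A \<in> carrier_mat N n" "g \<in> carrier_mat n n"
  shows "plucker n N s (A * g) = plucker n N s A * det g"
proof -
  have "plucker n N s (A * g) = det (Matrix.mat n n (\<lambda>(a, b). (A * g) $$ (right_row n N s a, b)))"
    using assms by (intro plucker_eq_det) auto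
  also have "\<dots> = det (Matrix.mat n n (\<lambda>(a, b). A $$ (right_row n N s a, b)) * g)"
    using assms right_row_less[OF assms(1)] by (subst row_selection_mult) auto
  also have "\<dots> = plucker n N s A * det g"
    using assms by (simp add: plucker_eq_det det_mult[of _ n])
  finally show ?thesis .
qed

text \<open>Up to sign this is the Pluecker coordinate of a diagram not contained in
  \<open>r\<close>. The sign is bypassed: every row of this matrix is a row of the sorted one, so a
  kernel vector of the latter serves for both.\<close>

lemma schubert_variety_row_relation:
  assumes "n \<le> N" "young_diagram n N r" "V \<in> schubert_variety n N r" "A \<in> frames n N V"
    and "y < n" "j \<notin> right_row n N r ` {..<n}" "j < right_row n N r y"
  shows "det (Matrix.mat n n (\<lambda>(a, b). A $$ (if a = y then j else right_row n N r a, b))) = 0"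
    (is "det ?M = 0")
proof -
  obtain s where s: "young_diagram n N s" "\<not> s \<subseteq> r"
    "right_row n N s ` {..<n} = insert j (right_row n N r ` ({..<n} - {y}))"
    using young_diagram_replace_row[OF assms(1,2,5,6,7)] .
  have A: "A \<in> carrier_mat N n" using assms(4) by (simp add: frames_iff)
  have "plucker n N s A = 0" using assms(3,4) s(1,2) by (auto simp: schubert_variety_def)
  let ?Ms = "Matrix.mat n n (\<lambda>(a, b). A $$ (right_row n N s a, b))"
  have "det ?Ms = 0" using \<open>plucker n N s A = 0\<close> plucker_eq_det[OF assms(1) s(1) A] by simp
  moreover have "?Ms \<in> carrier_mat n n" by simp
  ultimately obtain x where x: "\<exists>b<n. x b \<noteq> 0" "\<forall>a<n. (\<Sum>b<n. ?Ms $$ (a, b) * x b) = 0"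
    using det_eq_0_iff_kernel[of ?Ms n] by blast
  have x2: "(\<Sum>b<n. A $$ (right_row n N s a, b) * x b) = 0" if "a < n" for a
    using x(2)[rule_format, OF that] that by simp
  have "(\<Sum>b<n. ?M $$ (a, b) * x b) = 0" if "a < n" for a
  proof -
    have "(if a = y then j else right_row n N r a) \<in> right_row n N s ` {..<n}"
      unfolding s(3) using that by auto
    then obtain c where c: "(if a = y then j else right_row n N r a) = right_row n N s c" "c < n"
      by (elim imageE) simp
    have "(\<Sum>b<n. ?M $$ (a, b) * x b) = (\<Sum>b<n. A $$ (if a = y then j else right_row n N r a, b) * x b)"
      by (rule sum.cong) (use that in simp_all)
    also have "\<dots> = 0" unfolding c(1) by (rule x2[OF c(2)])
    finally show ?thesis .
  qed
  moreover have "?M \<in> carrier_mat n n" by simp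
  ultimately show ?thesis using x(1) det_eq_0_iff_kernel[of ?M n] by blast
qed

text \<open>The rows \<open>right_row n N r y\<close> are the pivot rows. Unlike being the identity
  on the pivot rows, this shape is preserved by left multiplication with lower triangular units, and
  it suffices for membership in the cell.\<close>

definition echelon :: "nat \<Rightarrow> nat \<Rightarrow> (nat \<times> nat) set \<Rightarrow> complex mat \<Rightarrow> bool" where
  "echelon n N r A \<longleftrightarrow> (\<forall>y<n. A $$ (right_row n N r y, y) \<noteq> 0 \<and> (\<forall>j<right_row n N r y. A $$ (j, y) = 0))"

text \<open>Since the coordinate of \<open>r\<close> is nonzero, the pivot rows can be normalised to
  the identity. An entry above a pivot is then either one of these zeros or, in a non-pivot row, the
  value of a minor that vanishes on the Schubert variety.\<close>

lemma schubert_cell_normal_frame: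
  assumes "n \<le> N" "young_diagram n N r" "V \<in> schubert_cell n N r"
  obtains A where "A \<in> frames n N V" "echelon n N r A"
    "\<And>a b. a < n \<Longrightarrow> b < n \<Longrightarrow> A $$ (right_row n N r a, b) = (if a = b then 1 else 0)"
proof -
  let ?rr = "right_row n N r"
  have V: "V \<in> schubert_variety n N r" "V \<in> Gr n N"
    using assms(3) by (auto simp: schubert_cell_def schubert_variety_def)
  obtain A0 where A0: "A0 \<in> frames n N V" using Gr_frame_exists[OF V(2)] by blast
  then have A0c: "A0 \<in> carrier_mat N n" by (simp add: frames_iff)
  let ?M = "Matrix.mat n n (\<lambda>(a, b). A0 $$ (?rr a, b))"
  have "det ?M \<noteq> 0"
    using assms(3) A0 plucker_eq_det[OF assms(1,2) A0c] by (auto simp: schubert_cell_def)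
  then obtain M' where M': "M' \<in> carrier_mat n n" "?M * M' = 1\<^sub>m n" "M' * ?M = 1\<^sub>m n"
    using det_nonzero_inverse[of ?M n] by auto
  have "det M' \<noteq> 0" using det_mult[of ?M n M'] M' by auto
  then have inv: "invertible_mat M'" using invertible_mat_iff_det_nonzero M'(1) by blast
  define A where "A = A0 * M'"
  have A: "A \<in> frames n N V" unfolding A_def by (rule frames_mult[OF A0 M'(1) inv])
  have id: "A $$ (?rr a, b) = (if a = b then 1 else 0)" if "a < n" "b < n" for a b
  proof -
    have "Matrix.mat n n (\<lambda>(a, b). A $$ (?rr a, b)) = 1\<^sub>m n"
      unfolding A_def using M' A0c right_row_less[OF assms(1)] by (subst row_selection_mult) auto
    from arg_cong[OF this, of "\<lambda>M. M $$ (a, b)"] show ?thesis using that by simp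
  qed
  have zero: "A $$ (j, y) = 0" if "y < n" "j < ?rr y" for j y
  proof (cases "j \<in> ?rr ` {..<n}")
    case True
    then obtain a where "a < n" "j = ?rr a" by auto
    then show ?thesis using id[of a y] that by auto
  next
    case False
    have "0 = det (Matrix.mat n n (\<lambda>(a, b). A $$ (if a = y then j else ?rr a, b)))"
      using schubert_variety_row_relation[OF assms(1,2) V(1) A that(1) False that(2)] by simp
    also have "Matrix.mat n n (\<lambda>(a, b). A $$ (if a = y then j else ?rr a, b)) =
        Matrix.mat n n (\<lambda>(a, b). if a = y then A $$ (j, b) else if a = b then 1 else 0)"
      using id by (intro eq_matI) auto
    also have "det \<dots> = A $$ (j, y)" by (rule det_identity_replace_row[OF that(1)])
    finally show ?thesis by simp
  qed
  show thesis by (rule that[OF A _ id]) (use id zero in \<open>auto simp: echelon_def\<close>)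
qed

lemma inj_columns_of_minor:
  assumes "A \<in> carrier_mat N n" "\<And>a. a < n \<Longrightarrow> f a < N"
    "det (Matrix.mat n n (\<lambda>(a, b). A $$ (f a, b))) \<noteq> 0"
  shows "inj_columns A"
  unfolding inj_columns_def
proof (intro ballI impI)
  fix x assume x: "x \<in> carrier_vec (dim_col A)" "A *\<^sub>v x = 0\<^sub>v (dim_row A)"
  have "(\<Sum>b<n. A $$ (f a, b) * x $ b) = 0" if "a < n" for a
  proof -
    have "(A *\<^sub>v x) $ f a = (\<Sum>b<n. A $$ (f a, b) * x $ b)"
      using assms(1,2) x(1) that by (auto simp: scalar_prod_def lessThan_atLeast0 intro!: sum.cong)
    then show ?thesis using x(2) assms(1,2) that by simp
  qed
  then have "\<not> (\<exists>b<n. x $ b \<noteq> 0)"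
    using assms(3) det_eq_0_iff_kernel[of "Matrix.mat n n (\<lambda>(a, b). A $$ (f a, b))" n] by auto
  then show "x = 0\<^sub>v (dim_col A)" using x(1) assms(1) by (intro eq_vecI) auto
qed

text \<open>For \<open>r\<close> the minor is lower triangular with the pivots on its diagonal. If
  \<open>s\<close> is not contained in \<open>r\<close>, some row of \<open>s\<close> lies above the
  pivot with the same index \<open>y\<close>; the \<open>n - y\<close> columns from \<open>y\<close>
  on then vanish in the first \<open>y + 1\<close> chosen rows and are dependent.\<close>

lemma plucker_echelon:
  assumes "n \<le> N" "young_diagram n N r" "A \<in> carrier_mat N n" "echelon n N r A"
  shows "plucker n N r A \<noteq> 0"
    and "young_diagram n N s \<Longrightarrow> \<not> s \<subseteq> r \<Longrightarrow> plucker n N s A = 0"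
proof -
  let ?rr = "right_row n N r"
  have mono: "strict_mono ?rr" by (rule strict_mono_right_row[OF assms(2)])
  have zero: "A $$ (i, y) = 0" if "y < n" "i < ?rr y" for i y
    using assms(4) that by (simp add: echelon_def)
  let ?M = "Matrix.mat n n (\<lambda>(a, b). A $$ (?rr a, b))"
  have "det ?M = prod_list (diag_mat ?M)"
    by (rule det_lower_triangular[of n]) (auto intro!: zero simp: strict_mono_less[OF mono])
  moreover have "0 \<notin> set (diag_mat ?M)" using assms(4) by (auto simp: diag_mat_def echelon_def)
  ultimately show "plucker n N r A \<noteq> 0"
    using plucker_eq_det[OF assms(1,2,3)] by (simp add: prod_list_zero_iff)
next
  let ?rr = "right_row n N r" and ?rs = "right_row n N s"
  assume s: "young_diagram n N s" "\<not> s \<subseteq> r"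
  have mono: "strict_mono ?rr" by (rule strict_mono_right_row[OF assms(2)])
  have mono_s: "strict_mono ?rs" by (rule strict_mono_right_row[OF s(1)])
  obtain y where y: "y < n" "?rs y < ?rr y"
    using s young_subset_iff[OF assms(2) s(1)] by (auto simp: not_le)
  have zero: "A $$ (?rs a, b) = 0" if "a \<le> y" "y \<le> b" "b < n" for a b
  proof -
    have "?rs a \<le> ?rs y" "?rr y \<le> ?rr b" using that mono mono_s by (simp_all add: strict_mono_less_eq)
    then show ?thesis using y that assms(4) by (simp add: echelon_def)
  qed
  obtain x where x: "\<exists>b\<in>{y..<n}. x b \<noteq> 0"
    "\<forall>a\<in>{y<..<n}. (\<Sum>b\<in>{y..<n}. A $$ (?rs a, b) * x b) = 0"
  proof -
    have "card {y<..<n} < card {y..<n}" using y(1) by simp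
    from homogeneous_system_nontrivial[OF _ _ this, of "\<lambda>a b. A $$ (?rs a, b)"] that
    show thesis by auto
  qed
  define x' where "x' b = (if y \<le> b then x b else 0)" for b
  have "(\<Sum>b<n. A $$ (?rs a, b) * x' b) = 0" if "a < n" for a
  proof -
    have "(\<Sum>b<n. A $$ (?rs a, b) * x' b) = (\<Sum>b\<in>{y..<n}. A $$ (?rs a, b) * x b)"
      by (rule sum.mono_neutral_cong_right) (auto simp: x'_def)
    also have "\<dots> = 0"
    proof (cases "a \<le> y")
      case True
      then show ?thesis using zero by (intro sum.neutral) auto
    next
      case False
      then show ?thesis using x(2) that by auto
    qed
    finally show ?thesis .
  qed
  moreover have "\<exists>b<n. x' b \<noteq> 0" using x(1) by (auto simp: x'_def)
  ultimately have "det (Matrix.mat n n (\<lambda>(a, b). A $$ (?rs a, b))) = 0"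
    by (subst det_eq_0_iff_kernel[of _ n]) (auto intro!: exI[of _ x'])
  then show "plucker n N s A = 0" using plucker_eq_det[OF assms(1) s(1) assms(3)] by simp
qed

lemma echelon_inj_columns:
  assumes "n \<le> N" "young_diagram n N r" "A \<in> carrier_mat N n" "echelon n N r A"
  shows "inj_columns A"
  using plucker_echelon(1)[OF assms] plucker_eq_det[OF assms(1-3)] right_row_less[OF assms(1)]
  by (intro inj_columns_of_minor[OF assms(3), of "right_row n N r"]) auto

text \<open>Another frame changes all Pluecker coordinates by one common nonzero factor, so testing
  a single frame is enough.\<close>

lemma echelon_in_schubert_cell:
  assumes "n \<le> N" "young_diagram n N r" "A \<in> frames n N V" "echelon n N r A"
  shows "V \<in> schubert_cell n N r"
proof -
  have A: "A \<in> carrier_mat N n" using assms(3) by (simp add: frames_iff)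
  have V: "V \<in> Gr n N"
    using echelon_inj_columns[OF assms(1,2) A assms(4)] assms(3) Gr_iff_frame by blast
  have pl: "\<exists>c. c \<noteq> 0 \<and> (\<forall>s. young_diagram n N s \<longrightarrow> plucker n N s A' = plucker n N s A * c)"
    if A': "A' \<in> frames n N V" for A'
  proof -
    obtain g where g: "g \<in> carrier_mat n n" "invertible_mat g" "A' = A * g"
      using frames_change_of_basis[OF V assms(3) A'] .
    then have "det g \<noteq> 0" using invertible_mat_iff_det_nonzero by blast
    then show ?thesis using plucker_mult[OF assms(1) _ A g(1)] g(3) by blast
  qed
  have "plucker n N s A' = 0" if "young_diagram n N s" "\<not> s \<subseteq> r" "A' \<in> frames n N V" for s A'
    using pl[OF that(3)] plucker_echelon(2)[OF assms(1,2) A assms(4) that(1,2)] that(1) by auto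
  moreover have "plucker n N r A' \<noteq> 0" if "A' \<in> frames n N V" for A'
    using pl[OF that] plucker_echelon(1)[OF assms(1,2) A assms(4)] assms(2) by auto
  ultimately show ?thesis using V by (auto simp: schubert_cell_def schubert_variety_def)
qed

section \<open>The Borel group of the cell\<close>

definition lower_triangular_units :: "nat \<Rightarrow> complex mat set" where
  "lower_triangular_units N =
     {g \<in> carrier_mat N N. (\<forall>i<N. g $$ (i, i) \<noteq> 0) \<and> (\<forall>i<N. \<forall>j<N. i < j \<longrightarrow> g $$ (i, j) = 0)}"

lemma echelon_lower_triangular:
  assumes "n \<le> N" "A \<in> carrier_mat N n" "echelon n N r A" "g \<in> lower_triangular_units N"
  shows "echelon n N r (g * A)"
proof -
  have g: "g \<in> carrier_mat N N" "\<And>i. i < N \<Longrightarrow> g $$ (i, i) \<noteq> 0"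
    "\<And>i j. j < N \<Longrightarrow> i < j \<Longrightarrow> g $$ (i, j) = 0"
    using assms(4) by (auto simp: lower_triangular_units_def)
  have zero: "A $$ (j, y) = 0" if "y < n" "j < right_row n N r y" for j y
    using assms(3) that by (simp add: echelon_def)
  show ?thesis
    unfolding echelon_def
  proof (intro allI impI conjI)
    fix y assume y: "y < n"
    let ?i = "right_row n N r y"
    have i: "?i < N" using y right_row_less[OF assms(1)] by simp
    have "(g * A) $$ (?i, y) = (\<Sum>c<N. g $$ (?i, c) * A $$ (c, y))"
      by (rule index_mult_mat_sum[OF g(1) assms(2) i y])
    also have "\<dots> = (\<Sum>c<N. if c = ?i then g $$ (?i, ?i) * A $$ (?i, y) else 0)"
    proof (intro sum.cong refl)
      fix c assume "c \<in> {..<N}"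
      then show "g $$ (?i, c) * A $$ (c, y) = (if c = ?i then g $$ (?i, ?i) * A $$ (?i, y) else 0)"
        using g(3)[of c ?i] zero[OF y, of c] by (cases c ?i rule: linorder_cases) auto
    qed
    also have "\<dots> = g $$ (?i, ?i) * A $$ (?i, y)" using i by simp
    finally show "(g * A) $$ (?i, y) \<noteq> 0" using g(2)[OF i] assms(3) y by (simp add: echelon_def)
    fix j assume j: "j < ?i"
    have "(g * A) $$ (j, y) = (\<Sum>c<N. g $$ (j, c) * A $$ (c, y))"
      using i j by (intro index_mult_mat_sum[OF g(1) assms(2) _ y]) simp
    also have "\<dots> = 0"
    proof (intro sum.neutral ballI)
      fix c assume "c \<in> {..<N}"
      then show "g $$ (j, c) * A $$ (c, y) = 0"
        using g(3)[of c j] zero[OF y, of c] j by (cases "c \<le> j") auto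
    qed
    finally show "(g * A) $$ (j, y) = 0" .
  qed
qed

lemma frames_left_mult:
  assumes "A \<in> frames n N V" "g \<in> carrier_mat N N"
  shows "g * A \<in> frames n N ((\<lambda>v. g *\<^sub>v v) ` V)"
proof -
  have A: "A \<in> carrier_mat N n" "V = (\<lambda>x. A *\<^sub>v x) ` carrier_vec n"
    using assms(1) by (auto simp: frames_iff)
  have "(\<lambda>v. g *\<^sub>v v) ` V = (\<lambda>x. (g * A) *\<^sub>v x) ` carrier_vec n"
    unfolding A(2) image_image
    by (rule image_cong) (use A(1) assms(2) in \<open>simp_all add: assoc_mult_mat_vec\<close>)
  then show ?thesis using A(1) assms(2) by (simp add: frames_iff)
qed

lemma schubert_cell_lower_triangular:
  assumes "n \<le> N" "young_diagram n N r" "V \<in> schubert_cell n N r" "g \<in> lower_triangular_units N"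
  shows "(\<lambda>v. g *\<^sub>v v) ` V \<in> schubert_cell n N r"
proof -
  obtain A where A: "A \<in> frames n N V" "echelon n N r A"
    by (rule schubert_cell_normal_frame[OF assms(1-3)])
  have Ac: "A \<in> carrier_mat N n" using A(1) by (simp add: frames_iff)
  have g: "g \<in> carrier_mat N N" using assms(4) by (simp add: lower_triangular_units_def)
  show ?thesis
    using echelon_in_schubert_cell[OF assms(1,2) frames_left_mult[OF A(1) g]]
      echelon_lower_triangular[OF assms(1) Ac A(2) assms(4)] by blast
qed


section \<open>Conormal vectors\<close>

lemma cell_frames_lower_triangular:
  assumes "n \<le> N" "young_diagram n N r" "g \<in> lower_triangular_units N"
    "A \<in> \<Union> (frames n N ` schubert_cell n N r)"
  shows "g * A \<in> \<Union> (frames n N ` schubert_cell n N r)"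
proof -
  obtain V where V: "V \<in> schubert_cell n N r" "A \<in> frames n N V" using assms(4) by auto
  have "g \<in> carrier_mat N N" using assms(3) by (simp add: lower_triangular_units_def)
  then show ?thesis
    using schubert_cell_lower_triangular[OF assms(1,2) V(1) assms(3)] frames_left_mult[OF V(2)] by blast
qed

text \<open>The curve of frames \<open>(1 + t E) A\<close> stays over the cell, so polynomials
  vanishing there vanish along it. For diagonal \<open>E\<close> the value \<open>t = -1\<close> has
  to be avoided, which does not affect the derivative at 0.\<close>

lemma elementary_in_Gr_tangent:
  assumes "n \<le> N" "young_diagram n N r" "V \<in> schubert_cell n N r" "i < N" "j \<le> i"
  shows "Matrix.mat N N (\<lambda>(a, b). if a = i \<and> b = j then 1 else 0) \<in> Gr_tangent n N (schubert_cell n N r) V"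
    (is "?E \<in> _")
  unfolding Gr_tangent_def zariski_tangent_def
proof (intro CollectI conjI ballI impI)
  show "?E \<in> carrier_mat N N" by simp
  fix A assume A: "A \<in> frames n N V"
  then have Ac: "A \<in> carrier_mat N n" by (simp add: frames_iff)
  show EA: "?E * A \<in> carrier_mat N n" using Ac by (intro mult_carrier_mat) auto
  fix F assume F: "F \<in> polynomial_functions (mat_coords N n)"
    "\<forall>B\<in>\<Union> (frames n N ` schubert_cell n N r). F B = 0"
  have zero: "F (A + t \<cdot>\<^sub>m (?E * A)) = 0" if "t \<noteq> -1" for t
  proof -
    have t: "1 + t \<noteq> 0" using that by (simp add: add_eq_0_iff)
    let ?g = "1\<^sub>m N + t \<cdot>\<^sub>m ?E"
    have "?g \<in> lower_triangular_units N"
      using t assms(5) by (auto simp: lower_triangular_units_def)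
    moreover have "?g * A = A + t \<cdot>\<^sub>m (?E * A)"
      using Ac EA by (simp add: add_mult_distrib_mat[of _ N N] mult_smult_assoc_mat[of ?E N N])
    ultimately show ?thesis
      using cell_frames_lower_triangular[OF assms(1,2), of ?g A] A assms(3) F(2) by auto
  qed
  have "\<forall>\<^sub>F t in nhds (0::complex). t \<in> -{-1}"
    by (rule eventually_nhds_in_open) (auto intro: open_Compl)
  then have "\<forall>\<^sub>F t in nhds (0::complex). t \<noteq> -1" by simp
  then have ev: "\<forall>\<^sub>F t in nhds 0. F (A + t \<cdot>\<^sub>m (?E * A)) = 0"
    by (rule eventually_mono) (rule zero)
  show "((\<lambda>t. F (A + t \<cdot>\<^sub>m (?E * A))) has_field_derivative 0) (at 0)"
    using DERIV_cong_ev[OF refl ev refl, of 0] by simp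
qed

text \<open>The trace of \<open>u * E\<close>, with \<open>E\<close> the elementary matrix at
  \<open>(b, a)\<close>, is the entry of \<open>u\<close> at \<open>(a, b)\<close>; for
  \<open>a \<le> b\<close> this \<open>E\<close> is a tangent vector.\<close>

lemma conormal_strictly_lower:
  assumes "n \<le> N" "young_diagram n N r" "(V, u) \<in> conormal_bundle n N (schubert_cell n N r)"
    "a \<le> b" "b < N"
  shows "u $$ (a, b) = 0"
proof -
  let ?E = "Matrix.mat N N (\<lambda>(c, d). if c = b \<and> d = a then 1 else 0) :: complex mat"
  have V: "V \<in> schubert_cell n N r" and u: "u \<in> carrier_mat N N"
    and tr: "\<And>X. X \<in> Gr_tangent n N (schubert_cell n N r) V \<Longrightarrow> (\<Sum>i<N. (u * X) $$ (i, i)) = 0"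
    using assms(3) by (auto simp: conormal_bundle_def cotangent_Gr_def)
  have "(u * ?E) $$ (i, i) = (if i = a then u $$ (a, b) else 0)" if "i < N" for i
  proof -
    have "(u * ?E) $$ (i, i) = (\<Sum>c<N. u $$ (i, c) * ?E $$ (c, i))"
      using u that by (intro index_mult_mat_sum[of _ N N _ N]) auto
    also have "\<dots> = (\<Sum>c<N. if c = b then (if i = a then u $$ (a, b) else 0) else 0)"
      using that by (intro sum.cong) auto
    also have "\<dots> = (if i = a then u $$ (a, b) else 0)" using assms(5) by simp
    finally show ?thesis .
  qed
  then have "(\<Sum>i<N. (u * ?E) $$ (i, i)) = (\<Sum>i<N. if i = a then u $$ (a, b) else 0)"
    by (intro sum.cong) auto
  also have "\<dots> = u $$ (a, b)" using assms(4,5) by simp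
  finally have "u $$ (a, b) = (\<Sum>i<N. (u * ?E) $$ (i, i))" by (rule sym)
  then show ?thesis using tr[OF elementary_in_Gr_tangent[OF assms(1,2) V assms(5,4)]] by (rule trans)
qed

lemma sum_diag_mult_commute:
  fixes P Q :: "'a::comm_semiring_0 mat"
  assumes "P \<in> carrier_mat N M" "Q \<in> carrier_mat M N"
  shows "(\<Sum>i<N. (P * Q) $$ (i, i)) = (\<Sum>i<M. (Q * P) $$ (i, i))"
proof -
  have "(\<Sum>i<N. (P * Q) $$ (i, i)) = (\<Sum>i<N. \<Sum>j<M. P $$ (i, j) * Q $$ (j, i))"
    using assms by (intro sum.cong refl index_mult_mat_sum[of _ N M _ N]) auto
  also have "\<dots> = (\<Sum>j<M. \<Sum>i<N. Q $$ (j, i) * P $$ (i, j))"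
    by (subst sum.swap) (simp add: mult.commute)
  also have "\<dots> = (\<Sum>i<M. (Q * P) $$ (i, i))"
    using assms by (intro sum.cong refl index_mult_mat_sum[of _ M N _ M, symmetric]) auto
  finally show ?thesis .
qed

text \<open>A tangent vector \<open>X\<close> at the translated space pulls back to
  \<open>h * X * g\<close> at \<open>V\<close>. Since \<open>u\<close> absorbs \<open>g\<close> and
  \<open>h\<close>, cyclicity of the trace shows that both pair equally with \<open>u\<close>. The
  matrix \<open>u\<close> itself does not move, so the translate stays in the same fibre of
  \<open>mu\<close>.\<close>

lemma conormal_bundle_translate:
  assumes "n \<le> N" "young_diagram n N r" "(V, u) \<in> conormal_bundle n N (schubert_cell n N r)"
    and g: "g \<in> lower_triangular_units N" and h: "h \<in> lower_triangular_units N"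
    and gh: "g * h = 1\<^sub>m N" "h * g = 1\<^sub>m N" and gu: "g * u = u" and ug: "u * g = u"
  shows "((\<lambda>v. g *\<^sub>v v) ` V, u) \<in> conormal_bundle n N (schubert_cell n N r)"
proof -
  let ?Y = "schubert_cell n N r" and ?V = "(\<lambda>v. g *\<^sub>v v) ` V"
  let ?S = "\<Union> (frames n N ` ?Y)"
  have V: "V \<in> ?Y" and cotu: "(V, u) \<in> cotangent_Gr n N"
    and tr: "\<forall>X \<in> Gr_tangent n N ?Y V. (\<Sum>i<N. (u * X) $$ (i, i)) = 0"
    using assms(3) unfolding conormal_bundle_def by simp_all
  have VGr: "V \<in> Gr n N" and u: "u \<in> carrier_mat N N"
    and imu: "(\<lambda>v. u *\<^sub>v v) ` carrier_vec N \<subseteq> V" and keru: "V \<subseteq> mat_kernel u"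
    using cotu unfolding cotangent_Gr_def by simp_all
  have gc: "g \<in> carrier_mat N N" and hc: "h \<in> carrier_mat N N"
    using g h by (auto simp: lower_triangular_units_def)
  have Vc: "V \<subseteq> carrier_vec N" by (rule Gr_subset_carrier[OF VGr])
  have V': "?V \<in> ?Y" by (rule schubert_cell_lower_triangular[OF assms(1,2) V g])
  then have V'Gr: "?V \<in> Gr n N" by (simp add: schubert_cell_def schubert_variety_def)
  have "u *\<^sub>v v \<in> ?V" if "v \<in> carrier_vec N" for v
  proof -
    have "u *\<^sub>v v = g *\<^sub>v (u *\<^sub>v v)" using gc u that gu by (metis assoc_mult_mat_vec)
    then show ?thesis using imu that by blast
  qed
  moreover have "?V \<subseteq> mat_kernel u"
  proof
    fix z assume "z \<in> ?V"
    then obtain v where v: "v \<in> V" "z = g *\<^sub>v v" by auto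
    then have "u *\<^sub>v z = u *\<^sub>v v" using gc u ug Vc by (metis assoc_mult_mat_vec subsetD)
    also have "\<dots> = 0\<^sub>v N" using keru v(1) u by (auto simp: mat_kernel_def)
    finally show "z \<in> mat_kernel u" using v gc u Vc by (auto simp: mat_kernel_def)
  qed
  ultimately have cot: "(?V, u) \<in> cotangent_Gr n N" using V'Gr u by (auto simp: cotangent_Gr_def)
  have uh: "u * h = u"
  proof -
    have "u * h = (u * g) * h" by (simp add: ug)
    also have "\<dots> = u * (g * h)" using u gc hc by (intro assoc_mult_mat)
    finally show ?thesis using gh u by simp
  qed
  have "(\<Sum>i<N. (u * X) $$ (i, i)) = 0" if X: "X \<in> Gr_tangent n N ?Y ?V" for X
  proof -
    have Xc: "X \<in> carrier_mat N N" using X by (simp add: Gr_tangent_def)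
    let ?X = "h * X * g"
    have "?X \<in> Gr_tangent n N ?Y V"
      unfolding Gr_tangent_def zariski_tangent_def
    proof (intro CollectI conjI ballI impI)
      show "?X \<in> carrier_mat N N" using hc Xc gc by auto
      fix A assume A: "A \<in> frames n N V"
      then have Ac: "A \<in> carrier_mat N n" by (simp add: frames_iff)
      show "?X * A \<in> carrier_mat N n" using hc Xc gc Ac by auto
      fix F assume F: "F \<in> polynomial_functions (mat_coords N n)" "\<forall>B\<in>?S. F B = 0"
      \<comment> \<open>Left multiplication by \<open>h\<close>, written out entrywise: composition
        with polynomial functions needs polynomial coordinates on matrices of every dimension, where
        \<open>h * B\<close> would not be described by this sum.\<close>
      define \<phi> where "\<phi> B = Matrix.mat N n (\<lambda>(i, j). \<Sum>c<N. h $$ (i, c) * B $$ (c, j))" for B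
      have \<phi>: "\<phi> B = h * B" if "B \<in> carrier_mat N n" for B
        unfolding \<phi>_def using hc that
        by (intro eq_matI) (auto simp: index_mult_mat_sum[OF hc that] simp del: index_mult_mat(1))
      have "(\<lambda>B. F (\<phi> B)) \<in> polynomial_functions (mat_coords N n)"
      proof (rule polynomial_functions_compose[OF F(1)])
        fix f assume "f \<in> mat_coords N n"
        then obtain i j where ij: "f = (\<lambda>A. A $$ (i, j))" "i < N" "j < n" by (auto simp: mat_coords_def)
        have "(\<lambda>q. f (\<phi> q)) = (\<lambda>q. \<Sum>c<N. h $$ (i, c) * q $$ (c, j))"
          using ij by (simp add: \<phi>_def)
        also have "\<dots> \<in> polynomial_functions (mat_coords N n)"
          using ij by (intro polynomial_functions_sum polynomial_functions.mult
              polynomial_functions.const mat_coord_polynomial) auto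
        finally show "(\<lambda>q. f (\<phi> q)) \<in> polynomial_functions (mat_coords N n)" .
      qed
      moreover have "\<forall>B\<in>?S. F (\<phi> B) = 0"
      proof
        fix B assume B: "B \<in> ?S"
        then have "\<phi> B = h * B" by (intro \<phi>) (auto simp: frames_iff)
        moreover have "F (h * B) = 0" using cell_frames_lower_triangular[OF assms(1,2) h B] F(2) by blast
        ultimately show "F (\<phi> B) = 0" by simp
      qed
      moreover have "X * (g * A) \<in> zariski_tangent n N ?S (g * A)"
        using X frames_left_mult[OF A gc] by (auto simp: Gr_tangent_def)
      ultimately have "((\<lambda>t. F (\<phi> (g * A + t \<cdot>\<^sub>m (X * (g * A))))) has_field_derivative 0) (at 0)"
        by (auto simp: zariski_tangent_def)
      moreover have "\<phi> (g * A + t \<cdot>\<^sub>m (X * (g * A))) = A + t \<cdot>\<^sub>m (?X * A)" for t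
      proof -
        have gA: "g * A \<in> carrier_mat N n" and XgA: "X * (g * A) \<in> carrier_mat N n" using gc Ac Xc by auto
        have "\<phi> (g * A + t \<cdot>\<^sub>m (X * (g * A))) = h * (g * A + t \<cdot>\<^sub>m (X * (g * A)))"
          by (rule \<phi>) (use gA XgA in auto)
        also have "\<dots> = h * (g * A) + t \<cdot>\<^sub>m (h * (X * (g * A)))"
          using hc gA XgA by (simp add: mult_add_distrib_mat[OF hc gA] mult_smult_distrib[OF hc XgA])
        also have "h * (g * A) = A"
          using assoc_mult_mat[OF hc gc Ac] gh Ac by simp
        also have "h * (X * (g * A)) = ?X * A"
        proof -
          have "?X * A = (h * X) * (g * A)" using hc Xc gc Ac by (intro assoc_mult_mat) auto
          also have "\<dots> = h * (X * (g * A))" using hc Xc gA by (intro assoc_mult_mat) auto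
          finally show ?thesis by simp
        qed
        finally show ?thesis .
      qed
      ultimately show "((\<lambda>t. F (A + t \<cdot>\<^sub>m (?X * A))) has_field_derivative 0) (at 0)" by simp
    qed
    then have "(\<Sum>i<N. (u * ?X) $$ (i, i)) = 0" by (rule tr[rule_format])
    moreover have "u * ?X = (u * X) * g"
    proof -
      have "u * ?X = (u * (h * X)) * g" using u hc Xc gc by (intro assoc_mult_mat[symmetric]) auto
      also have "u * (h * X) = (u * h) * X" using u hc Xc by (intro assoc_mult_mat[symmetric]) auto
      finally show ?thesis using uh by simp
    qed
    moreover have "(\<Sum>i<N. ((u * X) * g) $$ (i, i)) = (\<Sum>i<N. (g * (u * X)) $$ (i, i))"
      using u Xc gc by (intro sum_diag_mult_commute) auto
    moreover have "g * (u * X) = u * X" using assoc_mult_mat[OF gc u Xc] gu by simp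
    ultimately show ?thesis by simp
  qed
  with cot V' show ?thesis unfolding conormal_bundle_def by blast
qed

lemma topspace_cotangent:
  "topspace (subtopology (Gr_mat_topology n N) (cotangent_Gr n N)) = cotangent_Gr n N"
proof -
  let ?T = "zariski (pair_coords n N) (frame_preimage n N (Gr n N \<times> carrier_mat N N))"
  have "openin ?T (topspace ?T)" by (rule openin_topspace)
  then have "openin (Gr_mat_topology n N) (Gr n N \<times> carrier_mat N N)"
    unfolding openin_Gr_mat_iff by simp
  then have "Gr n N \<times> carrier_mat N N \<subseteq> topspace (Gr_mat_topology n N)" by (rule openin_subset)
  moreover have "cotangent_Gr n N \<subseteq> Gr n N \<times> carrier_mat N N" by (auto simp: cotangent_Gr_def)
  ultimately show ?thesis by (auto simp: topspace_subtopology)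
qed

lemma conormal_schubert_subset: "conormal_schubert n N r \<subseteq> cotangent_Gr n N"
  using closure_of_subset_topspace[of "subtopology (Gr_mat_topology n N) (cotangent_Gr n N)"]
  unfolding conormal_schubert_def topspace_cotangent .

lemma conormal_bundle_subset_schubert:
  "conormal_bundle n N (schubert_cell n N r) \<subseteq> conormal_schubert n N r"
  unfolding conormal_schubert_def
  by (rule closure_of_subset, unfold topspace_cotangent) (auto simp: conormal_bundle_def)


section \<open>Generic injectivity of the moment map\<close>

definition coordinate_frame :: "nat \<Rightarrow> nat \<Rightarrow> (nat \<times> nat) set \<Rightarrow> complex mat" where
  "coordinate_frame n N r = Matrix.mat N n (\<lambda>(i, b). if i = right_row n N r b then 1 else 0)"

lemma coordinate_frame_carrier [simp]: "coordinate_frame n N r \<in> carrier_mat N n"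
  by (simp add: coordinate_frame_def)

lemma echelon_coordinate_frame:
  assumes "n \<le> N" "young_diagram n N r"
  shows "echelon n N r (coordinate_frame n N r)"
  unfolding echelon_def
proof (intro allI impI conjI)
  fix y assume y: "y < n"
  have i: "right_row n N r y < N" by (rule right_row_less[OF assms(1) y])
  show "coordinate_frame n N r $$ (right_row n N r y, y) \<noteq> 0"
    using i y by (simp add: coordinate_frame_def)
  fix j assume "j < right_row n N r y"
  then show "coordinate_frame n N r $$ (j, y) = 0"
    using i y by (simp add: coordinate_frame_def)
qed

lemma mult_coordinate_frame:
  assumes "n \<le> N" "X \<in> carrier_mat M N" "i < M" "b < n"
  shows "(X * coordinate_frame n N r) $$ (i, b) = X $$ (i, right_row n N r b)"
proof -
  have "(X * coordinate_frame n N r) $$ (i, b) =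
      (\<Sum>c<N. X $$ (i, c) * coordinate_frame n N r $$ (c, b))"
    by (rule index_mult_mat_sum[OF assms(2) _ assms(3,4)]) simp
  also have "\<dots> = (\<Sum>c<N. if c = right_row n N r b then X $$ (i, right_row n N r b) else 0)"
    using assms(4) by (intro sum.cong) (auto simp: coordinate_frame_def)
  also have "\<dots> = X $$ (i, right_row n N r b)" using right_row_less[OF assms(1,4), of r] by simp
  finally show ?thesis .
qed

text \<open>The minor with row \<open>y\<close> replaced by row \<open>j\<close> vanishes on all
  frames over the cell. Its derivative at the coordinate frame in the direction \<open>X * A\<close>
  is the entry \<open>(j, y)\<close> of \<open>X * A\<close>, so this entry is 0. This bounds the
  Zariski tangent space from above.\<close>

lemma coordinate_Gr_tangent_zero:
  assumes "n \<le> N" "young_diagram n N r" "coordinate_frame n N r \<in> frames n N V"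
    and X: "X \<in> Gr_tangent n N (schubert_cell n N r) V"
    and "y < n" "j \<notin> right_row n N r ` {..<n}" "j < right_row n N r y"
  shows "X $$ (j, right_row n N r y) = 0"
proof -
  let ?rr = "right_row n N r" and ?A = "coordinate_frame n N r"
  define D where "D = X * ?A"
  have Xc: "X \<in> carrier_mat N N" using X by (simp add: Gr_tangent_def)
  have Dc: "D \<in> carrier_mat N n" unfolding D_def using Xc by (intro mult_carrier_mat[of _ N N]) simp_all
  have jN: "j < N" using right_row_less[OF assms(1,5), of r] assms(7) by simp
  have rrN: "?rr a < N" if "a < n" for a by (rule right_row_less[OF assms(1) that])
  have inj: "?rr a = ?rr b \<longleftrightarrow> a = b" for a b
    using strict_mono_eq[OF strict_mono_right_row[OF assms(2)]] .
  define F where "F A = det (Matrix.mat n n (\<lambda>(a, b). A $$ (if a = y then j else ?rr a, b)))" for A :: "complex mat"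
  have "F \<in> polynomial_functions (mat_coords N n)"
    unfolding F_def
  proof (rule polynomial_functions_det)
    fix a b assume ab: "a < n" "b < n"
    show "(\<lambda>A. A $$ (if a = y then j else ?rr a, b)) \<in> polynomial_functions (mat_coords N n)"
      by (rule mat_coord_polynomial) (use ab jN rrN in simp_all)
  qed
  moreover have "\<forall>B\<in>\<Union> (frames n N ` schubert_cell n N r). F B = 0"
  proof
    fix B assume "B \<in> \<Union> (frames n N ` schubert_cell n N r)"
    then obtain W where W: "W \<in> schubert_cell n N r" "B \<in> frames n N W" by blast
    then have "W \<in> schubert_variety n N r" by (simp add: schubert_cell_def)
    then show "F B = 0" unfolding F_def
      by (rule schubert_variety_row_relation[OF assms(1,2) _ W(2) assms(5-7)])
  qed
  moreover have "D \<in> zariski_tangent n N (\<Union> (frames n N ` schubert_cell n N r)) ?A"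
    using X assms(3) unfolding Gr_tangent_def D_def by blast
  ultimately have deriv0: "((\<lambda>t. F (?A + t \<cdot>\<^sub>m D)) has_field_derivative 0) (at 0)"
    unfolding zariski_tangent_def by blast
  define G where "G t = det (Matrix.mat n n (\<lambda>(a, b).
      if a = y then D $$ (j, b) else (if a = b then 1 else 0) + t * D $$ (?rr a, b)))" for t
  \<comment> \<open>Row \<open>j\<close> of the coordinate frame is zero, so row \<open>y\<close> of
    the minor is divisible by \<open>t\<close>. The derivative at 0 is then \<open>G 0\<close>, and
    no determinant has to be differentiated.\<close>
  have FG: "F (?A + t \<cdot>\<^sub>m D) = t * G t" for t
  proof -
    let ?M = "Matrix.mat n n (\<lambda>(a, b).
      if a = y then D $$ (j, b) else (if a = b then 1 else 0) + t * D $$ (?rr a, b))"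
    have entry: "(?A + t \<cdot>\<^sub>m D) $$ (i, b) = (if i = ?rr b then 1 else 0) + t * D $$ (i, b)"
      if "i < N" "b < n" for i b
      using that Dc by (simp add: coordinate_frame_def)
    have "Matrix.mat n n (\<lambda>(a, b). (?A + t \<cdot>\<^sub>m D) $$ (if a = y then j else ?rr a, b)) = multrow y t ?M"
    proof (intro eq_matI)
      fix a b assume "a < dim_row (multrow y t ?M)" "b < dim_col (multrow y t ?M)"
      then have ab: "a < n" "b < n" by simp_all
      have jb: "j \<noteq> ?rr b" using ab assms(6) by blast
      show "Matrix.mat n n (\<lambda>(a, b). (?A + t \<cdot>\<^sub>m D) $$ (if a = y then j else ?rr a, b)) $$ (a, b) =
          multrow y t ?M $$ (a, b)"
      proof (cases "a = y")
        case True
        then show ?thesis using ab jb entry[OF jN ab(2)] by simp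
      next
        case False
        then show ?thesis using ab entry[OF rrN[OF ab(1)] ab(2)] by (simp add: inj)
      qed
    qed simp_all
    then have "F (?A + t \<cdot>\<^sub>m D) = det (multrow y t ?M)" unfolding F_def by (rule arg_cong)
    also have "\<dots> = t * det ?M" by (rule det_multrow[OF assms(5)]) simp
    finally show ?thesis unfolding G_def .
  qed
  have "G \<in> polynomial_functions {\<lambda>t. t}"
    unfolding G_def
  proof (rule polynomial_functions_det)
    fix a b
    show "(\<lambda>t. if a = y then D $$ (j, b) else (if a = b then 1 else 0) + t * D $$ (?rr a, b))
        \<in> polynomial_functions {\<lambda>t. t}"
    proof (cases "a = y")
      case True
      then show ?thesis by (simp add: polynomial_functions.const)
    next
      case False
      have "(\<lambda>t. (if a = b then 1 else 0) + t * D $$ (?rr a, b)) \<in> polynomial_functions {\<lambda>t. t}"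
        by (intro polynomial_functions.add polynomial_functions.mult
            polynomial_functions.const polynomial_functions.coord) simp
      with False show ?thesis by simp
    qed
  qed
  then have "(\<lambda>t. G t) holomorphic_on UNIV"
    by (rule polynomial_functions_holomorphic) auto
  then have "(G has_field_derivative deriv G 0) (at 0)"
    by (rule holomorphic_derivI[of _ UNIV]) auto
  then have "((\<lambda>t. t * G t) has_field_derivative (0 * deriv G 0 + 1 * G 0)) (at 0)"
    by (rule DERIV_mult'[OF DERIV_ident])
  moreover have "((\<lambda>t. t * G t) has_field_derivative 0) (at 0)"
    using deriv0 unfolding FG .
  ultimately have "0 * deriv G 0 + 1 * G 0 = 0" by (rule DERIV_unique)
  then have "G 0 = 0" by simp
  moreover have "G 0 = D $$ (j, y)"
  proof -
    have "Matrix.mat n n (\<lambda>(a, b). if a = y then D $$ (j, b) else (if a = b then 1 else 0) + 0 * D $$ (?rr a, b)) =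
        Matrix.mat n n (\<lambda>(a, b). if a = y then D $$ (j, b) else if a = b then 1 else 0)"
      by (intro cong_mat) auto
    then show ?thesis unfolding G_def using det_identity_replace_row[OF assms(5)] by simp
  qed
  moreover have "D $$ (j, y) = X $$ (j, ?rr y)"
    unfolding D_def by (rule mult_coordinate_frame[OF assms(1) Xc jN assms(5)])
  ultimately show ?thesis by simp
qed

text \<open>Support in pivot rows and non-pivot columns places \<open>u\<close> in the cotangent
  fibre. Support below the diagonal makes its trace pairing meet only entries of \<open>X\<close>
  that vanish on tangent vectors.\<close>

lemma coordinate_conormal:
  assumes "n \<le> N" "young_diagram n N r" "u \<in> carrier_mat N N"
    and supp: "\<And>i j. i < N \<Longrightarrow> j < N \<Longrightarrow> u $$ (i, j) \<noteq> 0 \<Longrightarrow>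
      i \<in> right_row n N r ` {..<n} \<and> j \<notin> right_row n N r ` {..<n} \<and> j < i"
  shows "(vec_space.col_space N (coordinate_frame n N r), u) \<in> conormal_bundle n N (schubert_cell n N r)"
proof -
  let ?rr = "right_row n N r" and ?A = "coordinate_frame n N r"
  let ?V = "vec_space.col_space N ?A"
  have A: "?A \<in> frames n N ?V" by (simp add: frames_def)
  then have AV: "?V = (\<lambda>x. ?A *\<^sub>v x) ` carrier_vec n" by (simp add: frames_iff)
  have V: "?V \<in> schubert_cell n N r"
    by (rule echelon_in_schubert_cell[OF assms(1,2) A echelon_coordinate_frame[OF assms(1,2)]])
  then have VGr: "?V \<in> Gr n N" by (simp add: schubert_cell_def schubert_variety_def)
  have rrN: "?rr a < N" if "a < n" for a by (rule right_row_less[OF assms(1) that])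
  have inj: "?rr a = ?rr b \<longleftrightarrow> a = b" for a b
    using strict_mono_eq[OF strict_mono_right_row[OF assms(2)]] .
  define B where "B = Matrix.mat n N (\<lambda>(b, j). u $$ (?rr b, j))"
  have Bc: "B \<in> carrier_mat n N" by (simp add: B_def)
  have uAB: "u = ?A * B"
  proof (intro eq_matI)
    fix i j assume "i < dim_row (?A * B)" "j < dim_col (?A * B)"
    then have ij: "i < N" "j < N" by (simp_all add: B_def coordinate_frame_def)
    have "(?A * B) $$ (i, j) = (\<Sum>c<n. ?A $$ (i, c) * B $$ (c, j))"
      using ij by (intro index_mult_mat_sum[of _ N n _ N]) (simp_all add: Bc)
    also have "\<dots> = (\<Sum>c<n. if i = ?rr c then u $$ (i, j) else 0)"
      using ij by (intro sum.cong) (auto simp: B_def coordinate_frame_def)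
    also have "\<dots> = u $$ (i, j)"
    proof (cases "i \<in> ?rr ` {..<n}")
      case True
      then obtain c where c: "i = ?rr c" "c < n" by blast
      then have "(\<Sum>c<n. if i = ?rr c then u $$ (i, j) else 0) = (\<Sum>c'<n. if c' = c then u $$ (i, j) else 0)"
        by (intro sum.cong) (auto simp: inj)
      then show ?thesis using c by simp
    next
      case False
      then have "u $$ (i, j) = 0" using supp[OF ij] by blast
      then show ?thesis by (intro trans[OF sum.neutral]) auto
    qed
    finally show "u $$ (i, j) = (?A * B) $$ (i, j)" by simp
  qed (use assms(3) in \<open>simp_all add: B_def coordinate_frame_def\<close>)
  have uA: "u * ?A = 0\<^sub>m N n"
  proof (intro eq_matI)
    fix i b assume "i < dim_row (0\<^sub>m N n :: complex mat)" "b < dim_col (0\<^sub>m N n :: complex mat)"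
    then have ib: "i < N" "b < n" by simp_all
    have "u $$ (i, ?rr b) = 0" using supp[OF ib(1) rrN[OF ib(2)]] ib(2) by blast
    then show "(u * ?A) $$ (i, b) = 0\<^sub>m N n $$ (i, b)"
      using mult_coordinate_frame[OF assms(1,3) ib] ib by simp
  qed (use assms(3) in \<open>simp_all add: coordinate_frame_def\<close>)
  have "(\<lambda>v. u *\<^sub>v v) ` carrier_vec N \<subseteq> ?V"
  proof
    fix z assume "z \<in> (\<lambda>v. u *\<^sub>v v) ` carrier_vec N"
    then obtain v where v: "v \<in> carrier_vec N" "z = u *\<^sub>v v" by blast
    then have "z = ?A *\<^sub>v (B *\<^sub>v v)"
      using assoc_mult_mat_vec[OF coordinate_frame_carrier Bc v(1)] uAB by metis
    moreover have "B *\<^sub>v v \<in> carrier_vec n" by (rule mult_mat_vec_carrier[OF Bc v(1)])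
    ultimately show "z \<in> ?V" unfolding AV by blast
  qed
  moreover have "?V \<subseteq> mat_kernel u"
  proof
    fix z assume "z \<in> ?V"
    then obtain x where x: "x \<in> carrier_vec n" "z = ?A *\<^sub>v x" unfolding AV by blast
    have "u *\<^sub>v z = (u * ?A) *\<^sub>v x"
      unfolding x(2) by (rule assoc_mult_mat_vec[OF assms(3) coordinate_frame_carrier x(1), symmetric])
    also have "\<dots> = 0\<^sub>v N" unfolding uA using x(1) by (intro eq_vecI) auto
    finally show "z \<in> mat_kernel u"
      unfolding x(2)
      by (intro mat_kernelI[OF assms(3)] mult_mat_vec_carrier[OF coordinate_frame_carrier x(1)])
  qed
  ultimately have cot: "(?V, u) \<in> cotangent_Gr n N"
    using VGr assms(3) by (simp add: cotangent_Gr_def)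
  have "(\<Sum>i<N. (u * X) $$ (i, i)) = 0" if X: "X \<in> Gr_tangent n N (schubert_cell n N r) ?V" for X
  proof (intro sum.neutral ballI)
    fix i assume "i \<in> {..<N}"
    then have i: "i < N" by simp
    have Xc: "X \<in> carrier_mat N N" using X by (simp add: Gr_tangent_def)
    have "(u * X) $$ (i, i) = (\<Sum>k<N. u $$ (i, k) * X $$ (k, i))"
      by (rule index_mult_mat_sum[OF assms(3) Xc i i])
    also have "\<dots> = 0"
    proof (intro sum.neutral ballI)
      fix k assume "k \<in> {..<N}"
      then have k: "k < N" by simp
      show "u $$ (i, k) * X $$ (k, i) = 0"
      proof (cases "u $$ (i, k) = 0")
        case False
        then have s: "i \<in> ?rr ` {..<n}" "k \<notin> ?rr ` {..<n}" "k < i" using supp[OF i k] by blast+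
        then obtain y where y: "i = ?rr y" "y < n" by blast
        have "X $$ (k, ?rr y) = 0"
          by (rule coordinate_Gr_tangent_zero[OF assms(1,2) A X y(2) s(2)]) (use s(3) y(1) in simp)
        then show ?thesis using y(1) by simp
      qed simp
    qed
    finally show "(u * X) $$ (i, i) = 0" .
  qed
  with cot V show ?thesis unfolding conormal_bundle_def by blast
qed

text \<open>The minor makes \<open>n\<close> columns of \<open>u\<close> independent, and these lie
  in \<open>V\<close>, so they form a frame of it. This frame depends on \<open>u\<close> alone,
  hence so does \<open>V\<close>.\<close>

lemma image_frame_of_minor:
  assumes "(V, u) \<in> cotangent_Gr n N" "\<And>a. a < n \<Longrightarrow> f a < N" "\<And>a. a < n \<Longrightarrow> c a < N"
    "det (Matrix.mat n n (\<lambda>(a, b). u $$ (f a, c b))) \<noteq> 0"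
  shows "Matrix.mat N n (\<lambda>(i, b). u $$ (i, c b)) \<in> frames n N V" (is "?U \<in> _")
proof -
  have V: "V \<in> Gr n N" and u: "u \<in> carrier_mat N N" and im: "(\<lambda>v. u *\<^sub>v v) ` carrier_vec N \<subseteq> V"
    using assms(1) by (simp_all add: cotangent_Gr_def)
  obtain A where A: "A \<in> frames n N V" using Gr_frame_exists[OF V] by blast
  then have Ac: "A \<in> carrier_mat N n" by (simp add: frames_iff)
  obtain B where B: "B \<in> carrier_mat n N" "u = A * B" using factor_through_frame[OF A u im] .
  let ?B = "Matrix.mat n n (\<lambda>(a, b). B $$ (a, c b))"
  have UAB: "?U = A * ?B"
  proof (intro eq_matI)
    fix i b assume "i < dim_row (A * ?B)" "b < dim_col (A * ?B)"
    then have ib: "i < N" "b < n" using Ac by simp_all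
    have "(A * ?B) $$ (i, b) = (\<Sum>k<n. A $$ (i, k) * ?B $$ (k, b))"
      by (rule index_mult_mat_sum[OF Ac _ ib]) simp
    also have "\<dots> = (\<Sum>k<n. A $$ (i, k) * B $$ (k, c b))" using ib by (intro sum.cong) simp_all
    also have "\<dots> = u $$ (i, c b)"
      unfolding B(2) by (rule index_mult_mat_sum[OF Ac B(1) ib(1) assms(3)[OF ib(2)], symmetric])
    finally show "?U $$ (i, b) = (A * ?B) $$ (i, b)" using ib by simp
  qed (use Ac in simp_all)
  have "Matrix.mat n n (\<lambda>(a, b). u $$ (f a, c b)) = Matrix.mat n n (\<lambda>(a, b). (A * ?B) $$ (f a, b))"
    unfolding UAB[symmetric] using assms(2) by (intro cong_mat) simp_all
  also have "\<dots> = Matrix.mat n n (\<lambda>(a, b). A $$ (f a, b)) * ?B"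
    by (rule row_selection_mult[OF Ac _ assms(2)]) simp_all
  finally have "det (Matrix.mat n n (\<lambda>(a, b). A $$ (f a, b))) * det ?B \<noteq> 0"
    using assms(4) det_mult[of "Matrix.mat n n (\<lambda>(a, b). A $$ (f a, b))" n ?B] by simp
  then have "invertible_mat ?B" using invertible_mat_iff_det_nonzero[of ?B n] by simp
  then show ?thesis unfolding UAB by (intro frames_mult[OF A]) simp_all
qed

text \<open>A kernel vector \<open>z\<close> is added to the columns of a frame \<open>A\<close>.
  Some nontrivial combination vanishes outside the coordinates \<open>c\<close>; it lies in the
  kernel of \<open>u\<close>, so the minor forces it to be 0. By independence of the columns of
  \<open>A\<close>, the coefficient of \<open>z\<close> is nonzero.\<close>

lemma kernel_of_minor:
  assumes "(V, u) \<in> cotangent_Gr n N" "n \<le> N" "\<And>a. a < N - n \<Longrightarrow> f a < N" "\<And>a. a < N - n \<Longrightarrow> c a < N"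
    "inj_on c {..<N - n}" "det (Matrix.mat (N - n) (N - n) (\<lambda>(a, b). u $$ (f a, c b))) \<noteq> 0"
  shows "V = mat_kernel u"
proof
  have V: "V \<in> Gr n N" and u: "u \<in> carrier_mat N N" and ker: "V \<subseteq> mat_kernel u"
    using assms(1) by (simp_all add: cotangent_Gr_def)
  show "V \<subseteq> mat_kernel u" by (rule ker)
  obtain A where A: "A \<in> frames n N V" using Gr_frame_exists[OF V] by blast
  then have Ac: "A \<in> carrier_mat N n" and AV: "V = (\<lambda>x. A *\<^sub>v x) ` carrier_vec n"
    by (simp_all add: frames_iff)
  let ?q = "N - n"
  show "mat_kernel u \<subseteq> V"
  proof
    fix z assume "z \<in> mat_kernel u"
    then have z: "z \<in> carrier_vec N" "u *\<^sub>v z = 0\<^sub>v N" using u by (auto simp: mat_kernel_def)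
    let ?R = "{..<N} - c ` {..<?q}"
    have "card (c ` {..<?q}) = ?q" using assms(5) by (simp add: card_image)
    moreover have "c ` {..<?q} \<subseteq> {..<N}" using assms(4) by auto
    ultimately have "card ?R = n" using assms(2) by (simp add: card_Diff_subset)
    \<comment> \<open>The unknown with index \<open>n\<close> is the coefficient of
      \<open>z\<close>, the others belong to the columns of \<open>A\<close>: \<open>n + 1\<close>
      unknowns against \<open>n\<close> equations.\<close>
    then have "card ?R < card {..n}" by simp
    from homogeneous_system_nontrivial[OF _ _ this, of "\<lambda>i b. if b < n then A $$ (i, b) else z $ i"]
    obtain x where x: "\<exists>b\<in>{..n}. x b \<noteq> 0"
      "\<forall>i\<in>?R. (\<Sum>b\<in>{..n}. (if b < n then A $$ (i, b) else z $ i) * x b) = 0" by auto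
    define v where "v = A *\<^sub>v Matrix.vec n x + x n \<cdot>\<^sub>v z"
    have vi: "v $ i = (\<Sum>b<n. A $$ (i, b) * x b) + x n * z $ i" if "i < N" for i
    proof -
      have "(A *\<^sub>v Matrix.vec n x) $ i = (\<Sum>b<n. A $$ (i, b) * x b)"
        using Ac that by (auto simp: scalar_prod_def lessThan_atLeast0 intro!: sum.cong)
      then show ?thesis unfolding v_def using Ac z(1) that by simp
    qed
    have vc: "v \<in> carrier_vec N" unfolding v_def using Ac z(1) by auto
    have v0: "v $ i = 0" if "i \<in> ?R" for i
    proof -
      have "(\<Sum>b\<in>{..n}. (if b < n then A $$ (i, b) else z $ i) * x b) =
          (\<Sum>b<n. A $$ (i, b) * x b) + x n * z $ i"
        unfolding lessThan_Suc_atMost[symmetric] by simp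
      then show ?thesis using x(2) vi that by auto
    qed
    have "A *\<^sub>v Matrix.vec n x \<in> mat_kernel u" using ker AV by auto
    then have uAx: "u *\<^sub>v (A *\<^sub>v Matrix.vec n x) = 0\<^sub>v N" using u by (auto simp: mat_kernel_def)
    have uv: "u *\<^sub>v v = 0\<^sub>v N"
    proof -
      have "u *\<^sub>v v = u *\<^sub>v (A *\<^sub>v Matrix.vec n x) + u *\<^sub>v (x n \<cdot>\<^sub>v z)"
        unfolding v_def using u Ac z(1) by (intro mult_add_distrib_mat_vec[of _ N N]) auto
      also have "u *\<^sub>v (x n \<cdot>\<^sub>v z) = x n \<cdot>\<^sub>v (u *\<^sub>v z)" by (rule mult_mat_vec[OF u z(1)])
      finally show ?thesis unfolding uAx z(2) by auto
    qed
    let ?M = "Matrix.mat ?q ?q (\<lambda>(a, b). u $$ (f a, c b))"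
    have "(\<Sum>b<?q. ?M $$ (a, b) * v $ c b) = 0" if "a < ?q" for a
    proof -
      have "0 = (u *\<^sub>v v) $ f a" using uv assms(3)[OF that] by simp
      also have "\<dots> = (\<Sum>i<N. u $$ (f a, i) * v $ i)"
        using u vc assms(3)[OF that] by (auto simp: scalar_prod_def lessThan_atLeast0 intro!: sum.cong)
      also have "\<dots> = (\<Sum>i\<in>c ` {..<?q}. u $$ (f a, i) * v $ i)"
        by (rule sum.mono_neutral_right) (use assms(4) v0 in auto)
      also have "\<dots> = (\<Sum>b<?q. u $$ (f a, c b) * v $ c b)"
        using assms(5) by (simp add: sum.reindex)
      also have "\<dots> = (\<Sum>b<?q. ?M $$ (a, b) * v $ c b)" using that by (intro sum.cong) simp_all
      finally show ?thesis by simp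
    qed
    then have Mv: "\<forall>a<?q. (\<Sum>b<?q. ?M $$ (a, b) * v $ c b) = 0" by blast
    have Mc: "?M \<in> carrier_mat ?q ?q" by simp
    have vcb: "v $ c b = 0" if "b < ?q" for b
    proof (rule ccontr)
      assume "v $ c b \<noteq> 0"
      then have "\<exists>b<?q. v $ c b \<noteq> 0" using that by blast
      with Mv have "det ?M = 0"
        unfolding det_eq_0_iff_kernel[OF Mc] by (intro exI[of _ "\<lambda>b. v $ c b"] conjI)
      then show False using assms(6) by contradiction
    qed
    have veq: "v = 0\<^sub>v N"
    proof (intro eq_vecI)
      fix i assume "i < dim_vec (0\<^sub>v N :: complex vec)"
      then have i: "i < N" by simp
      show "v $ i = 0\<^sub>v N $ i"
      proof (cases "i \<in> c ` {..<?q}")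
        case True
        then obtain b where "i = c b" "b < ?q" by blast
        then show ?thesis using vcb i by simp
      next
        case False
        then show ?thesis using v0[of i] i by simp
      qed
    qed (use vc in simp)
    have xn: "x n \<noteq> 0"
    proof
      assume x0: "x n = 0"
      have "A *\<^sub>v Matrix.vec n x = 0\<^sub>v N"
      proof (intro eq_vecI)
        fix i assume "i < dim_vec (0\<^sub>v N :: complex vec)"
        then have i: "i < N" by simp
        have "v $ i = (A *\<^sub>v Matrix.vec n x) $ i" unfolding v_def using Ac z(1) i x0 by simp
        then show "(A *\<^sub>v Matrix.vec n x) $ i = 0\<^sub>v N $ i" using veq i by simp
      qed (use Ac in simp)
      then have "Matrix.vec n x = 0\<^sub>v n"
        using frames_inj_columns[OF V A] Ac by (auto simp: inj_columns_def)
      then have "x b = 0" if "b < n" for b using that by (metis index_vec index_zero_vec(1))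
      then show False using x(1) x0 by (auto simp: le_less)
    qed
    define y where "y = Matrix.vec n (\<lambda>b. - x b / x n)"
    have "z = A *\<^sub>v y"
    proof (intro eq_vecI)
      fix i assume "i < dim_vec (A *\<^sub>v y)"
      then have i: "i < N" using Ac by simp
      have "(A *\<^sub>v y) $ i = (\<Sum>b<n. A $$ (i, b) * (- x b / x n))"
        using Ac i by (auto simp: y_def scalar_prod_def lessThan_atLeast0 intro!: sum.cong)
      also have "\<dots> = - (\<Sum>b<n. A $$ (i, b) * x b) / x n"
        by (simp add: sum_divide_distrib sum_negf)
      also have "\<dots> = z $ i"
      proof -
        have "(\<Sum>b<n. A $$ (i, b) * x b) + x n * z $ i = 0" using vi[OF i] veq i by simp
        then have "(\<Sum>b<n. A $$ (i, b) * x b) = - (x n * z $ i)" by (simp add: eq_neg_iff_add_eq_0)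
        then show ?thesis using xn by simp
      qed
      finally show "z $ i = (A *\<^sub>v y) $ i" by simp
    qed (use z(1) Ac in simp)
    then show "z \<in> V" unfolding AV by (auto simp: y_def)
  qed
qed

text \<open>The minor \<open>P\<close> is nonzero at one conormal vector, so its nonvanishing locus
  is a nonempty open subset of the image of \<open>mu\<close> and meets every dense set. Over this
  locus \<open>u\<close> has rank \<open>min n (N - n)\<close> and determines
  \<open>V\<close>.\<close>

lemma mu_generically_injective:
  assumes "n \<le> N" "young_diagram n N r" "r = {} \<or> d + 1 \<le> max n (N - n)"
    and corners: "\<forall>(x, y) \<in> outer_corners n N r. x + y - 1 = d"
  shows "\<not> holds_generally (zariski (mat_coords N N) (mu ` conormal_schubert n N r))
    (\<lambda>w. \<not> is_singleton {z \<in> conormal_schubert n N r. mu z = w})"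
proof
  let ?Z = "conormal_schubert n N r" and ?rr = "right_row n N r"
  let ?T = "zariski (mat_coords N N) (mu ` ?Z)"
  assume "holds_generally ?T (\<lambda>w. \<not> is_singleton {z \<in> ?Z. mu z = w})"
  then obtain U where U: "?T closure_of U = mu ` ?Z"
    "\<And>w. w \<in> U \<Longrightarrow> \<not> is_singleton {z \<in> ?Z. mu z = w}"
    unfolding holds_generally_def topspace_zariski by blast
  \<comment> \<open>The surplus of right steps, or 0 by truncation if there is none; in either case
    \<open>q = min n (N - n)\<close>.\<close>
  define e where "e = 2 * n - N"
  define q where "q = n - e"
  let ?C = "{..<N} - ?rr ` {..<n}"
  define c where "c = pick ?C"
  define f where "f a = ?rr (e + a)" for a
  have mono: "strict_mono ?rr" by (rule strict_mono_right_row[OF assms(2)])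
  have rrinj: "?rr a = ?rr b \<longleftrightarrow> a = b" for a b using strict_mono_eq[OF mono] .
  have "card (?rr ` {..<n}) = n"
    using card_image[OF inj_on_subset[OF strict_mono_imp_inj_on[OF mono] subset_UNIV], of "{..<n}"] by simp
  moreover have "?rr ` {..<n} \<subseteq> {..<N}" using right_row_less[OF assms(1)] by auto
  ultimately have cardC: "card ?C = N - n" by (simp add: card_Diff_subset)
  have qC: "q \<le> card ?C" unfolding cardC q_def e_def by simp
  have fN: "f a < N" if "a < q" for a
    unfolding f_def using that by (intro right_row_less[OF assms(1)]) (simp add: q_def)
  have cC: "c a \<in> ?C" if "a < q" for a
    unfolding c_def using that qC by (intro pick_in_set_le) simp
  have cinj: "c a = c b \<longleftrightarrow> a = b" if "a < q" "b < q" for a b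
    using pick_mono_le[of b ?C a] pick_mono_le[of a ?C b] that qC
    unfolding c_def by (cases a b rule: linorder_cases) auto
  have cf: "c a < f a" if "a < q" for a
  proof -
    have "2 * n - N \<le> e + a" "e + a < n" using that by (auto simp: e_def q_def)
    from non_row_pick_less[OF assms(1-3) corners this] show ?thesis
      by (simp add: c_def f_def e_def)
  qed
  have cN: "c a < N" if "a < q" for a using cC[OF that] by simp
  define u where "u = Matrix.mat N N (\<lambda>(i, j). if \<exists>a<q. i = f a \<and> j = c a then 1 else 0 :: complex)"
  have u: "u \<in> carrier_mat N N" by (simp add: u_def)
  define z where "z = (vec_space.col_space N (coordinate_frame n N r), u)"
  have "z \<in> conormal_bundle n N (schubert_cell n N r)"
    unfolding z_def
  proof (rule coordinate_conormal[OF assms(1,2) u])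
    fix i j assume ij: "i < N" "j < N" "u $$ (i, j) \<noteq> 0"
    then obtain a where a: "a < q" "i = f a" "j = c a"
      unfolding u_def by (auto split: if_splits)
    have "i \<in> ?rr ` {..<n}" using a(1,2) by (auto simp: f_def q_def)
    moreover have "j \<notin> ?rr ` {..<n}" using cC[OF a(1)] a(3) by simp
    ultimately show "i \<in> ?rr ` {..<n} \<and> j \<notin> ?rr ` {..<n} \<and> j < i"
      using cf[OF a(1)] a(2,3) by simp
  qed
  then have zZ: "z \<in> ?Z" using conormal_bundle_subset_schubert by blast
  \<comment> \<open>The row and column indices are exchanged because \<open>mu\<close>
    transposes.\<close>
  define P where "P w = det (Matrix.mat q q (\<lambda>(a, b). w $$ (c b, f a)))" for w :: "complex mat"
  have "P \<in> polynomial_functions (mat_coords N N)"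
    unfolding P_def
  proof (rule polynomial_functions_det)
    fix a b assume "a < q" "b < q"
    then show "(\<lambda>w. w $$ (c b, f a)) \<in> polynomial_functions (mat_coords N N)"
      by (intro mat_coord_polynomial cN fN)
  qed
  then have opn: "openin ?T {w \<in> mu ` ?Z. P w \<noteq> 0}" by (rule openin_zariski_nonvanishing)
  have Pmu: "P (mu (V, v)) = det (Matrix.mat q q (\<lambda>(a, b). v $$ (f a, c b)))"
    if "v \<in> carrier_mat N N" for V v
    unfolding P_def mu_def using that cN fN by (intro arg_cong[of _ _ det] cong_mat) auto
  have "Matrix.mat q q (\<lambda>(a, b). u $$ (f a, c b)) = 1\<^sub>m q"
  proof (intro eq_matI)
    fix a b assume "a < dim_row (1\<^sub>m q :: complex mat)" "b < dim_col (1\<^sub>m q :: complex mat)"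
    then have ab: "a < q" "b < q" by simp_all
    have "(\<exists>a'<q. f a = f a' \<and> c b = c a') \<longleftrightarrow> a = b"
      using ab cinj by (auto simp: f_def rrinj)
    then show "Matrix.mat q q (\<lambda>(a, b). u $$ (f a, c b)) $$ (a, b) = 1\<^sub>m q $$ (a, b)"
      using ab fN[OF ab(1)] cN[OF ab(2)] by (simp add: u_def)
  qed simp_all
  then have "P (mu z) = 1" unfolding z_def Pmu[OF u] by simp
  then have muz: "mu z \<in> {w \<in> mu ` ?Z. P w \<noteq> 0}" using zZ by simp
  have "mu z \<in> ?T closure_of U" unfolding U(1) using zZ by blast
  then have "\<forall>W. mu z \<in> W \<and> openin ?T W \<longrightarrow> (\<exists>w. w \<in> U \<and> w \<in> W)"
    unfolding in_closure_of by (rule conjunct2)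
  from this[THEN spec, THEN mp, OF conjI[OF muz opn]]
  obtain w where w: "w \<in> U" "w \<in> mu ` ?Z" "P w \<noteq> 0" by blast
  obtain z1 where z1: "z1 \<in> ?Z" "mu z1 = w" using w(2) by blast
  have "z2 = z1" if z2: "z2 \<in> ?Z" "mu z2 = w" for z2
  proof -
    obtain V1 u1 where eq1: "z1 = (V1, u1)" by (cases z1)
    obtain V2 u2 where eq2: "z2 = (V2, u2)" by (cases z2)
    note eqs = eq1 eq2
    have "transpose_mat u1 = transpose_mat u2" using z1(2) z2(2) by (simp add: eqs mu_def)
    then have "transpose_mat (transpose_mat u2) = transpose_mat (transpose_mat u1)" by simp
    then have ueq: "u2 = u1" by simp
    have cot: "(V1, u1) \<in> cotangent_Gr n N" "(V2, u1) \<in> cotangent_Gr n N"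
      using subsetD[OF conormal_schubert_subset z1(1)] subsetD[OF conormal_schubert_subset z2(1)]
      by (simp_all add: eqs ueq)
    then have u1: "u1 \<in> carrier_mat N N" by (simp add: cotangent_Gr_def)
    have minor: "det (Matrix.mat q q (\<lambda>(a, b). u1 $$ (f a, c b))) \<noteq> 0"
      using w(3) Pmu[OF u1, of V1] z1(2) by (simp add: eqs)
    have "V2 = V1"
    proof (cases "n \<le> N - n")
      case True
      then have q: "q = n" by (simp add: q_def e_def)
      have "Matrix.mat N n (\<lambda>(i, b). u1 $$ (i, c b)) \<in> frames n N V1"
        by (rule image_frame_of_minor[OF cot(1), where f = f and c = c])
          (use fN cN minor in \<open>simp_all add: q\<close>)
      moreover have "Matrix.mat N n (\<lambda>(i, b). u1 $$ (i, c b)) \<in> frames n N V2"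
        by (rule image_frame_of_minor[OF cot(2), where f = f and c = c])
          (use fN cN minor in \<open>simp_all add: q\<close>)
      ultimately show ?thesis by (simp add: frames_def)
    next
      case False
      then have q: "q = N - n" using assms(1) by (simp add: q_def e_def)
      have "inj_on c {..<N - n}" using cinj unfolding q inj_on_def by blast
      moreover have "\<And>a. a < N - n \<Longrightarrow> f a < N" "\<And>a. a < N - n \<Longrightarrow> c a < N"
        using fN cN unfolding q by blast+
      moreover have "det (Matrix.mat (N - n) (N - n) (\<lambda>(a, b). u1 $$ (f a, c b))) \<noteq> 0"
        using minor unfolding q .
      ultimately have "V1 = mat_kernel u1" "V2 = mat_kernel u1"
        using kernel_of_minor[OF cot(1) assms(1), of f c] kernel_of_minor[OF cot(2) assms(1), of f c]
        by simp_all
      then show ?thesis by simp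
    qed
    then show ?thesis by (simp add: eqs ueq)
  qed
  then have "{z \<in> ?Z. mu z = w} = {z1}" using z1 by blast
  then have "is_singleton {z \<in> ?Z. mu z = w}" by (simp add: is_singleton_def)
  then show False using U(2)[OF w(1)] by blast
qed


section \<open>Pencils in the fibres of the moment map\<close>

lemma conormal_bundleD:
  assumes "(V, u) \<in> conormal_bundle n N Y"
  shows "V \<in> Y" "V \<in> Gr n N" "u \<in> carrier_mat N N" "(\<lambda>v. u *\<^sub>v v) ` carrier_vec N \<subseteq> V" "V \<subseteq> mat_kernel u"
  using assms unfolding conormal_bundle_def cotangent_Gr_def by simp_all

lemma image_in_kernel_frame:
  assumes "A \<in> frames n N V" "V \<subseteq> mat_kernel u" "u \<in> carrier_mat N N"
  shows "u * A = 0\<^sub>m N n"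
proof (rule mat_col_eqI)
  have A: "A \<in> carrier_mat N n" and V: "V = (\<lambda>x. A *\<^sub>v x) ` carrier_vec n"
    using assms(1) by (simp_all add: frames_iff)
  show "dim_row (u * A) = dim_row (0\<^sub>m N n :: complex mat)" "dim_col (u * A) = dim_col (0\<^sub>m N n :: complex mat)"
    using A assms(3) by simp_all
  fix b assume "b < dim_col (0\<^sub>m N n :: complex mat)"
  then have b: "b < n" by simp
  have "A *\<^sub>v unit_vec n b \<in> mat_kernel u" using assms(2) V by auto
  then have "u *\<^sub>v (A *\<^sub>v unit_vec n b) = 0\<^sub>v N" using mat_kernelD[OF assms(3)] by blast
  then have "u *\<^sub>v col A b = 0\<^sub>v N" unfolding mat_mult_unit_vec[OF A b] .
  then show "col (u * A) b = col (0\<^sub>m N n) b" using col_mult2[OF assms(3) A b] b by simp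
qed

text \<open>
  The vectors are found by counting: modulo the coordinates at least p, the rank of u is less than
  the dimension q of the image of V, and on these coordinates the kernel of u is bigger than V.
\<close>

lemma pencil_vectors:
  assumes "n \<le> N" "young_diagram n N r" "(V, u) \<in> conormal_bundle n N (schubert_cell n N r)"
    and "q \<le> n" "p \<le> N" "\<And>m. m < q \<Longrightarrow> right_row n N r m < p" "\<And>m. q \<le> m \<Longrightarrow> p \<le> right_row n N r m"
    and "card ({..<p} - right_row n N r ` {..<n}) < q"
    and "n - q < card ({p..<N} - right_row n N r ` {..<n})"
    and A: "A \<in> frames n N V"
      "\<And>a b. a < n \<Longrightarrow> b < n \<Longrightarrow> A $$ (right_row n N r a, b) = (if a = b then 1 else 0)"
  obtains \<xi> w where
    "\<And>i. \<xi> i \<noteq> 0 \<Longrightarrow> i < p" "\<And>i. w i \<noteq> 0 \<Longrightarrow> p \<le> i"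
    "\<And>j. j < N \<Longrightarrow> (\<Sum>i<N. \<xi> i * u $$ (i, j)) = 0" "\<And>i. i < N \<Longrightarrow> (\<Sum>j<N. u $$ (i, j) * w j) = 0"
    "\<exists>b<n. (\<Sum>i<N. \<xi> i * A $$ (i, b)) \<noteq> 0"
    "\<And>y. y < n \<Longrightarrow> w (right_row n N r y) = 0" "\<exists>i<N. w i \<noteq> 0"
proof -
  let ?rr = "right_row n N r"
  let ?R = "?rr ` {..<n}"
  note D = conormal_bundleD[OF assms(3)]
  have u: "u \<in> carrier_mat N N" by (rule D(3))
  have Ac: "A \<in> carrier_mat N n" using A(1) by (simp add: frames_iff)
  have low: "u $$ (a, b) = 0" if "a \<le> b" "b < N" for a b
    by (rule conormal_strictly_lower[OF assms(1-3) that])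
  have rrN: "?rr a < N" if "a < n" for a by (rule right_row_less[OF assms(1) that])
  have inj: "inj_on ?rr {..<n}"
    using inj_on_subset[OF strict_mono_imp_inj_on[OF strict_mono_right_row[OF assms(2)]] subset_UNIV] .
  have uA: "(\<Sum>j<N. u $$ (i, j) * A $$ (j, b)) = 0" if "i < N" "b < n" for i b
    using index_mult_mat_sum[OF u Ac that] image_in_kernel_frame[OF A(1) D(5) u] that by simp
  obtain B where B: "B \<in> carrier_mat n N" "u = A * B" using factor_through_frame[OF A(1) u D(4)] .
  \<comment> \<open>Since \<open>A\<close> is the identity on the pivot rows, the factor
    \<open>B\<close> consists of the pivot rows of \<open>u\<close>; all rows of \<open>u\<close>
    are combinations of these.\<close>
  have uAB: "u $$ (i, j) = (\<Sum>y<n. A $$ (i, y) * u $$ (?rr y, j))" if ij: "i < N" "j < N" for i j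
  proof -
    have uAB': "u $$ (i, j) = (\<Sum>y<n. A $$ (i, y) * B $$ (y, j))" if "i < N" for i
      unfolding B(2) by (rule index_mult_mat_sum[OF Ac B(1) that ij(2)])
    have "u $$ (?rr y, j) = B $$ (y, j)" if "y < n" for y
    proof -
      have "u $$ (?rr y, j) = (\<Sum>c<n. if c = y then B $$ (y, j) else 0)"
        unfolding uAB'[OF rrN[OF that]] using A(2)[OF that] by (intro sum.cong) auto
      then show ?thesis using that by simp
    qed
    then show ?thesis unfolding uAB'[OF ij(1)] by (intro sum.cong) simp_all
  qed
  \<comment> \<open>The functional is a combination of the first \<open>q\<close> pivot coordinates.
    Only the non-pivot columns of \<open>u\<close> with index less than \<open>p\<close> impose
    equations on it.\<close>
  have c1: "card ({..<p} - ?R) < card {..<q}" using assms(8) by simp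
  obtain \<eta> where \<eta>: "\<exists>y\<in>{..<q}. \<eta> y \<noteq> 0"
    "\<forall>j\<in>{..<p} - ?R. (\<Sum>y\<in>{..<q}. u $$ (?rr y, j) * \<eta> y) = 0"
    using homogeneous_system_nontrivial[OF _ _ c1, of "\<lambda>j y. u $$ (?rr y, j)"] by blast
  \<comment> \<open>Dually, the vector is supported on non-pivot coordinates from \<open>p\<close>
    on, and only the \<open>n - q\<close> later pivot rows of \<open>u\<close> impose
    equations.\<close>
  have c2: "card {q..<n} < card ({p..<N} - ?R)" using assms(9) by simp
  obtain \<omega> where \<omega>: "\<exists>j\<in>{p..<N} - ?R. \<omega> j \<noteq> 0"
    "\<forall>y\<in>{q..<n}. (\<Sum>j\<in>{p..<N} - ?R. u $$ (?rr y, j) * \<omega> j) = 0"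
    using homogeneous_system_nontrivial[OF _ _ c2, of "\<lambda>y j. u $$ (?rr y, j)"] by blast
  define \<xi> where "\<xi> i = (\<Sum>y<q. if i = ?rr y then \<eta> y else 0)" for i
  define w where "w j = (if j \<in> {p..<N} - ?R then \<omega> j else 0)" for j
  have \<xi>sum: "(\<Sum>i<N. \<xi> i * f i) = (\<Sum>y<q. \<eta> y * f (?rr y))" for f :: "nat \<Rightarrow> complex"
  proof -
    have "(\<Sum>i<N. \<xi> i * f i) = (\<Sum>i<N. \<Sum>y<q. if i = ?rr y then \<eta> y * f i else 0)"
      unfolding \<xi>_def by (auto simp: sum_distrib_right intro!: sum.cong)
    also have "\<dots> = (\<Sum>y<q. \<Sum>i<N. if i = ?rr y then \<eta> y * f (?rr y) else 0)"
      by (subst sum.swap) (auto intro!: sum.cong)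
    also have "\<dots> = (\<Sum>y<q. \<eta> y * f (?rr y))"
      using rrN assms(4) by (intro sum.cong) auto
    finally show ?thesis .
  qed
  \<comment> \<open>Columns from \<open>p\<close> on cost no equation: the rows used lie before
    \<open>p\<close>, where strict lower triangularity makes these entries zero.\<close>
  have \<xi>u_off: "(\<Sum>i<N. \<xi> i * u $$ (i, j)) = 0" if "j < N" "j \<notin> ?R" for j
  proof (cases "j < p")
    case True
    have "(\<Sum>i<N. \<xi> i * u $$ (i, j)) = (\<Sum>y<q. u $$ (?rr y, j) * \<eta> y)"
      unfolding \<xi>sum by (simp add: mult.commute)
    also have "\<dots> = 0" using \<eta>(2) True that(2) by simp
    finally show ?thesis .
  next
    case False
    have "\<eta> y * u $$ (?rr y, j) = 0" if "y < q" for y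
    proof -
      have "?rr y \<le> j" using assms(6)[OF that] False by simp
      then show ?thesis using low[OF _ \<open>j < N\<close>] by simp
    qed
    then show ?thesis unfolding \<xi>sum by (intro sum.neutral ballI) simp
  qed
  have \<xi>u: "(\<Sum>i<N. \<xi> i * u $$ (i, j)) = 0" if j: "j < N" for j
  proof (cases "j \<in> ?R")
    case False
    then show ?thesis by (rule \<xi>u_off[OF j])
  next
    case True
    then obtain b where b: "j = ?rr b" "b < n" by blast
    let ?S = "\<lambda>j. \<Sum>i<N. \<xi> i * u $$ (i, j)"
    \<comment> \<open>The relation \<open>u * A = 0\<close> recovers pivot columns from non-pivot
      ones: after pairing with \<open>\<xi>\<close> the latter drop out, and the identity on the
      pivot rows of \<open>A\<close> leaves the single column \<open>j\<close>.\<close>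
    have "0 = (\<Sum>i<N. \<xi> i * (\<Sum>j<N. u $$ (i, j) * A $$ (j, b)))"
      using uA[OF _ b(2)] by simp
    also have "\<dots> = (\<Sum>i<N. \<Sum>j<N. \<xi> i * u $$ (i, j) * A $$ (j, b))"
      by (simp add: sum_distrib_left mult.assoc)
    also have "\<dots> = (\<Sum>j<N. ?S j * A $$ (j, b))"
      by (subst sum.swap) (simp add: sum_distrib_right)
    also have "\<dots> = (\<Sum>j\<in>?R. ?S j * A $$ (j, b))"
      by (rule sum.mono_neutral_right) (use rrN \<xi>u_off in auto)
    also have "\<dots> = (\<Sum>a<n. ?S (?rr a) * A $$ (?rr a, b))"
      by (subst sum.reindex[OF inj]) simp
    also have "\<dots> = (\<Sum>a<n. if a = b then ?S (?rr b) else 0)"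
      using A(2) b(2) by (intro sum.cong) auto
    also have "\<dots> = ?S j" using b by simp
    finally show ?thesis by simp
  qed
  have uw_row: "(\<Sum>j<N. u $$ (?rr y, j) * w j) = 0" if y: "y < n" for y
  proof (cases "y < q")
    case True
    have "u $$ (?rr y, j) * w j = 0" if "j < N" for j
    proof (cases "p \<le> j")
      case True
      then have "?rr y \<le> j" using assms(6)[OF \<open>y < q\<close>] by simp
      then show ?thesis using low[OF _ that] by simp
    qed (simp add: w_def)
    then show ?thesis by (intro sum.neutral ballI) simp
  next
    case False
    have "(\<Sum>j<N. u $$ (?rr y, j) * w j) = (\<Sum>j\<in>{p..<N} - ?R. u $$ (?rr y, j) * \<omega> j)"
      by (rule sum.mono_neutral_cong_right) (auto simp: w_def)
    also have "\<dots> = 0" using \<omega>(2) False y by simp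
    finally show ?thesis .
  qed
  have uw: "(\<Sum>j<N. u $$ (i, j) * w j) = 0" if i: "i < N" for i
  proof -
    have "(\<Sum>j<N. u $$ (i, j) * w j) = (\<Sum>j<N. \<Sum>y<n. A $$ (i, y) * (u $$ (?rr y, j) * w j))"
      using uAB[OF i] by (intro sum.cong) (simp_all add: sum_distrib_right mult.assoc)
    also have "\<dots> = (\<Sum>y<n. A $$ (i, y) * (\<Sum>j<N. u $$ (?rr y, j) * w j))"
      by (subst sum.swap) (simp add: sum_distrib_left)
    also have "\<dots> = 0" using uw_row by simp
    finally show ?thesis .
  qed
  have \<xi>A: "(\<Sum>i<N. \<xi> i * A $$ (i, b)) = \<eta> b" if b: "b < q" for b
  proof -
    have "(\<Sum>i<N. \<xi> i * A $$ (i, b)) = (\<Sum>y<q. if y = b then \<eta> b else 0)"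
      unfolding \<xi>sum using A(2) b assms(4) by (intro sum.cong) auto
    then show ?thesis using b by simp
  qed
  have \<xi>p: "i < p" if nz: "\<xi> i \<noteq> 0" for i
  proof (rule ccontr)
    assume "\<not> i < p"
    then have "(if i = ?rr y then \<eta> y else 0) = 0" if "y < q" for y using assms(6)[OF that] by auto
    then have "\<xi> i = 0" unfolding \<xi>_def by (intro sum.neutral) simp
    then show False using nz by simp
  qed
  have \<xi>b: "\<exists>b<n. (\<Sum>i<N. \<xi> i * A $$ (i, b)) \<noteq> 0"
  proof -
    obtain b where b: "b < q" "\<eta> b \<noteq> 0" using \<eta>(1) by blast
    then show ?thesis using \<xi>A[OF b(1)] assms(4) by (intro exI[of _ b]) simp
  qed
  have wi: "\<exists>i<N. w i \<noteq> 0"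
  proof -
    obtain j where "j \<in> {p..<N} - ?R" "\<omega> j \<noteq> 0" using \<omega>(1) by blast
    then show ?thesis by (intro exI[of _ j]) (simp add: w_def)
  qed
  have wp: "p \<le> i" if "w i \<noteq> 0" for i using that unfolding w_def by (simp split: if_splits)
  have wR: "w (?rr y) = 0" if "y < n" for y using that by (simp add: w_def)
  show thesis by (rule that[of \<xi> w, OF \<xi>p wp \<xi>u uw \<xi>b wR wi])
qed

section \<open>Sections along a projective line\<close>

lemma section_holomorphic_along_curve:
  assumes \<sigma>: "\<sigma> \<in> pullback_O_sections n N k Z"
    and "\<And>t. (V t, u) \<in> Z" "\<And>t. B t \<in> frames n N (V t)"
    and hol: "\<And>i j. i < N \<Longrightarrow> j < n \<Longrightarrow> (\<lambda>t. B t $$ (i, j)) holomorphic_on UNIV"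
  shows "(\<lambda>t. \<sigma> (V t, u) (B t)) holomorphic_on UNIV"
  unfolding holomorphic_on_def
proof
  fix t0 :: complex
  have loc: "\<forall>z\<^sub>0 \<in> Z. \<forall>A\<^sub>0 \<in> frames n N (f_GP z\<^sub>0).
        \<exists>P \<in> polynomial_functions (pair_coords n N). \<exists>Q \<in> polynomial_functions (pair_coords n N).
          Q (A\<^sub>0, snd z\<^sub>0) \<noteq> 0 \<and>
          (\<forall>z \<in> Z. \<forall>A \<in> frames n N (f_GP z). Q (A, snd z) \<noteq> 0 \<longrightarrow>
             \<sigma> z A = P (A, snd z) / Q (A, snd z))"
    using \<sigma> unfolding pullback_O_sections_def by simp
  have B: "B t \<in> frames n N (f_GP (V t, u))" for t using assms(3) by (simp add: f_GP_def)
  obtain P Q where PQ: "P \<in> polynomial_functions (pair_coords n N)" "Q \<in> polynomial_functions (pair_coords n N)"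
    "Q (B t0, u) \<noteq> 0"
    and eq: "\<forall>z \<in> Z. \<forall>A \<in> frames n N (f_GP z). Q (A, snd z) \<noteq> 0 \<longrightarrow> \<sigma> z A = P (A, snd z) / Q (A, snd z)"
    using loc[rule_format, OF assms(2) B, of t0] by (elim bexE conjE) simp
  have curve: "(\<lambda>t. F (B t, u)) holomorphic_on UNIV" if "F \<in> polynomial_functions (pair_coords n N)" for F
  proof (rule polynomial_functions_holomorphic[OF that])
    fix f assume "f \<in> pair_coords n N"
    then show "(\<lambda>t. f (B t, u)) holomorphic_on UNIV"
      unfolding pair_coords_def mat_coords_def using hol by auto
  qed
  define S where "S = {t. Q (B t, u) \<noteq> 0}"
  have "open S"
    unfolding S_def using holomorphic_on_imp_continuous_on[OF curve[OF PQ(2)]]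
    by (intro open_Collect_neq continuous_on_const)
  have "(\<lambda>t. P (B t, u) / Q (B t, u)) holomorphic_on S"
    by (intro holomorphic_on_divide holomorphic_on_subset[OF curve[OF PQ(1)]]
        holomorphic_on_subset[OF curve[OF PQ(2)]]) (auto simp: S_def)
  moreover have "P (B t, u) / Q (B t, u) = \<sigma> (V t, u) (B t)" if "t \<in> S" for t
    using eq[rule_format, OF assms(2) B, of t] that by (simp add: S_def)
  ultimately have "(\<lambda>t. \<sigma> (V t, u) (B t)) holomorphic_on S"
    by (subst holomorphic_cong[OF refl, symmetric]) 
  moreover have "t0 \<in> S" using PQ(3) by (simp add: S_def)
  ultimately show "(\<lambda>t. \<sigma> (V t, u) (B t)) field_differentiable at t0 within UNIV"
    using holomorphic_on_imp_differentiable_at \<open>open S\<close> by simp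
qed

lemma sections_change_of_frame:
  assumes "\<sigma> \<in> pullback_O_sections n N k Z" "(V, u) \<in> Z" "A \<in> frames n N V"
    "g \<in> carrier_mat n n" "invertible_mat g"
  shows "\<sigma> (V, u) (A * g) = det g powi k * \<sigma> (V, u) A"
proof -
  have "\<forall>z\<in>Z. \<sigma> z \<in> O_fibre n N k (f_GP z)"
    using assms(1) unfolding pullback_O_sections_def by simp
  from this[rule_format, OF assms(2)] show ?thesis
    using assms(3-5) unfolding O_fibre_def f_GP_def by simp
qed

text \<open>The right factor is a rank one update of the identity that multiplies the row vector
  \<open>\<eta>\<close> by \<open>s\<close>. This cancels the factor \<open>inverse s\<close>, so
  the new frame is polynomial in \<open>s\<close> and extends to \<open>s = 0\<close>.\<close>

lemma rank_one_pencil_frame_mult: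
  fixes A :: "'a::field mat"
  assumes A: "A \<in> carrier_mat N n" and b0: "b0 < n" "\<eta> b0 \<noteq> 0" and s: "s \<noteq> 0"
  shows "Matrix.mat N n (\<lambda>(i, b). A $$ (i, b) + w i * \<eta> b + (s - 1) * \<eta> b / \<eta> b0 * A $$ (i, b0)) =
    Matrix.mat N n (\<lambda>(i, b). A $$ (i, b) + inverse s * (w i * \<eta> b)) *
    Matrix.mat n n (\<lambda>(a, b). if a = b0 then (if b = b0 then 1 else 0) + (s - 1) * \<eta> b / \<eta> b0
      else if a = b then 1 else 0)"
    (is "?C = ?A * ?G")
proof (intro eq_matI)
  fix i b assume "i < dim_row (?A * ?G)" "b < dim_col (?A * ?G)"
  then have ib: "i < N" "b < n" by simp_all
  let ?a = "\<lambda>b. A $$ (i, b) + inverse s * (w i * \<eta> b)"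
  have "(?A * ?G) $$ (i, b) = (\<Sum>c<n. ?A $$ (i, c) * ?G $$ (c, b))"
    by (rule index_mult_mat_sum[OF _ _ ib, where l = n]) simp_all
  also have "\<dots> = (\<Sum>c<n. (if c = b then ?a b else 0) + (if c = b0 then ?a b0 * ((s - 1) * \<eta> b / \<eta> b0) else 0))"
    using ib b0 by (intro sum.cong) (auto simp: algebra_simps)
  also have "\<dots> = ?a b + ?a b0 * ((s - 1) * \<eta> b / \<eta> b0)"
    using ib b0 by (simp add: sum.distrib)
  also have "\<dots> = A $$ (i, b) + w i * \<eta> b + (s - 1) * \<eta> b / \<eta> b0 * A $$ (i, b0)"
    using b0(2) s by (simp add: field_simps)
  finally show "?C $$ (i, b) = (?A * ?G) $$ (i, b)" using ib by simp
qed simp_all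


lemma tendsto_inverse_power_at_infinity:
  fixes h :: "complex \<Rightarrow> complex"
  assumes "isCont h 0" "0 < m"
  shows "((\<lambda>t. inverse t ^ m * h (inverse t)) \<longlongrightarrow> 0) at_infinity"
proof -
  have inv: "(inverse \<longlongrightarrow> (0::complex)) at_infinity" by (rule tendsto_inverse_0)
  have "((\<lambda>t. inverse t ^ m * h (inverse t)) \<longlongrightarrow> 0 ^ m * h 0) at_infinity"
    by (intro tendsto_mult tendsto_power inv isCont_tendsto_compose[OF assms(1) inv])
  moreover have "0 ^ m * h 0 = 0" using assms(2) by simp
  ultimately show ?thesis by (simp only:)
qed

text \<open>The vanishing of sections of a negative line bundle on the projective line, with
  \<open>f\<close> and \<open>h\<close> its expressions in the two charts. Gluing gives
  \<open>f t = t powi k * h (inverse t)\<close> for nonzero \<open>t\<close>, which tends to 0 at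
  infinity, and Liouville applies.\<close>

lemma homogeneous_entire_function_vanishes:
  fixes f h :: "complex \<Rightarrow> complex"
  assumes "f holomorphic_on UNIV" "h holomorphic_on UNIV" "k < (0::int)"
    "\<And>s. s \<noteq> 0 \<Longrightarrow> h s = s powi k * f (inverse s)"
  shows "f z = 0"
proof (rule Liouville_weak[OF assms(1)])
  define m where "m = nat (- k)"
  have m: "0 < m" "k = - int m" using assms(3) by (simp_all add: m_def)
  have "isCont h 0"
    using holomorphic_on_imp_continuous_on[OF assms(2)] by (simp add: continuous_on_eq_continuous_at)
  then have lim: "((\<lambda>t. inverse t ^ m * h (inverse t)) \<longlongrightarrow> 0) at_infinity"
    by (rule tendsto_inverse_power_at_infinity[OF _ m(1)])
  have eq: "inverse t ^ m * h (inverse t) = f t" if "t \<noteq> 0" for t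
  proof -
    have "h (inverse t) = t ^ m * f t"
      using assms(4)[of "inverse t"] that by (simp add: m(2) power_int_minus power_inverse[symmetric])
    moreover have "inverse t ^ m * t ^ m = 1" using that by (simp add: power_mult_distrib[symmetric])
    ultimately show ?thesis by (simp add: mult.assoc[symmetric])
  qed
  have "\<forall>\<^sub>F t in at_infinity. t \<noteq> (0::complex)"
    unfolding eventually_at_infinity by (intro exI[of _ 1]) auto
  then have "\<forall>\<^sub>F t in at_infinity. inverse t ^ m * h (inverse t) = f t"
    by (rule eventually_mono) (rule eq)
  then show "(f \<longlongrightarrow> 0) at_infinity" by (rule Lim_transform_eventually[OF lim])
qed

lemma section_vanishes_on_pencil:
  assumes "n \<le> N" "young_diagram n N r"
    and Vu: "(V, u) \<in> conormal_bundle n N (schubert_cell n N r)"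
    and \<sigma>: "\<sigma> \<in> pullback_O_sections n N k (conormal_schubert n N r)" and k: "k < 0"
    and A: "A \<in> frames n N V"
      "\<And>a b. a < n \<Longrightarrow> b < n \<Longrightarrow> A $$ (right_row n N r a, b) = (if a = b then 1 else 0)"
    and \<xi>: "\<And>i. \<xi> i \<noteq> 0 \<Longrightarrow> i < p" and w: "\<And>i. w i \<noteq> 0 \<Longrightarrow> p \<le> i"
    and \<xi>u: "\<And>j. j < N \<Longrightarrow> (\<Sum>i<N. \<xi> i * u $$ (i, j)) = 0"
    and uw: "\<And>i. i < N \<Longrightarrow> (\<Sum>j<N. u $$ (i, j) * w j) = 0"
    and b0: "b0 < n" "(\<Sum>i<N. \<xi> i * A $$ (i, b0)) \<noteq> 0"
    and wR: "\<And>y. y < n \<Longrightarrow> w (right_row n N r y) = 0" and i0: "i0 < N" "w i0 \<noteq> 0"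
  shows "\<sigma> (V, u) A = 0"
proof -
  let ?rr = "right_row n N r" and ?Y = "schubert_cell n N r" and ?Z = "conormal_schubert n N r"
  note D = conormal_bundleD[OF Vu]
  have u: "u \<in> carrier_mat N N" by (rule D(3))
  have Ac: "A \<in> carrier_mat N n" using A(1) by (simp add: frames_iff)
  have uA: "u * A = 0\<^sub>m N n" by (rule image_in_kernel_frame[OF A(1) D(5) u])
  define \<eta> where "\<eta> b = (\<Sum>i<N. \<xi> i * A $$ (i, b))" for b
  have \<eta>b0: "\<eta> b0 \<noteq> 0" using b0(2) by (simp add: \<eta>_def)
  \<comment> \<open>The rank one matrix \<open>w \<xi>\<close>. As \<open>p\<close> separates the
    two supports, it is strictly lower triangular with square zero; as \<open>\<xi>\<close> kills
    the image of \<open>u\<close> and \<open>u\<close> kills \<open>w\<close>, both products with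
    \<open>u\<close> vanish. Hence the matrices \<open>1 + t K\<close> form a unipotent group fixing
    \<open>u\<close>.\<close>
  define K where "K = Matrix.mat N N (\<lambda>(i, j). w i * \<xi> j)"
  have Kc: "K \<in> carrier_mat N N" by (simp add: K_def)
  have K0: "K $$ (i, j) = 0" if "i \<le> j" "i < N" "j < N" for i j
  proof -
    have "w i = 0 \<or> \<xi> j = 0" using \<xi>[of j] w[of i] that(1) by linarith
    then show ?thesis using that by (auto simp: K_def)
  qed
  have Ku: "K * u = 0\<^sub>m N N"
  proof (intro eq_matI)
    fix i j assume "i < dim_row (0\<^sub>m N N :: complex mat)" "j < dim_col (0\<^sub>m N N :: complex mat)"
    then have ij: "i < N" "j < N" by simp_all
    have "(K * u) $$ (i, j) = (\<Sum>c<N. K $$ (i, c) * u $$ (c, j))" by (rule index_mult_mat_sum[OF Kc u ij])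
    also have "\<dots> = w i * (\<Sum>c<N. \<xi> c * u $$ (c, j))"
      using ij by (simp add: K_def sum_distrib_left mult.assoc)
    finally show "(K * u) $$ (i, j) = 0\<^sub>m N N $$ (i, j)" using \<xi>u ij by simp
  qed (use Kc u in simp_all)
  have uK: "u * K = 0\<^sub>m N N"
  proof (intro eq_matI)
    fix i j assume "i < dim_row (0\<^sub>m N N :: complex mat)" "j < dim_col (0\<^sub>m N N :: complex mat)"
    then have ij: "i < N" "j < N" by simp_all
    have "(u * K) $$ (i, j) = (\<Sum>c<N. u $$ (i, c) * K $$ (c, j))" by (rule index_mult_mat_sum[OF u Kc ij])
    also have "\<dots> = (\<Sum>c<N. u $$ (i, c) * w c) * \<xi> j"
      using ij by (simp add: K_def sum_distrib_right mult.assoc)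
    finally show "(u * K) $$ (i, j) = 0\<^sub>m N N $$ (i, j)" using uw ij by simp
  qed (use Kc u in simp_all)
  have KK: "K * K = 0\<^sub>m N N"
  proof (intro eq_matI)
    fix i j assume "i < dim_row (0\<^sub>m N N :: complex mat)" "j < dim_col (0\<^sub>m N N :: complex mat)"
    then have ij: "i < N" "j < N" by simp_all
    have "(K * K) $$ (i, j) = (\<Sum>c<N. K $$ (i, c) * K $$ (c, j))" by (rule index_mult_mat_sum[OF Kc Kc ij])
    also have "\<dots> = 0"
    proof (intro sum.neutral ballI)
      fix c assume "c \<in> {..<N}"
      moreover have "\<xi> c = 0 \<or> w c = 0" using \<xi>[of c] w[of c] by linarith
      ultimately show "K $$ (i, c) * K $$ (c, j) = 0" using ij by (auto simp: K_def)
    qed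
    finally show "(K * K) $$ (i, j) = 0\<^sub>m N N $$ (i, j)" using ij by simp
  qed (use Kc in simp_all)
  define g where "g t = 1\<^sub>m N + t \<cdot>\<^sub>m K" for t
  have gc: "g t \<in> carrier_mat N N" for t by (simp add: g_def Kc)
  have tK: "t \<cdot>\<^sub>m K \<in> carrier_mat N N" for t using Kc by simp
  have gl: "g t \<in> lower_triangular_units N" for t
    using K0 Kc by (auto simp: lower_triangular_units_def g_def)
  have gg: "g t * g (- t) = 1\<^sub>m N" for t
  proof -
    have "g t * g (- t) = g t + g t * ((- t) \<cdot>\<^sub>m K)"
      unfolding g_def[of "- t"] using gc[of t] tK by (simp add: mult_add_distrib_mat[of _ N N _ N])
    also have "g t * ((- t) \<cdot>\<^sub>m K) = (- t) \<cdot>\<^sub>m (g t * K)"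
      by (rule mult_smult_distrib[OF gc Kc])
    also have "g t * K = 1\<^sub>m N * K + (t \<cdot>\<^sub>m K) * K"
      unfolding g_def by (rule add_mult_distrib_mat[OF one_carrier_mat tK Kc])
    also have "(t \<cdot>\<^sub>m K) * K = t \<cdot>\<^sub>m (K * K)" by (rule mult_smult_assoc_mat[OF Kc Kc])
    finally show ?thesis unfolding KK g_def using Kc by (intro eq_matI) auto
  qed
  have gu: "g t * u = u" for t
  proof -
    have "g t * u = 1\<^sub>m N * u + (t \<cdot>\<^sub>m K) * u"
      unfolding g_def by (rule add_mult_distrib_mat[OF one_carrier_mat tK u])
    also have "(t \<cdot>\<^sub>m K) * u = t \<cdot>\<^sub>m (K * u)" by (rule mult_smult_assoc_mat[OF Kc u])
    finally show ?thesis unfolding Ku using u by (intro eq_matI) auto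
  qed
  have ug: "u * g t = u" for t
  proof -
    have "u * g t = u * 1\<^sub>m N + u * (t \<cdot>\<^sub>m K)"
      unfolding g_def by (rule mult_add_distrib_mat[OF u one_carrier_mat tK])
    also have "u * (t \<cdot>\<^sub>m K) = t \<cdot>\<^sub>m (u * K)" by (rule mult_smult_distrib[OF u Kc])
    finally show ?thesis unfolding uK using u by (intro eq_matI) auto
  qed
  define V' where "V' t = (\<lambda>v. g t *\<^sub>v v) ` V" for t
  have V'u: "(V' t, u) \<in> conormal_bundle n N ?Y" for t
    unfolding V'_def using gg[of "- t"]
    by (intro conormal_bundle_translate[OF assms(1,2) Vu gl gl[of "- t"] gg _ gu ug]) simp
  define A' where "A' t = Matrix.mat N n (\<lambda>(i, b). A $$ (i, b) + t * (w i * \<eta> b))" for t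
  have A'g: "g t * A = A' t" for t
  proof (intro eq_matI)
    fix i b assume "i < dim_row (A' t)" "b < dim_col (A' t)"
    then have ib: "i < N" "b < n" by (simp_all add: A'_def)
    have "(K * A) $$ (i, b) = (\<Sum>c<N. K $$ (i, c) * A $$ (c, b))" by (rule index_mult_mat_sum[OF Kc Ac ib])
    also have "\<dots> = w i * \<eta> b" using ib by (simp add: K_def \<eta>_def sum_distrib_left mult.assoc)
    finally have KA: "(K * A) $$ (i, b) = w i * \<eta> b" .
    have "g t * A = 1\<^sub>m N * A + (t \<cdot>\<^sub>m K) * A"
      unfolding g_def by (rule add_mult_distrib_mat[OF one_carrier_mat tK Ac])
    also have "(t \<cdot>\<^sub>m K) * A = t \<cdot>\<^sub>m (K * A)" by (rule mult_smult_assoc_mat[OF Kc Ac])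
    finally have "(g t * A) $$ (i, b) = A $$ (i, b) + t * (K * A) $$ (i, b)" using Ac Kc ib by simp
    then show "(g t * A) $$ (i, b) = A' t $$ (i, b)" unfolding KA using ib by (simp add: A'_def)
  qed (use gc[of t] Ac in \<open>simp_all add: A'_def\<close>)
  have A'f: "A' t \<in> frames n N (V' t)" for t
    unfolding A'g[symmetric] V'_def by (rule frames_left_mult[OF A(1) gc])
  define G where "G s = Matrix.mat n n (\<lambda>(a, b). if a = b0 then (if b = b0 then 1 else 0) + (s - 1) * \<eta> b / \<eta> b0
      else if a = b then 1 else 0)" for s
  have Gc: "G s \<in> carrier_mat n n" for s by (simp add: G_def)
  have detG: "det (G s) = s" for s
    unfolding G_def by (subst det_identity_replace_row[OF b0(1)]) (use \<eta>b0 in simp)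
  have Ginv: "invertible_mat (G s)" if "s \<noteq> 0" for s
    using invertible_mat_iff_det_nonzero[OF Gc] detG that by simp
  \<comment> \<open>a frame of the pencil that stays polynomial at its point at infinity, s = 1 / t = 0\<close>
  define C where "C s = Matrix.mat N n (\<lambda>(i, b). A $$ (i, b) + w i * \<eta> b + (s - 1) * \<eta> b / \<eta> b0 * A $$ (i, b0))" for s
  have Cc: "C s \<in> carrier_mat N n" for s by (simp add: C_def)
  have CG: "C s = A' (inverse s) * G s" if "s \<noteq> 0" for s
    unfolding C_def A'_def G_def by (rule rank_one_pencil_frame_mult[where \<eta> = \<eta> and w = w, OF Ac b0(1) \<eta>b0 that])
  \<comment> \<open>The space \<open>W 0\<close> is spanned by \<open>w\<close> and the hyperplane
    of \<open>V\<close> on which \<open>\<xi>\<close> vanishes. It lies outside the cell, because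
    \<open>w\<close> vanishes on the pivot rows.\<close>
  define W where "W s = (if s = 0 then vec_space.col_space N (C 0) else V' (inverse s))" for s
  have Cf: "C s \<in> frames n N (W s)" for s
  proof (cases "s = 0")
    case True
    then show ?thesis by (simp add: W_def frames_def Cc)
  next
    case False
    then show ?thesis using frames_mult[OF A'f Gc Ginv] by (simp add: W_def CG)
  qed
  have C0i: "(C 0 *\<^sub>v x) $ i = (A *\<^sub>v x) $ i + (w i - A $$ (i, b0) / \<eta> b0) * (\<Sum>b<n. \<eta> b * x $ b)"
    if x: "x \<in> carrier_vec n" and i: "i < N" for x i
  proof -
    have "(C 0 *\<^sub>v x) $ i = (\<Sum>b<n. (A $$ (i, b) + w i * \<eta> b + (0 - 1) * \<eta> b / \<eta> b0 * A $$ (i, b0)) * x $ b)"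
      using x i by (auto simp: C_def scalar_prod_def lessThan_atLeast0 intro!: sum.cong)
    also have "\<dots> = (\<Sum>b<n. A $$ (i, b) * x $ b + (w i - A $$ (i, b0) / \<eta> b0) * (\<eta> b * x $ b))"
      by (intro sum.cong refl) (simp add: algebra_simps)
    also have "\<dots> = (\<Sum>b<n. A $$ (i, b) * x $ b) + (w i - A $$ (i, b0) / \<eta> b0) * (\<Sum>b<n. \<eta> b * x $ b)"
      by (simp add: sum.distrib sum_distrib_left)
    also have "(\<Sum>b<n. A $$ (i, b) * x $ b) = (A *\<^sub>v x) $ i"
      using x i Ac by (auto simp: scalar_prod_def lessThan_atLeast0 intro!: sum.cong)
    finally show ?thesis .
  qed
  have AxR: "(A *\<^sub>v x) $ ?rr a = x $ a" if x: "x \<in> carrier_vec n" and a: "a < n" for x a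
  proof -
    have "(A *\<^sub>v x) $ ?rr a = (\<Sum>b<n. A $$ (?rr a, b) * x $ b)"
      using x right_row_less[OF assms(1) a, of r] Ac
      by (auto simp: scalar_prod_def lessThan_atLeast0 intro!: sum.cong)
    also have "\<dots> = (\<Sum>b<n. if b = a then x $ a else 0)" using A(2)[OF a] by (intro sum.cong) auto
    finally show ?thesis using a by simp
  qed
  \<comment> \<open>The pivot rows, where \<open>w\<close> vanishes, force a relation to be a
    multiple of the \<open>b0\<close>-th unit vector; row \<open>i0\<close>, where \<open>w\<close>
    does not vanish, excludes that.\<close>
  have C0inj: "inj_columns (C 0)"
    unfolding inj_columns_def
  proof (intro ballI impI)
    fix x assume "x \<in> carrier_vec (dim_col (C 0))" and "C 0 *\<^sub>v x = 0\<^sub>v (dim_row (C 0))"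
    then have x: "x \<in> carrier_vec n" and C0x: "C 0 *\<^sub>v x = 0\<^sub>v N" using Cc[of 0] by simp_all
    let ?e = "\<Sum>b<n. \<eta> b * x $ b"
    have xa: "x $ a = A $$ (?rr a, b0) / \<eta> b0 * ?e" if a: "a < n" for a
    proof -
      have "0 = x $ a + (0 - A $$ (?rr a, b0) / \<eta> b0) * ?e"
        using C0i[OF x right_row_less[OF assms(1) a, of r]] C0x right_row_less[OF assms(1) a, of r]
          wR[OF a] AxR[OF x a] by simp
      then show ?thesis by (simp add: algebra_simps)
    qed
    have x0: "x $ a = 0" if "a < n" "a \<noteq> b0" for a
      using xa[OF that(1)] A(2)[OF that(1) b0(1)] that(2) by simp
    have Axi: "(A *\<^sub>v x) $ i0 = A $$ (i0, b0) * x $ b0"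
    proof -
      have "(A *\<^sub>v x) $ i0 = (\<Sum>b<n. A $$ (i0, b) * x $ b)"
        using x i0 Ac by (auto simp: scalar_prod_def lessThan_atLeast0 intro!: sum.cong)
      also have "\<dots> = (\<Sum>b<n. if b = b0 then A $$ (i0, b0) * x $ b0 else 0)"
        using x0 by (intro sum.cong) auto
      finally show ?thesis using b0(1) by simp
    qed
    have e: "?e = \<eta> b0 * x $ b0"
    proof -
      have "?e = (\<Sum>b<n. if b = b0 then \<eta> b0 * x $ b0 else 0)"
        using x0 by (intro sum.cong) auto
      then show ?thesis using b0(1) by simp
    qed
    have "0 = A $$ (i0, b0) * x $ b0 + (w i0 - A $$ (i0, b0) / \<eta> b0) * (\<eta> b0 * x $ b0)"
      using C0i[OF x i0(1)] C0x i0(1) Axi e by simp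
    also have "\<dots> = w i0 * \<eta> b0 * x $ b0" using \<eta>b0 by (simp add: field_simps)
    finally have xb0: "x $ b0 = 0" using i0(2) \<eta>b0 by simp
    show "x = 0\<^sub>v (dim_col (C 0))"
    proof (intro eq_vecI)
      fix a assume "a < dim_vec (0\<^sub>v (dim_col (C 0)) :: complex vec)"
      then have "a < n" using Cc[of 0] by simp
      then show "x $ a = 0\<^sub>v (dim_col (C 0)) $ a" using x0 xb0 Cc[of 0] by (cases "a = b0") simp_all
    qed (use x Cc[of 0] in simp)
  qed
  have W0Gr: "W 0 \<in> Gr n N" unfolding W_def using inj_columns_in_Gr[OF Cc C0inj] by simp
  have W0: "W 0 = (\<lambda>x. C 0 *\<^sub>v x) ` carrier_vec n" using Cf[of 0] by (simp add: frames_iff)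
  have "(\<lambda>v. u *\<^sub>v v) ` carrier_vec N \<subseteq> W 0"
  proof
    fix z assume "z \<in> (\<lambda>v. u *\<^sub>v v) ` carrier_vec N"
    then obtain v where v: "v \<in> carrier_vec N" "z = u *\<^sub>v v" by blast
    then have "z \<in> V" using D(4) by blast
    then obtain x where x: "x \<in> carrier_vec n" "z = A *\<^sub>v x" using A(1) by (auto simp: frames_iff)
    \<comment> \<open>For a vector in the image of \<open>u\<close> this number is its value under
      \<open>\<xi>\<close>, hence 0; on such coordinates \<open>C 0\<close> and \<open>A\<close>
      agree.\<close>
    have "(\<Sum>b<n. \<eta> b * x $ b) = (\<Sum>b<n. \<Sum>i<N. \<xi> i * (A $$ (i, b) * x $ b))"
      unfolding \<eta>_def by (simp add: sum_distrib_right mult.assoc)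
    also have "\<dots> = (\<Sum>i<N. \<xi> i * (A *\<^sub>v x) $ i)"
    proof (subst sum.swap, intro sum.cong refl)
      fix i assume "i \<in> {..<N}"
      then have "(A *\<^sub>v x) $ i = (\<Sum>b<n. A $$ (i, b) * x $ b)"
        using x(1) Ac by (auto simp: scalar_prod_def lessThan_atLeast0 intro!: sum.cong)
      then show "(\<Sum>b<n. \<xi> i * (A $$ (i, b) * x $ b)) = \<xi> i * (A *\<^sub>v x) $ i"
        by (simp add: sum_distrib_left)
    qed
    also have "\<dots> = (\<Sum>i<N. \<Sum>j<N. \<xi> i * u $$ (i, j) * v $ j)"
      unfolding x(2)[symmetric] v(2)
    proof (intro sum.cong refl)
      fix i assume "i \<in> {..<N}"
      then have "(u *\<^sub>v v) $ i = (\<Sum>j<N. u $$ (i, j) * v $ j)"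
        using v(1) u by (auto simp: scalar_prod_def lessThan_atLeast0 intro!: sum.cong)
      then show "\<xi> i * (u *\<^sub>v v) $ i = (\<Sum>j<N. \<xi> i * u $$ (i, j) * v $ j)"
        by (simp add: sum_distrib_left mult.assoc)
    qed
    also have "\<dots> = (\<Sum>j<N. (\<Sum>i<N. \<xi> i * u $$ (i, j)) * v $ j)"
      by (subst sum.swap) (simp add: sum_distrib_right)
    also have "\<dots> = 0" using \<xi>u by simp
    finally have e0: "(\<Sum>b<n. \<eta> b * x $ b) = 0" .
    have "z = C 0 *\<^sub>v x"
    proof (intro eq_vecI)
      fix i assume "i < dim_vec (C 0 *\<^sub>v x)"
      then have "i < N" using Cc[of 0] by simp
      then show "z $ i = (C 0 *\<^sub>v x) $ i" using C0i[OF x(1)] e0 x(2) by simp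
    qed (use x Ac Cc[of 0] in simp)
    then show "z \<in> W 0" unfolding W0 using x(1) by blast
  qed
  moreover have "W 0 \<subseteq> mat_kernel u"
  proof -
    have uA0: "(\<Sum>c<N. u $$ (i, c) * A $$ (c, b)) = 0" if "i < N" "b < n" for i b
      using index_mult_mat_sum[OF u Ac that] uA that by simp
    have uC: "u * C 0 = 0\<^sub>m N n"
    proof (intro eq_matI)
      fix i b assume "i < dim_row (0\<^sub>m N n :: complex mat)" "b < dim_col (0\<^sub>m N n :: complex mat)"
      then have ib: "i < N" "b < n" by simp_all
      have "(u * C 0) $$ (i, b) = (\<Sum>c<N. u $$ (i, c) * C 0 $$ (c, b))"
        by (rule index_mult_mat_sum[OF u Cc ib])
      also have "\<dots> = (\<Sum>c<N. u $$ (i, c) * A $$ (c, b) + u $$ (i, c) * w c * \<eta> b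
          + (- \<eta> b / \<eta> b0) * (u $$ (i, c) * A $$ (c, b0)))"
        using ib by (intro sum.cong) (simp_all add: C_def algebra_simps)
      also have "\<dots> = (\<Sum>c<N. u $$ (i, c) * A $$ (c, b)) + (\<Sum>c<N. u $$ (i, c) * w c) * \<eta> b
          + (- \<eta> b / \<eta> b0) * (\<Sum>c<N. u $$ (i, c) * A $$ (c, b0))"
        by (simp only: sum.distrib sum_distrib_left sum_distrib_right)
      also have "\<dots> = 0" using uA0[OF ib] uA0[OF ib(1) b0(1)] uw[OF ib(1)] by simp
      finally show "(u * C 0) $$ (i, b) = 0\<^sub>m N n $$ (i, b)" using ib by simp
    qed (use u Cc[of 0] in simp_all)
    show ?thesis
    proof
      fix z assume "z \<in> W 0"
      then obtain x where x: "x \<in> carrier_vec n" "z = C 0 *\<^sub>v x" unfolding W0 by blast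
      have "u *\<^sub>v z = (u * C 0) *\<^sub>v x"
        unfolding x(2) by (rule assoc_mult_mat_vec[OF u Cc x(1), symmetric])
      also have "\<dots> = 0\<^sub>v N" unfolding uC using x(1) by (intro eq_vecI) auto
      finally show "z \<in> mat_kernel u"
        unfolding x(2) by (intro mat_kernelI[OF u] mult_mat_vec_carrier[OF Cc x(1)])
    qed
  qed
  ultimately have W0cot: "(W 0, u) \<in> cotangent_Gr n N"
    using W0Gr u by (simp add: cotangent_Gr_def)
  have Wbundle: "(W s, u) \<in> conormal_bundle n N ?Y" if "s \<noteq> 0" for s
    using V'u that by (simp add: W_def)
  have Chol: "(\<lambda>s. C s $$ (i, j)) holomorphic_on UNIV" if "i < N" "j < n" for i j
    using that by (auto simp: C_def intro!: holomorphic_intros)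
  have A'hol: "(\<lambda>t. A' t $$ (i, j)) holomorphic_on UNIV" if "i < N" "j < n" for i j
    using that by (auto simp: A'_def intro!: holomorphic_intros)
  have WGr: "W s \<in> Gr n N" for s
    using W0Gr conormal_bundleD(2)[OF Wbundle] by (cases "s = 0") simp_all
  \<comment> \<open>A Zariski neighbourhood of the limit point pulls back to an open set of
    parameters around 0. It contains some nonzero \<open>s\<close>, where the pencil is in the
    conormal bundle.\<close>
  have W0Z: "(W 0, u) \<in> ?Z"
    unfolding conormal_schubert_def in_closure_of topspace_cotangent
  proof (intro conjI allI impI W0cot)
    fix T assume T: "(W 0, u) \<in> T \<and> openin (subtopology (Gr_mat_topology n N) (cotangent_Gr n N)) T"
    then obtain T' where T': "openin (Gr_mat_topology n N) T'" "T = T' \<inter> cotangent_Gr n N"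
      unfolding openin_subtopology by blast
    let ?S = "frame_preimage n N (Gr n N \<times> carrier_mat N N)"
    have opn: "openin (zariski (pair_coords n N) ?S) (frame_preimage n N T')"
      using T'(1) unfolding openin_Gr_mat_iff by blast
    have CS: "(C s, u) \<in> ?S" for s
      unfolding frame_preimage_def using Cf[of s] WGr[of s] u by blast
    have "open {s. (C s, u) \<in> frame_preimage n N T'}"
    proof (rule open_preimage_zariski[OF opn _ CS])
      fix f assume "f \<in> pair_coords n N"
      then show "(\<lambda>s. f (C s, u)) holomorphic_on UNIV"
        unfolding pair_coords_def mat_coords_def using Chol by auto
    qed
    moreover have "0 \<in> {s. (C s, u) \<in> frame_preimage n N T'}"
      using T T'(2) Cf[of 0] unfolding frame_preimage_def by blast
    ultimately obtain \<epsilon> where \<epsilon>: "\<epsilon> > 0" "ball 0 \<epsilon> \<subseteq> {s. (C s, u) \<in> frame_preimage n N T'}"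
      using open_contains_ball by blast
    let ?s = "complex_of_real (\<epsilon> / 2)"
    have "?s \<in> ball 0 \<epsilon>" using \<epsilon>(1) by (simp add: dist_norm)
    then have "(C ?s, u) \<in> frame_preimage n N T'" using \<epsilon>(2) by blast
    then obtain V'' where V'': "(V'', u) \<in> T'" "C ?s \<in> frames n N V''"
      unfolding frame_preimage_def by blast
    have "V'' = W ?s" using V''(2) Cf[of ?s] by (simp add: frames_def)
    moreover have "(W ?s, u) \<in> conormal_bundle n N ?Y" using \<epsilon>(1) by (intro Wbundle) simp
    moreover from this have "(W ?s, u) \<in> cotangent_Gr n N" by (simp add: conormal_bundle_def)
    ultimately show "\<exists>z. z \<in> conormal_bundle n N ?Y \<and> z \<in> T"
      using V''(1) unfolding T'(2) by blast
  qed
  have V'Z: "(V' t, u) \<in> ?Z" for t using V'u conormal_bundle_subset_schubert by blast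
  have WZ: "(W s, u) \<in> ?Z" for s
    using W0Z subsetD[OF conormal_bundle_subset_schubert Wbundle] by (cases "s = 0") simp_all
  have "\<sigma> (V' 0, u) (A' 0) = 0"
  proof (rule homogeneous_entire_function_vanishes[where f = "\<lambda>t. \<sigma> (V' t, u) (A' t)" and
        h = "\<lambda>s. \<sigma> (W s, u) (C s)", OF _ _ k])
    show "(\<lambda>t. \<sigma> (V' t, u) (A' t)) holomorphic_on UNIV"
      by (rule section_holomorphic_along_curve[OF \<sigma> V'Z A'f A'hol])
    show "(\<lambda>s. \<sigma> (W s, u) (C s)) holomorphic_on UNIV"
      by (rule section_holomorphic_along_curve[OF \<sigma> WZ Cf Chol])
    fix s :: complex assume s: "s \<noteq> 0"
    then have "\<sigma> (W s, u) (C s) = \<sigma> (V' (inverse s), u) (A' (inverse s) * G s)"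
      by (simp add: W_def CG)
    also have "\<dots> = det (G s) powi k * \<sigma> (V' (inverse s), u) (A' (inverse s))"
      by (rule sections_change_of_frame[OF \<sigma> V'Z A'f Gc Ginv[OF s]])
    finally show "\<sigma> (W s, u) (C s) = s powi k * \<sigma> (V' (inverse s), u) (A' (inverse s))"
      unfolding detG .
  qed
  moreover have "A' 0 = A" using Ac by (intro eq_matI) (auto simp: A'_def)
  moreover have "V' 0 = V" using A'f[of 0] A(1) \<open>A' 0 = A\<close> by (simp add: frames_def)
  ultimately show ?thesis by simp
qed

text \<open>The pencil argument applies to a frame normalised on the pivot rows; the transformation
  rule of the line bundle carries the vanishing to all other frames.\<close>

lemma sections_vanish_on_conormal_bundle:
  assumes "n \<le> N" "young_diagram n N r" "r \<noteq> {}" "n \<le> d" "N - n \<le> d"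
    and corners: "\<forall>(x, y) \<in> outer_corners n N r. x + y - 1 = d"
    and \<sigma>: "\<sigma> \<in> pullback_O_sections n N k (conormal_schubert n N r)" and k: "k < 0"
    and Vu: "(V, u) \<in> conormal_bundle n N (schubert_cell n N r)" and A': "A' \<in> frames n N V"
  shows "\<sigma> (V, u) A' = 0"
proof -
  obtain q p where pq: "q \<le> n" "p \<le> N" "\<And>m. m < q \<Longrightarrow> right_row n N r m < p"
    "\<And>m. q \<le> m \<Longrightarrow> p \<le> right_row n N r m"
    "card ({..<p} - right_row n N r ` {..<n}) < q"
    "n - q < card ({p..<N} - right_row n N r ` {..<n})"
    by (rule corner_split[OF assms(1-5) corners]) (rule that; (assumption | blast))
  have V: "V \<in> schubert_cell n N r" "V \<in> Gr n N" using conormal_bundleD[OF Vu] by simp_all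
  obtain A where A: "A \<in> frames n N V" "echelon n N r A"
    "\<And>a b. a < n \<Longrightarrow> b < n \<Longrightarrow> A $$ (right_row n N r a, b) = (if a = b then 1 else 0)"
    by (rule schubert_cell_normal_frame[OF assms(1,2) V(1)]) (rule that; (assumption | blast))
  obtain \<xi> w where \<xi>w: "\<And>i. \<xi> i \<noteq> 0 \<Longrightarrow> i < p" "\<And>i. w i \<noteq> 0 \<Longrightarrow> p \<le> i"
    "\<And>j. j < N \<Longrightarrow> (\<Sum>i<N. \<xi> i * u $$ (i, j)) = 0" "\<And>i. i < N \<Longrightarrow> (\<Sum>j<N. u $$ (i, j) * w j) = 0"
    "\<exists>b<n. (\<Sum>i<N. \<xi> i * A $$ (i, b)) \<noteq> 0"
    "\<And>y. y < n \<Longrightarrow> w (right_row n N r y) = 0" "\<exists>i<N. w i \<noteq> 0"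
    by (rule pencil_vectors[OF assms(1,2) Vu pq A(1,3)]) (assumption | (rule that; (assumption | blast)))+
  obtain b0 where b0: "b0 < n" "(\<Sum>i<N. \<xi> i * A $$ (i, b0)) \<noteq> 0" using \<xi>w(5) by blast
  obtain i0 where i0: "i0 < N" "w i0 \<noteq> 0" using \<xi>w(7) by blast
  have "\<sigma> (V, u) A = 0"
    by (rule section_vanishes_on_pencil[OF assms(1,2) Vu \<sigma> k A(1,3) \<xi>w(1-4) b0 \<xi>w(6) i0])
  moreover obtain g where g: "g \<in> carrier_mat n n" "invertible_mat g" "A' = A * g"
    by (rule frames_change_of_basis[OF V(2) A(1) A'])
  moreover have "(V, u) \<in> conormal_schubert n N r" using Vu conormal_bundle_subset_schubert by blast
  ultimately show ?thesis using sections_change_of_frame[OF \<sigma> _ A(1) g(1,2)] by simp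
qed


section \<open>Sections of powers of the Pluecker bundle\<close>

text \<open>An arbitrary polynomial \<open>R\<close> is not homogeneous under change of basis, so
  its nonvanishing depends on the frame. The preimage in the frame bundle is the union, over all
  invertible \<open>g\<close>, of the loci where \<open>R (A * g, u)\<close> is nonzero.\<close>

lemma openin_Gr_mat_nonvanishing:
  assumes R: "R \<in> polynomial_functions (pair_coords n N)"
  shows "openin (Gr_mat_topology n N)
    {(V, u). V \<in> Gr n N \<and> u \<in> carrier_mat N N \<and> (\<exists>A \<in> frames n N V. R (A, u) \<noteq> 0)}"
    (is "openin _ ?W")
  unfolding openin_Gr_mat_iff
proof
  show "?W \<subseteq> Gr n N \<times> carrier_mat N N" by blast
  let ?S = "frame_preimage n N (Gr n N \<times> carrier_mat N N)"
  define \<phi> where "\<phi> g p = (Matrix.mat N n (\<lambda>(i, j). \<Sum>c<n. fst p $$ (i, c) * g $$ (c, j)), snd p)"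
    for g :: "complex mat" and p :: "complex mat \<times> complex mat"
  have \<phi>: "\<phi> g (A, u) = (A * g, u)" if "A \<in> carrier_mat N n" "g \<in> carrier_mat n n" for g A u
  proof -
    have "Matrix.mat N n (\<lambda>(i, j). \<Sum>c<n. A $$ (i, c) * g $$ (c, j)) = A * g"
      using that by (intro eq_matI) (auto simp: index_mult_mat_sum[OF that] simp del: index_mult_mat(1))
    then show ?thesis by (simp add: \<phi>_def)
  qed
  have R\<phi>: "(\<lambda>p. R (\<phi> g p)) \<in> polynomial_functions (pair_coords n N)" for g
  proof (rule polynomial_functions_compose[OF R])
    fix f assume "f \<in> pair_coords n N"
    then consider (1) i j where "f = (\<lambda>p. fst p $$ (i, j))" "i < N" "j < n"
      | (2) i j where "f = (\<lambda>p. snd p $$ (i, j))" "i < N" "j < N"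
      unfolding pair_coords_def mat_coords_def by auto
    then show "(\<lambda>p. f (\<phi> g p)) \<in> polynomial_functions (pair_coords n N)"
    proof cases
      case 1
      have "(\<lambda>p. f (\<phi> g p)) = (\<lambda>p. \<Sum>c<n. fst p $$ (i, c) * g $$ (c, j))"
        using 1 by (simp add: \<phi>_def)
      also have "\<dots> \<in> polynomial_functions (pair_coords n N)"
      proof (intro polynomial_functions_sum polynomial_functions.mult polynomial_functions.const)
        fix c assume "c \<in> {..<n}"
        then have "(\<lambda>p. fst p $$ (i, c)) \<in> pair_coords n N"
          using 1 unfolding pair_coords_def mat_coords_def by auto
        then show "(\<lambda>p. fst p $$ (i, c)) \<in> polynomial_functions (pair_coords n N)"
          by (rule polynomial_functions.coord)
      qed simp
      finally show ?thesis .
    next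
      case 2
      have "(\<lambda>p. f (\<phi> g p)) = f" using 2 by (simp add: \<phi>_def)
      then show ?thesis using \<open>f \<in> pair_coords n N\<close> by (simp add: polynomial_functions.coord)
    qed
  qed
  have "frame_preimage n N ?W = (\<Union>g\<in>{g \<in> carrier_mat n n. invertible_mat g}. {p \<in> ?S. R (\<phi> g p) \<noteq> 0})"
  proof (intro equalityI subsetI)
    fix p assume "p \<in> frame_preimage n N ?W"
    then obtain A u V A' where p: "p = (A, u)" "A \<in> frames n N V" "V \<in> Gr n N" "u \<in> carrier_mat N N"
      "A' \<in> frames n N V" "R (A', u) \<noteq> 0"
      unfolding frame_preimage_def by blast
    obtain g where g: "g \<in> carrier_mat n n" "invertible_mat g" "A' = A * g"
      by (rule frames_change_of_basis[OF p(3,2,5)])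
    have "A \<in> carrier_mat N n" using p(2) by (simp add: frames_iff)
    then have "R (\<phi> g p) \<noteq> 0" using p(1,6) g \<phi> by simp
    moreover have "p \<in> ?S" using p unfolding frame_preimage_def by blast
    ultimately show "p \<in> (\<Union>g\<in>{g \<in> carrier_mat n n. invertible_mat g}. {p \<in> ?S. R (\<phi> g p) \<noteq> 0})"
      using g by blast
  next
    fix p assume "p \<in> (\<Union>g\<in>{g \<in> carrier_mat n n. invertible_mat g}. {p \<in> ?S. R (\<phi> g p) \<noteq> 0})"
    then obtain g where g: "g \<in> carrier_mat n n" "invertible_mat g" "p \<in> ?S" "R (\<phi> g p) \<noteq> 0" by blast
    then obtain A u V where p: "p = (A, u)" "A \<in> frames n N V" "V \<in> Gr n N" "u \<in> carrier_mat N N"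
      unfolding frame_preimage_def by blast
    have "A \<in> carrier_mat N n" using p(2) by (simp add: frames_iff)
    then have "R (A * g, u) \<noteq> 0" using p(1) g \<phi> by simp
    moreover have "A * g \<in> frames n N V" by (rule frames_mult[OF p(2) g(1,2)])
    ultimately show "p \<in> frame_preimage n N ?W" using p unfolding frame_preimage_def by blast
  qed
  moreover have "openin (zariski (pair_coords n N) ?S)
      (\<Union>g\<in>{g \<in> carrier_mat n n. invertible_mat g}. {p \<in> ?S. R (\<phi> g p) \<noteq> 0})"
    by (intro openin_Union) (auto intro: openin_zariski_nonvanishing[OF R\<phi>])
  ultimately show "openin (zariski (pair_coords n N) ?S) (frame_preimage n N ?W)" by simp
qed

text \<open>Where a section is nonzero, the product of a local numerator and denominator is nonzero.
  This product defines an open set, which meets the dense conormal bundle, and there the quotient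
  would be a nonzero value of the section.\<close>

lemma section_zero_if_zero_on_conormal_bundle:
  assumes \<sigma>: "\<sigma> \<in> pullback_O_sections n N k (conormal_schubert n N r)"
    and zero: "\<And>V u A. (V, u) \<in> conormal_bundle n N (schubert_cell n N r) \<Longrightarrow> A \<in> frames n N V \<Longrightarrow>
      \<sigma> (V, u) A = 0"
  shows "\<sigma> = (\<lambda>_ _. 0)"
proof (intro ext)
  fix z0 A0
  let ?Z = "conormal_schubert n N r" and ?B = "conormal_bundle n N (schubert_cell n N r)"
  have fib: "\<forall>z\<in>?Z. \<sigma> z \<in> O_fibre n N k (f_GP z)" and off: "\<forall>z. z \<notin> ?Z \<longrightarrow> \<sigma> z = (\<lambda>_. 0)"
    and loc: "\<forall>z\<^sub>0 \<in> ?Z. \<forall>A\<^sub>0 \<in> frames n N (f_GP z\<^sub>0).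
        \<exists>P \<in> polynomial_functions (pair_coords n N). \<exists>Q \<in> polynomial_functions (pair_coords n N).
          Q (A\<^sub>0, snd z\<^sub>0) \<noteq> 0 \<and>
          (\<forall>z \<in> ?Z. \<forall>A \<in> frames n N (f_GP z). Q (A, snd z) \<noteq> 0 \<longrightarrow>
             \<sigma> z A = P (A, snd z) / Q (A, snd z))"
    using \<sigma> unfolding pullback_O_sections_def by simp_all
  show "\<sigma> z0 A0 = 0"
  proof (rule ccontr)
    assume nz: "\<sigma> z0 A0 \<noteq> 0"
    have z0: "z0 \<in> ?Z"
    proof (rule ccontr)
      assume "z0 \<notin> ?Z"
      then have "\<sigma> z0 = (\<lambda>_. 0)" using off by blast
      then show False using nz by simp
    qed
    have A0: "A0 \<in> frames n N (f_GP z0)"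
      using fib[rule_format, OF z0] nz unfolding O_fibre_def by (rule_tac ccontr) simp
    obtain P Q where PQ: "P \<in> polynomial_functions (pair_coords n N)"
      "Q \<in> polynomial_functions (pair_coords n N)" "Q (A0, snd z0) \<noteq> 0"
      and eq: "\<forall>z \<in> ?Z. \<forall>A \<in> frames n N (f_GP z). Q (A, snd z) \<noteq> 0 \<longrightarrow>
        \<sigma> z A = P (A, snd z) / Q (A, snd z)"
      using loc[rule_format, OF z0 A0] by (elim bexE conjE) simp
    define R where "R p = P p * Q p" for p
    have "R \<in> polynomial_functions (pair_coords n N)"
      unfolding R_def by (rule polynomial_functions.mult[OF PQ(1,2)])
    note opn = openin_Gr_mat_nonvanishing[OF this]
    let ?W = "{(V, u). V \<in> Gr n N \<and> u \<in> carrier_mat N N \<and> (\<exists>A \<in> frames n N V. R (A, u) \<noteq> 0)}"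
    have "P (A0, snd z0) \<noteq> 0" using nz eq[rule_format, OF z0 A0 PQ(3)] by auto
    then have R0: "R (A0, snd z0) \<noteq> 0" using PQ(3) by (simp add: R_def)
    have cot0: "z0 \<in> cotangent_Gr n N" by (rule subsetD[OF conormal_schubert_subset z0])
    have "z0 \<in> ?W"
    proof -
      obtain V u where z: "z0 = (V, u)" by (cases z0)
      have "V \<in> Gr n N" "u \<in> carrier_mat N N" using cot0 by (simp_all add: z cotangent_Gr_def)
      moreover have "\<exists>A \<in> frames n N V. R (A, u) \<noteq> 0" using A0 R0 by (auto simp: z f_GP_def)
      ultimately show ?thesis by (simp add: z)
    qed
    then have mem: "z0 \<in> ?W \<inter> cotangent_Gr n N" using cot0 by (rule IntI)
    have op: "openin (subtopology (Gr_mat_topology n N) (cotangent_Gr n N)) (?W \<inter> cotangent_Gr n N)"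
      by (rule openin_subtopology_Int[OF opn])
    have "\<forall>T. z0 \<in> T \<and> openin (subtopology (Gr_mat_topology n N) (cotangent_Gr n N)) T \<longrightarrow>
        (\<exists>z. z \<in> ?B \<and> z \<in> T)"
      using z0 unfolding conormal_schubert_def in_closure_of by (rule conjunct2)
    from this[THEN spec, THEN mp, OF conjI[OF mem op]]
    obtain z1 where z1: "z1 \<in> ?B" "z1 \<in> ?W" by blast
    obtain V1 u1 where z1eq: "z1 = (V1, u1)" by (cases z1)
    obtain A1 where A1: "A1 \<in> frames n N V1" "R (A1, u1) \<noteq> 0" using z1(2) unfolding z1eq by blast
    then have PQ1: "P (A1, u1) \<noteq> 0" "Q (A1, u1) \<noteq> 0" by (simp_all add: R_def)
    have z1Z: "(V1, u1) \<in> ?Z" using z1(1) conormal_bundle_subset_schubert unfolding z1eq by blast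
    have "\<sigma> (V1, u1) A1 = P (A1, u1) / Q (A1, u1)"
      using eq[rule_format, OF z1Z, of A1] A1(1) PQ1 by (simp add: f_GP_def)
    moreover have "\<sigma> (V1, u1) A1 = 0" by (rule zero[OF _ A1(1)]) (use z1(1) z1eq in simp)
    ultimately show False using PQ1 by simp
  qed
qed

lemma zero_section: "(\<lambda>_ _. 0) \<in> pullback_O_sections n N k Z"
  unfolding pullback_O_sections_def
proof (intro CollectI conjI ballI allI impI)
  fix z A assume "z \<in> Z" "A \<in> frames n N (f_GP z)"
  show "\<exists>P \<in> polynomial_functions (pair_coords n N). \<exists>Q \<in> polynomial_functions (pair_coords n N).
      Q (A, snd z) \<noteq> 0 \<and> (\<forall>z \<in> Z. \<forall>A \<in> frames n N (f_GP z). Q (A, snd z) \<noteq> 0 \<longrightarrow>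
        0 = P (A, snd z) / Q (A, snd z))"
    by (rule bexI[of _ "\<lambda>_. 0"], rule bexI[of _ "\<lambda>_. 1"]) (simp_all add: polynomial_functions.const)
qed (simp_all add: O_fibre_def)

theorem mainTheorem7:
  fixes n N d :: nat and r :: "(nat \<times> nat) set"
  assumes "n \<le> N" and "even N"
    and "young_diagram n N r"
    and "\<forall>(x, y) \<in> outer_corners n N r. x + y - 1 = d"
    and "holds_generally
           (zariski (mat_coords N N) (mu ` conormal_schubert n N r))
           (\<lambda>w. \<not> is_singleton {z \<in> conormal_schubert n N r. mu z = w})"
  shows "pullback_O_sections n N (int (N div 2) - int d - 1) (conormal_schubert n N r) =
           {\<lambda>_ _. 0}"
proof -
  have not_inj: "\<not> (r = {} \<or> d + 1 \<le> max n (N - n))"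
    using mu_generically_injective[OF assms(1,3) _ assms(4)] assms(5) by blast
  then have r: "r \<noteq> {}" and d: "n \<le> d" "N - n \<le> d" by auto
  \<comment> \<open>Adding the two bounds gives \<open>N \<le> 2 * d\<close>.\<close>
  have k: "int (N div 2) - int d - 1 < 0" using d by linarith
  show ?thesis
  proof (intro equalityI subsetI)
    fix \<sigma> assume \<sigma>: "\<sigma> \<in> pullback_O_sections n N (int (N div 2) - int d - 1) (conormal_schubert n N r)"
    have "\<sigma> = (\<lambda>_ _. 0)"
      by (rule section_zero_if_zero_on_conormal_bundle[OF \<sigma>])
        (rule sections_vanish_on_conormal_bundle[OF assms(1,3) r d assms(4) \<sigma> k])
    then show "\<sigma> \<in> {\<lambda>_ _. 0}" by simp
  next
    fix \<sigma> :: "complex vec set \<times> complex mat \<Rightarrow> complex mat \<Rightarrow> complex"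
    assume "\<sigma> \<in> {\<lambda>_ _. 0}"
    then show "\<sigma> \<in> pullback_O_sections n N (int (N div 2) - int d - 1) (conormal_schubert n N r)"
      using zero_section by simp
  qed
qed

end
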